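(* Let $N>2$ be an integer, let $\Omega\subset\mathbb{R}^N$ be a bounded open set, and let $a:\Omega\to\mathbb{R}$ be a measurable function for which there are positive constants $\alpha,\beta$ with $\alpha\le a(x)\le\beta$ for almost every $x\in\Omega$. Let $\theta=\frac{1}{N-1}$, and let $f\in L^1(\Omega)$ be such that $f\log(1+|f|)\in L^1(\Omega)$. Then there exists a function $u\in W^{1,1}_0(\Omega)$ which is a distributional solution of the problem $$-\operatorname{div}\left(\frac{a(x)\nabla u}{(1+|u|)^\theta}\right)=f \ \text{ in }\Omega,\qquad u=0\ \text{ on }\partial\Omega.$$
   Context: A function $u\in W^{1,1}_0(\Omega)$ is a distributional solution of the problem $-\operatorname{div}\left(\frac{a(x)\nabla u}{(1+|u|)^\theta}\right)=f$ in $\Omega$, $u=0$ on $\partial\Omega$, if $$\int_\Omega \frac{a(x)\,\nabla u}{(1+|u|)^\theta}\cdot\nabla\varphi\,dx=\int_\Omega f\,\varphi\,dx\qquad\text{for all }\varphi\in C_0^\infty(\Omega).$$ The boundary condition $u=0$ on $\partial\Omega$ is understood as membership in $W^{1,1}_0(\Omega)$, the closure of $C_0^\infty(\Omega)$ in $W^{1,1}(\Omega)$. Here $C_0^\infty(\Omega)$ denotes the smooth functions with compact support in $\Omega$. *)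

theory Defs
  imports "HOL-Analysis.Analysis"
begin

text \<open>
  Functions on \<open>\<Omega>\<close> are represented by functions on the whole space whose values outside \<open>\<Omega>\<close> do not
  matter: all integrability, measurability and almost-everywhere conditions refer to Lebesgue
  measure restricted to \<open>\<Omega>\<close>. Elements of \<open>L\<^sup>1(\<Omega>)\<close> are represented by functions rather than by
  almost-everywhere equivalence classes.
\<close>

primrec C_k :: "nat \<Rightarrow> ('a::euclidean_space \<Rightarrow> real) \<Rightarrow> bool" where
  "C_k 0 f \<longleftrightarrow> continuous_on UNIV f"
| "C_k (Suc k) f \<longleftrightarrow>
     f differentiable_on UNIV \<and> (\<forall>v. C_k k (\<lambda>x. frechet_derivative f (at x) v))"

text \<open>
  \<open>C\<^sub>0\<^sup>\<infinity>(\<Omega>)\<close>: each such function is identified with its extension by zero, which for an open set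
  \<open>\<Omega>\<close> is smooth on the whole space.
\<close>

definition test_functions :: "'a::euclidean_space set \<Rightarrow> ('a \<Rightarrow> real) set" where
  "test_functions \<Omega> =
     {\<phi>. (\<forall>k. C_k k \<phi>) \<and> compact (closure {x. \<phi> x \<noteq> 0}) \<and> closure {x. \<phi> x \<noteq> 0} \<subseteq> \<Omega>}"

definition grad :: "(real ^ 'n \<Rightarrow> real) \<Rightarrow> real ^ 'n \<Rightarrow> real ^ 'n" where
  "grad \<phi> x = (\<chi> i. frechet_derivative \<phi> (at x) (axis i 1))"

text \<open>
  The weak gradient is a relation (like \<^const>\<open>has_derivative\<close>), because it is determined only up to
  null sets. The integrability conditions make the relation hold for some \<open>G\<close> exactly when
  \<open>u \<in> W\<^sup>1\<^sup>,\<^sup>1(\<Omega>)\<close>.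
\<close>

definition has_weak_gradient ::
    "(real ^ 'n \<Rightarrow> real) \<Rightarrow> (real ^ 'n \<Rightarrow> real ^ 'n) \<Rightarrow> (real ^ 'n) set \<Rightarrow> bool" where
  "has_weak_gradient u G \<Omega> \<longleftrightarrow>
     integrable (lebesgue_on \<Omega>) u \<and> integrable (lebesgue_on \<Omega>) G \<and>
     (\<forall>\<phi>\<in>test_functions \<Omega>. \<forall>i.
        (LINT x|lebesgue_on \<Omega>. u x * grad \<phi> x $ i) =
        - (LINT x|lebesgue_on \<Omega>. G x $ i * \<phi> x))"

definition W11 :: "(real ^ 'n) set \<Rightarrow> (real ^ 'n \<Rightarrow> real) set" where
  "W11 \<Omega> = {u. \<exists>G. has_weak_gradient u G \<Omega>}"

text \<open>
  The closure of \<open>C\<^sub>0\<^sup>\<infinity>(\<Omega>)\<close> in \<open>W\<^sup>1\<^sup>,\<^sup>1(\<Omega>)\<close>; the sum of integrals is the \<open>W\<^sup>1\<^sup>,\<^sup>1\<close>-norm of \<open>u - \<phi>\<close>.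
\<close>

definition W11_0 :: "(real ^ 'n) set \<Rightarrow> (real ^ 'n \<Rightarrow> real) set" where
  "W11_0 \<Omega> = {u \<in> W11 \<Omega>. \<forall>\<epsilon>>0. \<exists>\<phi>\<in>test_functions \<Omega>. \<exists>H.
      has_weak_gradient (\<lambda>x. u x - \<phi> x) H \<Omega> \<and>
      (LINT x|lebesgue_on \<Omega>. \<bar>u x - \<phi> x\<bar>) + (LINT x|lebesgue_on \<Omega>. norm (H x)) < \<epsilon>}"

definition distributional_solution ::
    "(real ^ 'n) set \<Rightarrow> (real ^ 'n \<Rightarrow> real) \<Rightarrow> real \<Rightarrow> (real ^ 'n \<Rightarrow> real) \<Rightarrow>
     (real ^ 'n \<Rightarrow> real) \<Rightarrow> bool" where
  "distributional_solution \<Omega> a \<theta> f u \<longleftrightarrow>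
     u \<in> W11_0 \<Omega> \<and>
     (\<exists>G. has_weak_gradient u G \<Omega> \<and>
       (\<forall>\<phi>\<in>test_functions \<Omega>.
          (LINT x|lebesgue_on \<Omega>. ((a x / (1 + \<bar>u x\<bar>) powr \<theta>) *\<^sub>R G x) \<bullet> grad \<phi> x) =
          (LINT x|lebesgue_on \<Omega>. f x * \<phi> x)))"

end

theory Submission
  imports Defs
begin

text \<open>
  Put \<open>p = 1 / (N - 2)\<close>, \<open>b(s) = 1 + \<bar>s\<bar> / (1 + p)\<close> and let \<open>B\<close> be the odd function with \<open>B' = b\<^sup>p\<close>.
  The substitution \<open>u = B(v)\<close> turns the equation into the linear one \<open>- div (a \<nabla>v) = f\<close>, and
  what has to be shown is that \<open>\<nabla>u = b(v)\<^sup>p \<nabla>v\<close> is integrable.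

  Testing the linear equation with the odd function \<open>g\<close> with \<open>g' = 1 / b\<close>, of logarithmic growth,
  bounds the integral \<open>E\<close> of \<open>\<bar>\<nabla>v\<bar>\<^sup>2 / b(v)\<close> in terms of the \<open>L log L\<close> size of \<open>f\<close> and a small power of the
  integral \<open>m\<close> of \<open>b(v)\<close> to the power \<open>N / (N - 2)\<close>. By the Cauchy--Schwarz inequality the square of the
  \<open>L\<^sup>1\<close> norm of \<open>\<nabla>B(v)\<close> is at most \<open>E m\<close>, and the Sobolev inequality for the exponent
  \<open>N / (N - 1)\<close>, applied to \<open>B(v)\<close>, bounds \<open>m\<close> by a sublinear power of itself.

  For the approximate solutions \<open>v\<^sub>n\<close> with truncated data, the same estimate applies to
  \<open>\<lambda>(v\<^sub>n - v\<^sub>m)\<close> with a constant independent of \<open>\<lambda>\<close> once \<open>n\<close> and \<open>m\<close> are large. Letting \<open>\<lambda>\<close>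
  tend to infinity shows that \<open>\<nabla>v\<^sub>n\<close> and \<open>\<nabla>B(v\<^sub>n)\<close> are Cauchy in \<open>L\<^sup>1\<close>.
\<close>

section \<open>Test functions\<close>

text \<open>The value of \<open>p\<close> comes from matching two exponents. The Cauchy--Schwarz
  step costs the integral of \<open>b^(1 + 2p)\<close>, while the Sobolev inequality for
  \<open>B(v)\<close>, which grows like \<open>b^(1 + p)\<close>, controls that of
  \<open>b^((1 + p) N / (N - 1))\<close>. They agree exactly for \<open>p = 1 / (N - 2)\<close>, and
  then \<open>p / (1 + p)\<close> is the given \<theta>. A logarithm is the growth that
  \<open>L log L\<close> data can be paired with: what remains is a power of \<open>b(v)\<close> as
  small as desired. With the power 1/4 the loop closes, since \<open>m\<close> is bounded by a
  constant plus a multiple of \<open>(m^(1/4) m)^(3/4)\<close> at worst. The obstacle is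
  compactness: bounded gradients in \<open>L^1\<close> need not have a weakly convergent
  subsequence. Linearity in \<open>v\<close> replaces compactness. The difference \<lambda>(v_n -
  v_m) has the data \<lambda>(f_n - f_m), whose \<open>L log L\<close> size is at most 1 for late
  indices, whatever \<lambda> is; undoing the scaling gains 1/\<lambda>. The nonlinear factor
  \<open>b^p\<close> is only compared through its Hoelder continuity, which gains \<lambda> to the
  power \<open>-p\<close>.\<close>

lemma C_k_Suc_imp: "C_k (Suc k) f \<Longrightarrow> C_k k f"
proof (induction k arbitrary: f)
  case 0
  then show ?case by (simp add: differentiable_imp_continuous_on)
next
  case (Suc k)
  then have "f differentiable_on UNIV" "\<And>v. C_k (Suc k) (\<lambda>x. frechet_derivative f (at x) v)"
    by simp_all
  with Suc.IH show ?case by (subst C_k.simps(2)) blast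
qed

lemma has_derivative_frechet_UNIV:
  "f differentiable_on UNIV \<Longrightarrow> (f has_derivative frechet_derivative f (at x)) (at x)"
  by (simp add: differentiable_on_def flip: frechet_derivative_works)

lemma C_k_const: "C_k k (\<lambda>_. c)"
  by (induction k arbitrary: c) simp_all

lemma C_k_add: "C_k k f \<Longrightarrow> C_k k g \<Longrightarrow> C_k k (\<lambda>x. f x + g x)"
proof (induction k arbitrary: f g)
  case 0
  then show ?case by (simp add: continuous_on_add)
next
  case (Suc k)
  then have d: "f differentiable_on UNIV" "g differentiable_on UNIV" by auto
  have "frechet_derivative (\<lambda>x. f x + g x) (at x) =
      (\<lambda>v. frechet_derivative f (at x) v + frechet_derivative g (at x) v)" for x
    by (rule frechet_derivative_at[symmetric])
      (intro has_derivative_add has_derivative_frechet_UNIV d)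
  then show ?case using Suc d by simp
qed

lemma C_k_mult: "C_k k f \<Longrightarrow> C_k k g \<Longrightarrow> C_k k (\<lambda>x. f x * g x)"
proof (induction k arbitrary: f g)
  case 0
  then show ?case by (simp add: continuous_on_mult)
next
  case (Suc k)
  then have d: "f differentiable_on UNIV" "g differentiable_on UNIV" by auto
  have e: "frechet_derivative (\<lambda>x. f x * g x) (at x) =
      (\<lambda>v. f x * frechet_derivative g (at x) v + frechet_derivative f (at x) v * g x)" for x
    by (rule frechet_derivative_at[symmetric])
      (intro has_derivative_mult has_derivative_frechet_UNIV d)
  have "C_k k f" "C_k k g" using Suc.prems by (auto intro: C_k_Suc_imp simp del: C_k.simps)
  then have "C_k k (\<lambda>x. f x * frechet_derivative g (at x) v + frechet_derivative f (at x) v * g x)" for v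
    using Suc by (intro C_k_add Suc.IH) simp_all
  then show ?case using d by (simp add: e differentiable_on_mult)
qed

lemma test_functionsI:
  assumes "\<And>k. C_k k \<phi>" "compact K" "K \<subseteq> \<Omega>" "\<And>x. x \<notin> K \<Longrightarrow> \<phi> x = 0"
  shows "\<phi> \<in> test_functions \<Omega>"
proof -
  have "closure {x. \<phi> x \<noteq> 0} \<subseteq> K"
    using assms(2,4) by (intro closure_minimal) (auto simp: compact_imp_closed)
  with assms show ?thesis
    unfolding test_functions_def
    by (auto simp: compact_eq_bounded_closed intro: bounded_subset)
qed

lemma test_functionsE:
  assumes "\<phi> \<in> test_functions \<Omega>"
  obtains K where "compact K" "K \<subseteq> \<Omega>" "\<And>x. x \<notin> K \<Longrightarrow> \<phi> x = 0"
  using assms that[of "closure {x. \<phi> x \<noteq> 0}"] closure_subset[of "{x. \<phi> x \<noteq> 0}"]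
  unfolding test_functions_def by blast

lemma test_functions_C_k: "\<phi> \<in> test_functions \<Omega> \<Longrightarrow> C_k k \<phi>"
  by (simp add: test_functions_def)

lemma test_functions_mult_C_k:
  assumes "\<phi> \<in> test_functions \<Omega>" "\<And>k. C_k k \<psi>"
  shows "(\<lambda>x. \<psi> x * \<phi> x) \<in> test_functions \<Omega>"
proof -
  obtain K where "compact K" "K \<subseteq> \<Omega>" "\<And>x. x \<notin> K \<Longrightarrow> \<phi> x = 0"
    using test_functionsE[OF assms(1)] by blast
  then show ?thesis
    using assms by (intro test_functionsI[of _ K]) (auto intro: C_k_mult test_functions_C_k)
qed

lemma test_functions_mult:
  "\<phi> \<in> test_functions \<Omega> \<Longrightarrow> \<psi> \<in> test_functions \<Omega> \<Longrightarrow> (\<lambda>x. \<psi> x * \<phi> x) \<in> test_functions \<Omega>"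
  by (rule test_functions_mult_C_k) (auto intro: test_functions_C_k)

lemma test_functions_cmult: "\<phi> \<in> test_functions \<Omega> \<Longrightarrow> (\<lambda>x. c * \<phi> x) \<in> test_functions \<Omega>"
  by (rule test_functions_mult_C_k) (auto intro: C_k_const)

lemma test_functions_add:
  assumes "\<phi> \<in> test_functions \<Omega>" "\<psi> \<in> test_functions \<Omega>"
  shows "(\<lambda>x. \<phi> x + \<psi> x) \<in> test_functions \<Omega>"
proof -
  obtain K L where "compact K" "K \<subseteq> \<Omega>" "\<And>x. x \<notin> K \<Longrightarrow> \<phi> x = 0"
    "compact L" "L \<subseteq> \<Omega>" "\<And>x. x \<notin> L \<Longrightarrow> \<psi> x = 0"
    using test_functionsE assms by metis
  then show ?thesis
    using assms by (intro test_functionsI[of _ "K \<union> L"]) (auto intro: C_k_add test_functions_C_k)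
qed

lemma test_functions_zero: "(\<lambda>_. 0) \<in> test_functions \<Omega>"
  by (rule test_functionsI[of _ "{}"]) (auto intro: C_k_const)

lemma test_functions_sum:
  assumes "finite I" "\<And>i. i \<in> I \<Longrightarrow> \<phi> i \<in> test_functions \<Omega>"
  shows "(\<lambda>x. \<Sum>i\<in>I. \<phi> i x) \<in> test_functions \<Omega>"
  using assms by (induction I rule: finite_induct) (auto intro: test_functions_zero test_functions_add)

lemma test_functions_power:
  "\<phi> \<in> test_functions \<Omega> \<Longrightarrow> (\<lambda>x. \<phi> x ^ Suc n) \<in> test_functions \<Omega>"
proof (induction n)
  case (Suc n)
  then have "(\<lambda>x. \<phi> x * \<phi> x ^ Suc n) \<in> test_functions \<Omega>"
    by (intro test_functions_mult)
  then show ?case by simp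
qed simp

text \<open>Even for smooth \<open>w\<close> the function \<open>transform p (w x)\<close> is only
  of class C^1, because \<open>weight p\<close> has a kink at 0. This class makes the Sobolev
  inequality and integration by parts available for such compositions.\<close>

definition C1c :: "'a::euclidean_space set \<Rightarrow> ('a \<Rightarrow> real) \<Rightarrow> ('a \<Rightarrow> 'a) \<Rightarrow> bool" where
  "C1c \<Omega> z Z \<longleftrightarrow> (\<forall>x. (z has_derivative (\<lambda>h. Z x \<bullet> h)) (at x)) \<and> continuous_on UNIV Z \<and>
     (\<exists>K. compact K \<and> K \<subseteq> \<Omega> \<and> (\<forall>x. x \<notin> K \<longrightarrow> z x = 0))"

lemma C1c_D:
  assumes "C1c \<Omega> z Z"
  shows "(z has_derivative (\<lambda>h. Z x \<bullet> h)) (at x)" "continuous_on UNIV Z" "continuous_on UNIV z"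
  using assms unfolding C1c_def
  by (auto simp: continuous_on_eq_continuous_at intro: has_derivative_continuous)

text \<open>Off \<open>K\<close> the function vanishes on an open set, hence so does its derivative,
  and one compact set serves both \<open>z\<close> and \<open>Z\<close>.\<close>

lemma C1c_support:
  assumes "C1c \<Omega> z Z"
  obtains K where "compact K" "K \<subseteq> \<Omega>" "\<And>x. x \<notin> K \<Longrightarrow> z x = 0" "\<And>x. x \<notin> K \<Longrightarrow> Z x = 0"
proof -
  obtain K where K: "compact K" "K \<subseteq> \<Omega>" "\<And>x. x \<notin> K \<Longrightarrow> z x = 0"
    using assms unfolding C1c_def by blast
  have "Z x = 0" if x: "x \<notin> K" for x
  proof -
    have "open (- K)" using K(1) by (simp add: compact_imp_closed open_Compl)
    then have "(z has_derivative (\<lambda>h. 0)) (at x)"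
      by (rule has_derivative_transform_within_open[OF has_derivative_const, of "-K" x 0 z]) (use x K in auto)
    then have "(\<lambda>h. Z x \<bullet> h) = (\<lambda>h. 0)"
      using C1c_D(1)[OF assms] has_derivative_unique by blast
    then have "Z x \<bullet> Z x = 0" by metis
    then show ?thesis by simp
  qed
  with K that show ?thesis by blast
qed

lemma grad_eqI:
  fixes Z :: "real^'n"
  assumes "(z has_derivative (\<lambda>h. Z \<bullet> h)) (at x)"
  shows "grad z x = Z"
  unfolding grad_def vec_eq_iff
  using frechet_derivative_at[OF assms, symmetric] by (simp add: inner_axis)

lemma C1c_grad:
  fixes \<phi> :: "real^'n \<Rightarrow> real"
  assumes "\<phi> \<in> test_functions \<Omega>"
  shows "C1c \<Omega> \<phi> (grad \<phi>)"
proof -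
  have C: "C_k (Suc 0) \<phi>" using assms by (rule test_functions_C_k)
  then have D: "(\<phi> has_derivative frechet_derivative \<phi> (at x)) (at x)" for x
    by (intro has_derivative_frechet_UNIV) simp
  have "frechet_derivative \<phi> (at x) h = grad \<phi> x \<bullet> h" for x h
  proof -
    interpret bounded_linear "frechet_derivative \<phi> (at x)"
      using D by (rule has_derivative_bounded_linear)
    have "h = (\<Sum>i\<in>UNIV. h $ i *\<^sub>R axis i 1)"
      by (simp add: vec_eq_iff axis_def if_distrib cong: if_cong)
    then have "frechet_derivative \<phi> (at x) h = frechet_derivative \<phi> (at x) (\<Sum>i\<in>UNIV. h $ i *\<^sub>R axis i 1)"
      by simp
    also have "\<dots> = (\<Sum>i\<in>UNIV. h $ i * frechet_derivative \<phi> (at x) (axis i 1))"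
      by (simp add: sum scaleR)
    finally show ?thesis by (simp add: grad_def inner_vec_def mult.commute)
  qed
  with D have "(\<phi> has_derivative (\<lambda>h. grad \<phi> x \<bullet> h)) (at x)" for x
    by (metis (no_types, lifting) ext)
  moreover have "continuous_on UNIV (grad \<phi>)"
    unfolding grad_def using C by (intro continuous_on_vec_lambda) simp
  ultimately show ?thesis
    unfolding C1c_def using test_functionsE[OF assms] by metis
qed

lemmas has_derivative_grad = C1c_D(1)[OF C1c_grad]

lemma grad_add:
  "\<phi> \<in> test_functions \<Omega> \<Longrightarrow> \<psi> \<in> test_functions \<Omega> \<Longrightarrow> grad (\<lambda>x. \<phi> x + \<psi> x) x = grad \<phi> x + grad \<psi> x"
  by (rule grad_eqI) (auto intro!: derivative_eq_intros has_derivative_grad simp: inner_add_left)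

lemma grad_cmult: "\<phi> \<in> test_functions \<Omega> \<Longrightarrow> grad (\<lambda>x. c * \<phi> x) x = c *\<^sub>R grad \<phi> x"
  by (rule grad_eqI) (auto intro!: derivative_eq_intros has_derivative_grad simp: mult.commute)

lemma C1c_compose:
  assumes "C1c \<Omega> z Z" "\<And>s. (g has_field_derivative g' s) (at s)" "continuous_on UNIV g'" "g 0 = 0"
  shows "C1c \<Omega> (\<lambda>x. g (z x)) (\<lambda>x. g' (z x) *\<^sub>R Z x)"
proof -
  have "((\<lambda>x. g (z x)) has_derivative (\<lambda>h. (g' (z x) *\<^sub>R Z x) \<bullet> h)) (at x)" for x
    using has_derivative_compose[OF C1c_D(1)[OF assms(1)], of g "(*) (g' (z x))" x]
      assms(2)[of "z x"] by (simp add: has_field_derivative_def)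
  moreover have "continuous_on UNIV (\<lambda>x. g' (z x) *\<^sub>R Z x)"
    using C1c_D(2,3)[OF assms(1)] continuous_on_compose2[OF assms(3), of UNIV z]
    by (intro continuous_on_scaleR) auto
  ultimately show ?thesis
    using C1c_support[OF assms(1)] assms(4) unfolding C1c_def by metis
qed

lemma C1c_bounded:
  assumes "C1c \<Omega> z Z"
  obtains B where "B > 0" "\<And>x. \<bar>z x\<bar> \<le> B" "\<And>x. norm (Z x) \<le> B"
proof -
  obtain K where K: "compact K" "K \<subseteq> \<Omega>" "\<And>x. x \<notin> K \<Longrightarrow> z x = 0" "\<And>x. x \<notin> K \<Longrightarrow> Z x = 0"
    using C1c_support[OF assms] by blast
  have "bounded (z ` K)" "bounded (Z ` K)"
    using C1c_D(2,3)[OF assms] K(1)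
    by (auto intro!: compact_imp_bounded compact_continuous_image intro: continuous_on_subset)
  then obtain a b where "a > 0" "b > 0" "\<forall>x\<in>K. \<bar>z x\<bar> \<le> a" "\<forall>x\<in>K. norm (Z x) \<le> b"
    by (auto simp: bounded_pos)
  then have "\<bar>z x\<bar> \<le> a + b" "norm (Z x) \<le> a + b" for x
    using K(3,4)[of x] by (cases "x \<in> K"; force)+
  with \<open>a > 0\<close> \<open>b > 0\<close> that[of "a + b"] show ?thesis by auto
qed

text \<open>
  \<open>g \<circ> \<phi>\<close> need not be smooth; integrating a Weierstrass approximation of \<open>g'\<close> from \<open>0\<close> gives a
  polynomial without constant term, which maps test functions to test functions.
\<close>

lemma test_functions_approx_compose:
  fixes \<phi> :: "real^'n \<Rightarrow> real"
  assumes \<phi>: "\<phi> \<in> test_functions \<Omega>"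
    and g: "\<And>s. (g has_field_derivative g' s) (at s)" "continuous_on UNIV g'" "g 0 = 0"
    and "\<epsilon> > 0"
  obtains \<psi> where "\<psi> \<in> test_functions \<Omega>" "\<And>x. \<bar>\<psi> x - g (\<phi> x)\<bar> \<le> \<epsilon>"
    "\<And>x. norm (grad \<psi> x - g' (\<phi> x) *\<^sub>R grad \<phi> x) \<le> \<epsilon>"
proof -
  obtain B where B: "B > 0" "\<And>x. \<bar>\<phi> x\<bar> \<le> B" "\<And>x. norm (grad \<phi> x) \<le> B"
    using C1c_bounded[OF C1c_grad[OF \<phi>]] by blast
  have "continuous_on {-B..B} g'" using g(2) continuous_on_subset by blast
  \<comment> \<open>The tolerance \<open>\<epsilon> / B\<close> is used twice: the gradient error is
    multiplied by a vector of norm at most \<open>B\<close>, and the error of the function arises by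
    integration over a length of at most \<open>B\<close>.\<close>
  then obtain q where q: "real_polynomial_function q" "\<And>s. s \<in> {-B..B} \<Longrightarrow> \<bar>g' s - q s\<bar> < \<epsilon> / B"
    using Stone_Weierstrass_real_polynomial_function[of "{-B..B}" g' "\<epsilon> / B"] \<open>\<epsilon> > 0\<close> \<open>B > 0\<close>
    by auto
  obtain a n where an: "q = (\<lambda>s. \<Sum>i\<le>n. a i * s ^ i)"
    using q(1) by (auto simp: real_polynomial_function_iff_sum)
  define P where "P s = (\<Sum>i\<le>n. a i / real (Suc i) * s ^ Suc i)" for s
  have P': "(P has_field_derivative q s) (at s)" for s
    unfolding P_def[abs_def] an
    by (auto intro!: derivative_eq_intros sum.cong simp del: power_Suc)
  have P0: "P 0 = 0" by (simp add: P_def)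
  have Pt: "(\<lambda>x. P (\<phi> x)) \<in> test_functions \<Omega>"
    unfolding P_def by (intro test_functions_sum test_functions_cmult test_functions_power \<phi>) auto
  have "C1c \<Omega> (\<lambda>x. P (\<phi> x)) (\<lambda>x. q (\<phi> x) *\<^sub>R grad \<phi> x)"
    using P' P0 an by (intro C1c_compose C1c_grad \<phi>) (auto intro!: continuous_intros)
  then have gP: "grad (\<lambda>x. P (\<phi> x)) x = q (\<phi> x) *\<^sub>R grad \<phi> x" for x
    by (intro grad_eqI C1c_D(1))
  have Pg: "\<bar>P s - g s\<bar> \<le> \<epsilon>" if "s \<in> {-B..B}" for s
  proof -
    have "norm ((P s - g s) - (P 0 - g 0)) \<le> \<epsilon> / B * norm (s - 0)"
      by (rule field_differentiable_bound[of "{-B..B}" _ "\<lambda>s. q s - g' s"])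
        (use that B(1) q(2) in \<open>auto intro!: DERIV_diff has_field_derivative_at_within[OF P']
           has_field_derivative_at_within[OF g(1)] less_imp_le simp: abs_minus_commute\<close>)
    also have "\<dots> \<le> \<epsilon> / B * B" using that \<open>\<epsilon> > 0\<close> \<open>B > 0\<close> by (intro mult_left_mono) auto
    finally show ?thesis using P0 g(3) \<open>B > 0\<close> by simp
  qed
  show ?thesis
  proof (rule that[OF Pt])
    fix x
    have s: "\<phi> x \<in> {-B..B}" using B(2)[of x] by (simp add: abs_le_iff)
    show "\<bar>P (\<phi> x) - g (\<phi> x)\<bar> \<le> \<epsilon>" using Pg[OF s] .
    have "norm (grad (\<lambda>x. P (\<phi> x)) x - g' (\<phi> x) *\<^sub>R grad \<phi> x) = \<bar>g' (\<phi> x) - q (\<phi> x)\<bar> * norm (grad \<phi> x)"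
      unfolding gP by (metis abs_minus_commute norm_scaleR scaleR_left_diff_distrib)
    also have "\<dots> \<le> \<epsilon> / B * B" using q(2)[OF s] B(3) \<open>\<epsilon> > 0\<close> \<open>B > 0\<close> by (intro mult_mono) auto
    finally show "norm (grad (\<lambda>x. P (\<phi> x)) x - g' (\<phi> x) *\<^sub>R grad \<phi> x) \<le> \<epsilon>" using \<open>B > 0\<close> by simp
  qed
qed

section \<open>The Gagliardo--Nirenberg--Sobolev inequality\<close>

lemma product_sigma_finite_lborel: "product_sigma_finite (\<lambda>_::'i. lborel::real measure)"
  by (simp add: product_sigma_finite_def sigma_finite_lborel)

lemma measurable_fun_upd_component:
  assumes "f \<in> borel_measurable (Pi\<^sub>M (insert j I) (\<lambda>_. lborel :: real measure))"
  shows "(\<lambda>x. f (x(j := t))) \<in> borel_measurable (Pi\<^sub>M I (\<lambda>_. lborel))"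
  by (rule measurable_compose[OF measurable_fun_upd[where J = I] assms]) auto

lemma measurable_fun_upd_pair:
  assumes "f \<in> borel_measurable (Pi\<^sub>M (insert j I) (\<lambda>_. lborel :: real measure))"
  shows "(\<lambda>(t, x). f (x(j := t))) \<in> borel_measurable (lborel \<Otimes>\<^sub>M Pi\<^sub>M I (\<lambda>_. lborel))"
  unfolding split_beta'
  by (rule measurable_compose[OF measurable_fun_upd[where J = I] assms]) auto

text \<open>
  Induction on the number of coordinates. The hypothesis is dual to the inequality for the slices
  \<open>z(\<cdot>, t)\<close>; it is tested against \<open>z(\<cdot>, t)\<close> to the power \<open>1 / n\<close>, whose norm is
  controlled uniformly in \<open>t\<close> by the bound in the direction \<open>j\<close>.
\<close>

lemma gagliardo_step:
  fixes z m :: "('i \<Rightarrow> real) \<Rightarrow> real"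
  defines "L \<equiv> \<lambda>I. Pi\<^sub>M I (\<lambda>_::'i. lborel :: real measure)"
  assumes I: "finite I" "j \<notin> I"
    and meas: "z \<in> borel_measurable (L (insert j I))" "m \<in> borel_measurable (L (insert j I))"
    and nonneg: "\<And>x. z x \<ge> 0" "\<And>x. m x \<ge> 0"
    and bound: "\<And>x. ennreal (z x) \<le> (\<integral>\<^sup>+s. m (x(j := s)) \<partial>lborel)"
    and dual: "\<And>t g G. g \<in> borel_measurable (L I) \<Longrightarrow> (\<And>x. g x \<ge> 0) \<Longrightarrow> G > 0 \<Longrightarrow>
       (\<integral>\<^sup>+x. g x powr n \<partial>L I) \<le> ennreal (G powr n) \<Longrightarrow>
       (\<integral>\<^sup>+x. z (x(j := t)) * g x \<partial>L I) \<le> (\<integral>\<^sup>+x. m (x(j := t)) \<partial>L I) * ennreal G"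
    and "n > 0" "D > 0" and D: "(\<integral>\<^sup>+x. m x \<partial>L (insert j I)) \<le> ennreal D"
  shows "(\<integral>\<^sup>+x. z x powr (1 + 1 / n) \<partial>L (insert j I)) \<le> ennreal (D powr (1 + 1 / n))"
proof -
  interpret product_sigma_finite "\<lambda>_::'i. lborel :: real measure"
    by (rule product_sigma_finite_lborel)
  interpret I: sigma_finite_measure "L I"
    unfolding L_def using I(1) by (rule sigma_finite)
  note [measurable] = meas[unfolded L_def]
  note slice[measurable] = measurable_fun_upd_component[OF meas(1)[unfolded L_def]]
    measurable_fun_upd_component[OF meas(2)[unfolded L_def]]
  have int_m: "(\<integral>\<^sup>+t. (\<integral>\<^sup>+x. m (x(j := t)) \<partial>L I) \<partial>lborel) = (\<integral>\<^sup>+x. m x \<partial>L (insert j I))"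
    unfolding L_def using I by (subst product_nn_integral_insert_rev) auto
  have slice_bound: "(\<integral>\<^sup>+x. z (x(j := t)) * z (x(j := t)) powr (1 / n) \<partial>L I)
      \<le> (\<integral>\<^sup>+x. m (x(j := t)) \<partial>L I) * ennreal (D powr (1 / n))" for t
  proof (rule dual)
    have "(\<integral>\<^sup>+x. (z (x(j := t)) powr (1 / n)) powr n \<partial>L I) = (\<integral>\<^sup>+x. z (x(j := t)) \<partial>L I)"
      using \<open>n > 0\<close> nonneg by (simp add: powr_powr)
    also have "\<dots> \<le> (\<integral>\<^sup>+x. (\<integral>\<^sup>+s. m (x(j := s)) \<partial>lborel) \<partial>L I)"
      using bound[of "_(j := t)"] by (intro nn_integral_mono) simp
    also have "\<dots> = (\<integral>\<^sup>+x. m x \<partial>L (insert j I))"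
      unfolding L_def using I by (subst product_nn_integral_insert) auto
    also have "\<dots> \<le> ennreal ((D powr (1 / n)) powr n)"
      using D \<open>n > 0\<close> \<open>D > 0\<close> by (simp add: powr_powr)
    finally show "(\<integral>\<^sup>+x. (z (x(j := t)) powr (1 / n)) powr n \<partial>L I) \<le> ennreal ((D powr (1 / n)) powr n)" .
    show "(\<lambda>x. z (x(j := t)) powr (1 / n)) \<in> borel_measurable (L I)"
      unfolding L_def by measurable
  qed (use \<open>D > 0\<close> in auto)
  have "(\<integral>\<^sup>+x. z x powr (1 + 1 / n) \<partial>L (insert j I)) = (\<integral>\<^sup>+x. z x * z x powr (1 / n) \<partial>L (insert j I))"
    using nonneg by (intro nn_integral_cong) (simp add: powr_add)
  also have "\<dots> = (\<integral>\<^sup>+t. (\<integral>\<^sup>+x. z (x(j := t)) * z (x(j := t)) powr (1 / n) \<partial>L I) \<partial>lborel)"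
    unfolding L_def using I by (subst product_nn_integral_insert_rev) auto
  also have "\<dots> \<le> (\<integral>\<^sup>+t. (\<integral>\<^sup>+x. m (x(j := t)) \<partial>L I) * ennreal (D powr (1 / n)) \<partial>lborel)"
    using slice_bound by (intro nn_integral_mono) simp
  also have "\<dots> = (\<integral>\<^sup>+t. (\<integral>\<^sup>+x. m (x(j := t)) \<partial>L I) \<partial>lborel) * ennreal (D powr (1 / n))"
  proof (rule nn_integral_multc)
    have "(\<lambda>(t, x). ennreal (m (x(j := t)))) \<in> borel_measurable (lborel \<Otimes>\<^sub>M L I)"
      unfolding L_def using measurable_fun_upd_pair[OF meas(2)[unfolded L_def]] by measurable
    then show "(\<lambda>t. \<integral>\<^sup>+x. m (x(j := t)) \<partial>L I) \<in> borel_measurable lborel"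
      using I.borel_measurable_nn_integral by simp
  qed
  also have "\<dots> \<le> ennreal D * ennreal (D powr (1 / n))"
    unfolding int_m using D by (rule mult_right_mono) simp
  also have "\<dots> = ennreal (D powr (1 + 1 / n))"
    using \<open>D > 0\<close> by (simp add: powr_add flip: ennreal_mult)
  finally show ?thesis .
qed

text \<open>The dual form makes sense for a single coordinate, where the exponent
  \<open>n / (n - 1)\<close> would be infinite, so the induction can start there. In the induction
  step \<open>gagliardo_step\<close> turns the dual form for slices into a norm bound for
  \<open>z\<close>, and Hoelder's inequality turns that back into the dual form.\<close>

lemma gagliardo_dual:
  fixes z m :: "('i \<Rightarrow> real) \<Rightarrow> real"
  defines "L \<equiv> \<lambda>I. Pi\<^sub>M I (\<lambda>_::'i. lborel :: real measure)"
  assumes "finite I" "I \<noteq> {}"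
    and "z \<in> borel_measurable (L I)" "m \<in> borel_measurable (L I)"
    and "\<And>x. z x \<ge> 0" "\<And>x. m x \<ge> 0"
    and "\<And>x i. i \<in> I \<Longrightarrow> ennreal (z x) \<le> (\<integral>\<^sup>+s. m (x(i := s)) \<partial>lborel)"
    and "g \<in> borel_measurable (L I)" "\<And>x. g x \<ge> 0" "G > 0"
    and "(\<integral>\<^sup>+x. g x powr card I \<partial>L I) \<le> ennreal (G powr card I)"
  shows "(\<integral>\<^sup>+x. z x * g x \<partial>L I) \<le> (\<integral>\<^sup>+x. m x \<partial>L I) * ennreal G"
  using assms(2-)
proof (induction I arbitrary: z m g G rule: finite_ne_induct)
  case (singleton i)
  interpret product_sigma_finite "\<lambda>_::'i. lborel :: real measure"
    by (rule product_sigma_finite_lborel)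
  \<comment> \<open>The only point of the product over no coordinates; \<open>x0(i := s)\<close>
    runs through the product over \<open>i\<close> alone.\<close>
  define x0 where "x0 = (\<lambda>_::'i. undefined :: real)"
  have *: "(\<integral>\<^sup>+x. f x \<partial>L {i}) = (\<integral>\<^sup>+s. f (x0(i := s)) \<partial>lborel)"
    if "f \<in> borel_measurable (L {i})" for f :: "_ \<Rightarrow> ennreal"
    unfolding L_def x0_def using that[unfolded L_def]
    by (subst product_nn_integral_insert_rev) (auto simp: PiM_empty nn_integral_count_space_finite fun_upd_def)
  note [measurable] = singleton.prems(1,2,6)
  have g: "(\<lambda>s. ennreal (g (x0(i := s)))) \<in> borel_measurable lborel"
  proof -
    have "(\<lambda>s. x0(i := s)) \<in> measurable lborel (L {i})"
      unfolding L_def by (rule measurable_component_update) (auto simp: x0_def space_PiM)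
    from measurable_compose[OF this singleton.prems(6)] show ?thesis by measurable
  qed
  have "(\<integral>\<^sup>+x. z x * g x \<partial>L {i}) = (\<integral>\<^sup>+s. z (x0(i := s)) * g (x0(i := s)) \<partial>lborel)"
    by (rule *) measurable
  also have "\<dots> \<le> (\<integral>\<^sup>+s. (\<integral>\<^sup>+x. m x \<partial>L {i}) * g (x0(i := s)) \<partial>lborel)"
  proof (rule nn_integral_mono)
    fix s
    have "ennreal (z (x0(i := s))) \<le> (\<integral>\<^sup>+x. m x \<partial>L {i})"
      using singleton.prems(5)[OF singletonI, of "x0(i := s)"]
      by (subst *) (measurable, simp only: fun_upd_upd)
    then show "ennreal (z (x0(i := s)) * g (x0(i := s))) \<le> (\<integral>\<^sup>+x. m x \<partial>L {i}) * g (x0(i := s))"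
      using singleton.prems by (simp add: ennreal_mult mult_right_mono)
  qed
  also have "\<dots> = (\<integral>\<^sup>+x. m x \<partial>L {i}) * (\<integral>\<^sup>+s. g (x0(i := s)) \<partial>lborel)"
    using g by (rule nn_integral_cmult)
  also have "(\<integral>\<^sup>+s. g (x0(i := s)) \<partial>lborel) = (\<integral>\<^sup>+x. g x \<partial>L {i})"
    by (rule *[symmetric]) measurable
  also have "\<dots> \<le> ennreal G"
    using singleton.prems by simp
  finally show ?case by (simp add: mult_left_mono)
next
  case (insert j I)
  define n where "n = real (card I)"
  define N where "N = 1 + n"
  have n: "n > 0" using insert by (simp add: n_def card_gt_0_iff)
  have N: "real (card (insert j I)) = N" using insert by (simp add: N_def n_def)
  have cnj: "1 / (1 + 1 / n) + 1 / N = 1" "1 + 1 / n > 1" "N > 1"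
    using n by (auto simp: N_def field_simps)
  note meas[measurable] = insert.prems(1,2,6)
  have dual: "(\<integral>\<^sup>+x. z (x(j := t)) * h x \<partial>L I) \<le> (\<integral>\<^sup>+x. m (x(j := t)) \<partial>L I) * ennreal H"
    if "h \<in> borel_measurable (L I)" "\<And>x. h x \<ge> 0" "H > 0"
      "(\<integral>\<^sup>+x. h x powr n \<partial>L I) \<le> ennreal (H powr n)" for t h H
  proof (rule insert.IH)
    show "ennreal (z (x(j := t))) \<le> (\<integral>\<^sup>+s. m ((x(i := s))(j := t)) \<partial>lborel)" if "i \<in> I" for x i
      using insert.prems(5)[of i "x(j := t)"] insert.hyps that fun_upd_twist[of i j x]
      by (metis (no_types, lifting) insert_iff nn_integral_cong)
    show "(\<lambda>x. z (x(j := t))) \<in> borel_measurable (L I)" "(\<lambda>x. m (x(j := t))) \<in> borel_measurable (L I)"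
      unfolding L_def using meas[unfolded L_def] by (auto intro: measurable_fun_upd_component)
  qed (use that insert.prems in \<open>auto simp: n_def\<close>)
  \<comment> \<open>Hoelder's inequality, by integrating Young's inequality for \<open>z / D\<close>
    and \<open>g / G\<close>. The normalisation needs \<open>D > 0\<close>, and the conjugate
    exponents in \<open>cnj\<close> make the two terms add up to \<open>D * G\<close>.\<close>
  have *: "(\<integral>\<^sup>+x. z x * g x \<partial>L (insert j I)) \<le> ennreal D * ennreal G"
    if D: "D > 0" "(\<integral>\<^sup>+x. m x \<partial>L (insert j I)) \<le> ennreal D" for D
  proof -
    have 1: "(\<integral>\<^sup>+x. z x powr (1 + 1 / n) \<partial>L (insert j I)) \<le> ennreal (D powr (1 + 1 / n))"
      unfolding L_def
      by (rule gagliardo_step[OF _ _ _ _ _ _ insert.prems(5)[OF insertI1] dual[unfolded L_def] n D[unfolded L_def]])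
        (use insert.hyps insert.prems in \<open>auto simp: L_def\<close>)
    have "ennreal (z x * g x) \<le> ennreal (D * G / ((1 + 1 / n) * D powr (1 + 1 / n))) * ennreal (z x powr (1 + 1 / n)) +
        ennreal (D * G / (N * G powr N)) * ennreal (g x powr N)" for x
    proof -
      have "(z x / D) * (g x / G) \<le> (z x / D) powr (1 + 1 / n) / (1 + 1 / n) + (g x / G) powr N / N"
        using cnj insert.prems D by (intro Youngs_inequality) auto
      then have "D * G * ((z x / D) * (g x / G)) \<le>
          D * G * ((z x / D) powr (1 + 1 / n) / (1 + 1 / n) + (g x / G) powr N / N)"
        using D \<open>G > 0\<close> by (intro mult_left_mono) auto
      also have "\<dots> = D * G / ((1 + 1 / n) * D powr (1 + 1 / n)) * z x powr (1 + 1 / n) +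
          D * G / (N * G powr N) * g x powr N"
        using D \<open>G > 0\<close> insert.prems by (simp add: powr_divide ring_distribs mult_ac)
      finally have "z x * g x \<le> D * G / ((1 + 1 / n) * D powr (1 + 1 / n)) * z x powr (1 + 1 / n) +
          D * G / (N * G powr N) * g x powr N"
        using D \<open>G > 0\<close> by simp
      then show ?thesis
        using D \<open>G > 0\<close> cnj by (simp add: ennreal_leI flip: ennreal_mult ennreal_plus)
    qed
    then have "(\<integral>\<^sup>+x. z x * g x \<partial>L (insert j I)) \<le>
        (\<integral>\<^sup>+x. ennreal (D * G / ((1 + 1 / n) * D powr (1 + 1 / n))) * ennreal (z x powr (1 + 1 / n)) +
        ennreal (D * G / (N * G powr N)) * ennreal (g x powr N) \<partial>L (insert j I))"
      by (intro nn_integral_mono) simp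
    also have "\<dots> = ennreal (D * G / ((1 + 1 / n) * D powr (1 + 1 / n))) * (\<integral>\<^sup>+x. z x powr (1 + 1 / n) \<partial>L (insert j I)) +
        ennreal (D * G / (N * G powr N)) * (\<integral>\<^sup>+x. g x powr N \<partial>L (insert j I))"
      by (simp add: nn_integral_add nn_integral_cmult)
    also have "\<dots> \<le> ennreal (D * G / ((1 + 1 / n) * D powr (1 + 1 / n))) * ennreal (D powr (1 + 1 / n)) +
        ennreal (D * G / (N * G powr N)) * ennreal (G powr N)"
      using 1 insert.prems(9) unfolding N by (intro add_mono mult_left_mono) auto
    also have "\<dots> = ennreal (D * G * (1 / (1 + 1 / n) + 1 / N))"
    proof -
      have "D * G / ((1 + 1 / n) * D powr (1 + 1 / n)) * D powr (1 + 1 / n) = D * G * (1 / (1 + 1 / n))"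
        "D * G / (N * G powr N) * G powr N = D * G * (1 / N)"
        using D \<open>G > 0\<close> by simp_all
      then show ?thesis
        unfolding distrib_left using D \<open>G > 0\<close> n cnj(3)
        by (simp del: times_divide_eq_right times_divide_eq_left add: add_nonneg_nonneg flip: ennreal_mult ennreal_plus)
    qed
    also have "\<dots> = ennreal D * ennreal G"
      unfolding cnj using D \<open>G > 0\<close> by (simp add: ennreal_mult)
    finally show ?thesis .
  qed
  show ?case
  proof (cases "(\<integral>\<^sup>+x. m x \<partial>L (insert j I))")
    \<comment> \<open>A finite integral may be 0. It is enlarged by \<open>e / G\<close>, which
      costs exactly \<open>e\<close> after multiplication by \<open>G\<close>.\<close>
    case (real D)
    have "(\<integral>\<^sup>+x. z x * g x \<partial>L (insert j I)) \<le> ennreal D * ennreal G + ennreal e" if "e > 0" for e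
    proof -
      have "(\<integral>\<^sup>+x. z x * g x \<partial>L (insert j I)) \<le> ennreal (D + e / G) * ennreal G"
        using real that \<open>G > 0\<close> by (intro *) (auto intro!: ennreal_leI add_nonneg_pos)
      also have "\<dots> = ennreal D * ennreal G + ennreal e"
        using real that \<open>G > 0\<close> by (simp add: ring_distribs flip: ennreal_mult ennreal_plus)
      finally show ?thesis .
    qed
    then show ?thesis unfolding real by (rule ennreal_le_epsilon) 
  next
    case top
    then show ?thesis using \<open>G > 0\<close> by (simp add: ennreal_top_mult)
  qed
qed

text \<open>After splitting off one coordinate at least one remains, so the dual inequality holds on
  the slices, and one more use of \<open>gagliardo_step\<close> returns to the primal form.\<close>

lemma gagliardo:
  fixes z m :: "('i \<Rightarrow> real) \<Rightarrow> real"
  defines "L \<equiv> \<lambda>I. Pi\<^sub>M I (\<lambda>_::'i. lborel :: real measure)"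
  assumes "finite I" "card I \<ge> 2"
    and meas: "z \<in> borel_measurable (L I)" "m \<in> borel_measurable (L I)"
    and nonneg: "\<And>x. z x \<ge> 0" "\<And>x. m x \<ge> 0"
    and bound: "\<And>x i. i \<in> I \<Longrightarrow> ennreal (z x) \<le> (\<integral>\<^sup>+s. m (x(i := s)) \<partial>lborel)"
    and D: "D > 0" "(\<integral>\<^sup>+x. m x \<partial>L I) \<le> ennreal D"
  shows "(\<integral>\<^sup>+x. z x powr (real (card I) / (real (card I) - 1)) \<partial>L I) \<le> ennreal (D powr (real (card I) / (real (card I) - 1)))"
proof -
  obtain j where "j \<in> I" using assms(3) by fastforce
  define J where "J = I - {j}"
  have J: "I = insert j J" "j \<notin> J" "finite J" "real (card I) = 1 + real (card J)" "card J > 0"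
    using \<open>j \<in> I\<close> assms by (auto simp: J_def)
  have dual: "(\<integral>\<^sup>+x. z (x(j := t)) * h x \<partial>L J) \<le> (\<integral>\<^sup>+x. m (x(j := t)) \<partial>L J) * ennreal H"
    if "h \<in> borel_measurable (L J)" "\<And>x. h x \<ge> 0" "H > 0"
      "(\<integral>\<^sup>+x. h x powr real (card J) \<partial>L J) \<le> ennreal (H powr real (card J))" for t h H
    unfolding L_def
  proof (rule gagliardo_dual)
    show "ennreal (z (x(j := t))) \<le> (\<integral>\<^sup>+s. m ((x(i := s))(j := t)) \<partial>lborel)" if "i \<in> J" for x i
      using bound[of i "x(j := t)"] J that fun_upd_twist[of i j x] by (metis (no_types, lifting) insert_iff nn_integral_cong)
    show "(\<lambda>x. z (x(j := t))) \<in> borel_measurable (Pi\<^sub>M J (\<lambda>_. lborel))"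
      "(\<lambda>x. m (x(j := t))) \<in> borel_measurable (Pi\<^sub>M J (\<lambda>_. lborel))"
      using meas[unfolded L_def J] by (auto intro: measurable_fun_upd_component)
  qed (use that nonneg J in \<open>auto simp: L_def\<close>)
  have e: "real (card I) / (real (card I) - 1) = 1 + 1 / real (card J)"
    using J(4,5) by (simp add: add_divide_distrib)
  show ?thesis
    unfolding e unfolding J(1) L_def
    by (rule gagliardo_step[OF _ _ _ _ _ _ bound[OF \<open>j \<in> I\<close>] dual[unfolded L_def]])
      (use J assms in \<open>auto simp: L_def\<close>)
qed


section \<open>Sobolev and Poincare inequalities for compactly supported C^1 functions\<close>

lemma C1c_slice_bound:
  assumes "C1c \<Omega> z Z" "norm b = 1"
  shows "ennreal \<bar>z (y + t *\<^sub>R b)\<bar> \<le> (\<integral>\<^sup>+s. norm (Z (y + s *\<^sub>R b)) \<partial>lborel)"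
proof -
  obtain K where K: "compact K" "\<And>x. x \<notin> K \<Longrightarrow> z x = 0"
    using C1c_support[OF assms(1)] by metis
  obtain R where R: "\<And>x. x \<in> K \<Longrightarrow> norm x \<le> R" "R > 0"
    using compact_imp_bounded[OF K(1)] by (auto simp: bounded_pos)
  \<comment> \<open>A parameter before \<open>t\<close> for which the point on the line is outside
    the support; the fundamental theorem of calculus is applied from there to
    \<open>t\<close>.\<close>
  define r where "r = - (\<bar>t\<bar> + R + norm y + 1)"
  have "norm (y + r *\<^sub>R b) \<ge> norm (r *\<^sub>R b) - norm y"
    by (metis add.commute norm_diff_ineq)
  then have "norm (y + r *\<^sub>R b) > R" using assms(2) R(2) by (simp add: r_def)
  then have zr: "z (y + r *\<^sub>R b) = 0" using K(2) R(1) by force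
  have rt: "r \<le> t" using R(2) norm_ge_zero[of y] abs_ge_minus_self[of t] unfolding r_def by linarith
  have cont: "continuous_on {r..t} (\<lambda>s. Z (y + s *\<^sub>R b) \<bullet> b)"
    by (intro continuous_intros continuous_on_compose2[OF C1c_D(2)[OF assms(1)]]) auto
  have deriv: "((\<lambda>s. z (y + s *\<^sub>R b)) has_vector_derivative Z (y + s *\<^sub>R b) \<bullet> b) (at s within {r..t})" for s
  proof -
    have "((\<lambda>s. z (y + s *\<^sub>R b)) has_derivative (\<lambda>h. Z (y + s *\<^sub>R b) \<bullet> (h *\<^sub>R b))) (at s)"
      by (rule has_derivative_compose[OF _ C1c_D(1)[OF assms(1)], where f = "\<lambda>s. y + s *\<^sub>R b"])
        (auto intro!: derivative_eq_intros)
    then show ?thesis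
      unfolding has_vector_derivative_def by (simp add: has_derivative_at_withinI)
  qed
  have "has_bochner_integral lborel (\<lambda>s. indicator {r..t} s *\<^sub>R (Z (y + s *\<^sub>R b) \<bullet> b)) (z (y + t *\<^sub>R b) - z (y + r *\<^sub>R b))"
    by (rule has_bochner_integral_FTC_Icc[OF rt]) (use deriv cont in auto)
  then have i: "integrable lborel (\<lambda>s. indicator {r..t} s *\<^sub>R (Z (y + s *\<^sub>R b) \<bullet> b))"
    "z (y + t *\<^sub>R b) = (LINT s|lborel. indicator {r..t} s *\<^sub>R (Z (y + s *\<^sub>R b) \<bullet> b))"
    by (auto simp: has_bochner_integral_iff zr)
  have "ennreal \<bar>z (y + t *\<^sub>R b)\<bar> \<le> (\<integral>\<^sup>+s. norm (indicator {r..t} s *\<^sub>R (Z (y + s *\<^sub>R b) \<bullet> b)) \<partial>lborel)"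
    unfolding i(2) real_norm_def[symmetric] by (rule integral_norm_bound_ennreal[OF i(1)])
  also have "\<dots> \<le> (\<integral>\<^sup>+s. norm (Z (y + s *\<^sub>R b)) \<partial>lborel)"
    using Cauchy_Schwarz_ineq2[of _ b] assms(2)
    by (intro nn_integral_mono ennreal_leI) (auto simp: indicator_def)
  finally show ?thesis .
qed

text \<open>Lebesgue measure is the image under \<open>T\<close> of a product of lines, and changing
  one coordinate moves \<open>T f\<close> along a basis vector. Hence \<open>gagliardo\<close>
  applies with the norm of \<open>Z\<close> as common majorant in all directions.\<close>

lemma C1c_sobolev_lborel:
  fixes z :: "'a::euclidean_space \<Rightarrow> real"
  defines "q \<equiv> real DIM('a) / (real DIM('a) - 1)"
  assumes z: "C1c \<Omega> z Z" and "DIM('a) \<ge> 2" "D > 0" "(\<integral>\<^sup>+x. norm (Z x) \<partial>lborel) \<le> ennreal D"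
  shows "(\<integral>\<^sup>+x. \<bar>z x\<bar> powr q \<partial>lborel) \<le> ennreal (D powr q)"
proof -
  define T :: "('a \<Rightarrow> real) \<Rightarrow> 'a" where "T f = (\<Sum>b\<in>Basis. f b *\<^sub>R b)" for f
  define P where "P = Pi\<^sub>M (Basis :: 'a set) (\<lambda>_. lborel :: real measure)"
  have T[measurable]: "T \<in> measurable P borel" unfolding T_def P_def by measurable
  have L: "(lborel :: 'a measure) = distr P borel T"
    unfolding P_def T_def[abs_def] by (rule lborel_eq)
  have [measurable]: "z \<in> borel_measurable borel" "Z \<in> borel_measurable borel"
    using C1c_D[OF z] by (auto intro: borel_measurable_continuous_onI)
  have nn: "(\<integral>\<^sup>+x. h x \<partial>lborel) = (\<integral>\<^sup>+f. h (T f) \<partial>P)" if "h \<in> borel_measurable borel" for h :: "'a \<Rightarrow> ennreal"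
    unfolding L using that by (subst nn_integral_distr) auto
  have upd: "T (f(b := s)) = (T f - f b *\<^sub>R b) + s *\<^sub>R b" if "b \<in> Basis" for f b s
    unfolding T_def using that
    by (subst (1 2) sum.remove[of Basis b]) (auto intro!: sum.cong)
  have "(\<integral>\<^sup>+f. \<bar>z (T f)\<bar> powr q \<partial>P) \<le> ennreal (D powr q)"
    unfolding P_def q_def
  proof (rule gagliardo[where m = "\<lambda>f. norm (Z (T f))"])
    show "ennreal \<bar>z (T f)\<bar> \<le> (\<integral>\<^sup>+s. norm (Z (T (f(b := s)))) \<partial>lborel)" if "b \<in> Basis" for f b
      using C1c_slice_bound[OF z, of b "T f - f b *\<^sub>R b" "f b"] that by (simp add: upd)
    show "(\<integral>\<^sup>+f. norm (Z (T f)) \<partial>Pi\<^sub>M Basis (\<lambda>_. lborel)) \<le> ennreal D"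
      using assms(5) by (subst (asm) nn) (auto simp: P_def)
    show "(\<lambda>f. \<bar>z (T f)\<bar>) \<in> borel_measurable (Pi\<^sub>M Basis (\<lambda>_. lborel))"
      "(\<lambda>f. norm (Z (T f))) \<in> borel_measurable (Pi\<^sub>M Basis (\<lambda>_. lborel))"
      unfolding P_def[symmetric] by measurable
  qed (use assms in auto)
  then show ?thesis by (subst nn) auto
qed

lemma borel_imp_lebesgue_on: "h \<in> borel_measurable borel \<Longrightarrow> h \<in> borel_measurable (lebesgue_on \<Omega>)"
  by (intro measurable_restrict_space1 measurable_completion) simp

lemma nn_integral_lebesgue_on_support:
  assumes "open \<Omega>" "h \<in> borel_measurable borel" "\<And>x. x \<notin> \<Omega> \<Longrightarrow> h x = 0"
  shows "(\<integral>\<^sup>+x. h x \<partial>lebesgue_on \<Omega>) = (\<integral>\<^sup>+x. h x \<partial>lborel)"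
proof -
  have "(\<integral>\<^sup>+x. h x \<partial>lebesgue_on \<Omega>) = (\<integral>\<^sup>+x. h x * indicator \<Omega> x \<partial>lebesgue)"
    using assms by (subst nn_integral_restrict_space) auto
  also have "\<dots> = (\<integral>\<^sup>+x. h x \<partial>lebesgue)"
    using assms(3) by (intro nn_integral_cong) (auto simp: indicator_def)
  finally show ?thesis by (simp add: nn_integral_completion)
qed

lemma finite_measure_lebesgue_on_bounded:
  "open \<Omega> \<Longrightarrow> bounded \<Omega> \<Longrightarrow> finite_measure (lebesgue_on \<Omega>)"
  by (intro finite_measureI)
    (use lmeasurable_open[of \<Omega>] in \<open>auto simp: emeasure_restrict_space fmeasurable_def\<close>)

lemma integrable_continuous_lebesgue_on:
  fixes h :: "'a::euclidean_space \<Rightarrow> 'b::{banach,second_countable_topology}"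
  assumes "open \<Omega>" "bounded \<Omega>" "continuous_on UNIV h"
  shows "integrable (lebesgue_on \<Omega>) h"
proof -
  have "bounded (h ` closure \<Omega>)"
    using assms by (auto intro!: compact_imp_bounded compact_continuous_image intro: continuous_on_subset)
  then obtain B where B: "\<And>x. x \<in> closure \<Omega> \<Longrightarrow> norm (h x) \<le> B"
    by (auto simp: bounded_iff)
  interpret finite_measure "lebesgue_on \<Omega>"
    using assms by (intro finite_measure_lebesgue_on_bounded)
  show ?thesis
  proof (rule integrable_const_bound)
    show "AE x in lebesgue_on \<Omega>. norm (h x) \<le> B"
      using B closure_subset by (intro AE_I2) auto
  qed (use assms in \<open>auto intro!: borel_imp_lebesgue_on borel_measurable_continuous_onI\<close>)
qed

lemma continuous_on_abs_powr:
  fixes z :: "'a::topological_space \<Rightarrow> real"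
  shows "continuous_on S z \<Longrightarrow> q > 0 \<Longrightarrow> continuous_on S (\<lambda>x. \<bar>z x\<bar> powr q)"
  by (intro continuous_on_powr' continuous_intros) auto

lemma C1c_sobolev:
  fixes z :: "'a::euclidean_space \<Rightarrow> real"
  defines "q \<equiv> real DIM('a) / (real DIM('a) - 1)"
  assumes \<Omega>: "open \<Omega>" "bounded \<Omega>" and z: "C1c \<Omega> z Z" and "DIM('a) \<ge> 2" "D > 0"
    and D: "(LINT x|lebesgue_on \<Omega>. norm (Z x)) \<le> D"
  shows "(LINT x|lebesgue_on \<Omega>. \<bar>z x\<bar> powr q) \<le> D powr q"
proof -
  obtain K where K: "K \<subseteq> \<Omega>" "\<And>x. x \<notin> K \<Longrightarrow> z x = 0" "\<And>x. x \<notin> K \<Longrightarrow> Z x = 0"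
    using C1c_support[OF z] by metis
  have q: "q > 0" using assms(5) by (simp add: q_def)
  note c = C1c_D(2,3)[OF z]
  have m: "z \<in> borel_measurable borel" "Z \<in> borel_measurable borel"
    using c by (auto intro: borel_measurable_continuous_onI)
  have i: "integrable (lebesgue_on \<Omega>) (\<lambda>x. norm (Z x))" "integrable (lebesgue_on \<Omega>) (\<lambda>x. \<bar>z x\<bar> powr q)"
    using c q by (auto intro!: integrable_continuous_lebesgue_on \<Omega> continuous_on_abs_powr continuous_intros)
  have "(\<integral>\<^sup>+x. norm (Z x) \<partial>lborel) = (\<integral>\<^sup>+x. norm (Z x) \<partial>lebesgue_on \<Omega>)"
    using K m \<Omega> by (intro nn_integral_lebesgue_on_support[symmetric]) auto
  also have "\<dots> = ennreal (LINT x|lebesgue_on \<Omega>. norm (Z x))"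
    using i by (intro nn_integral_eq_integral) auto
  also have "\<dots> \<le> ennreal D" using D by (rule ennreal_leI)
  finally have "(\<integral>\<^sup>+x. \<bar>z x\<bar> powr q \<partial>lborel) \<le> ennreal (D powr q)"
    unfolding q_def using assms by (intro C1c_sobolev_lborel)
  also have "(\<integral>\<^sup>+x. \<bar>z x\<bar> powr q \<partial>lborel) = (\<integral>\<^sup>+x. \<bar>z x\<bar> powr q \<partial>lebesgue_on \<Omega>)"
    using K m \<Omega> q by (intro nn_integral_lebesgue_on_support[symmetric]) auto
  also have "\<dots> = ennreal (LINT x|lebesgue_on \<Omega>. \<bar>z x\<bar> powr q)"
    using i by (intro nn_integral_eq_integral) auto
  finally show ?thesis by simp
qed

text \<open>On a set of finite measure the Sobolev bound controls the \<open>L^1\<close> norm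
  through \<open>t \<le> 1 + t powr q\<close>, applied to
  \<open>t = \<bar>z x\<bar> / D\<close>.\<close>

lemma C1c_poincare:
  fixes z :: "'a::euclidean_space \<Rightarrow> real"
  assumes \<Omega>: "open \<Omega>" "bounded \<Omega>" and z: "C1c \<Omega> z Z" and "DIM('a) \<ge> 2"
  shows "(LINT x|lebesgue_on \<Omega>. \<bar>z x\<bar>) \<le> (1 + measure lebesgue \<Omega>) * (LINT x|lebesgue_on \<Omega>. norm (Z x))"
proof (rule field_le_epsilon)
  fix e :: real assume "e > 0"
  define q where "q = real DIM('a) / (real DIM('a) - 1)"
  have q: "q > 1" using assms(4) by (simp add: q_def)
  \<comment> \<open>The excess over the gradient norm makes \<open>D\<close> positive and becomes
    \<open>e\<close> after multiplication by \<open>1 + measure lebesgue \<Omega>\<close>.\<close>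
  define D where "D = (LINT x|lebesgue_on \<Omega>. norm (Z x)) + e / (1 + measure lebesgue \<Omega>)"
  have pos: "1 + measure lebesgue \<Omega> > 0" by (simp add: add_pos_nonneg)
  have D: "D > 0" "(LINT x|lebesgue_on \<Omega>. norm (Z x)) \<le> D"
    using \<open>e > 0\<close> pos by (auto simp: D_def intro!: add_nonneg_pos)
  interpret finite_measure "lebesgue_on \<Omega>"
    using \<Omega> by (intro finite_measure_lebesgue_on_bounded)
  note c = C1c_D(3)[OF z]
  have i: "integrable (lebesgue_on \<Omega>) (\<lambda>x. \<bar>z x\<bar>)" "integrable (lebesgue_on \<Omega>) (\<lambda>x. \<bar>z x\<bar> powr q)"
    using c q by (auto intro!: integrable_continuous_lebesgue_on \<Omega> continuous_on_abs_powr continuous_intros)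
  have le: "\<bar>z x\<bar> \<le> D * (1 + \<bar>z x\<bar> powr q / D powr q)" for x
  proof -
    have "\<bar>z x\<bar> / D \<le> 1 + (\<bar>z x\<bar> / D) powr q"
    proof (cases "\<bar>z x\<bar> / D \<le> 1")
      case False
      then have "(\<bar>z x\<bar> / D) powr 1 \<le> (\<bar>z x\<bar> / D) powr q" using q by (intro powr_mono) auto
      then show ?thesis using False D(1) by simp
    next
      case True
      then show ?thesis using powr_ge_zero[of "\<bar>z x\<bar> / D" q] by linarith
    qed
    then show ?thesis using D(1) by (simp add: powr_divide field_simps)
  qed
  have "(LINT x|lebesgue_on \<Omega>. \<bar>z x\<bar>) \<le> (LINT x|lebesgue_on \<Omega>. D * (1 + \<bar>z x\<bar> powr q / D powr q))"
    using i le by (intro integral_mono) auto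
  also have "\<dots> = D * (measure lebesgue \<Omega> + (LINT x|lebesgue_on \<Omega>. \<bar>z x\<bar> powr q) / D powr q)"
    using i \<Omega> by (simp add: measure_restrict_space)
  also have "\<dots> \<le> D * (measure lebesgue \<Omega> + 1)"
    using C1c_sobolev[OF \<Omega> z assms(4) D] D(1) by (intro mult_left_mono add_left_mono) (auto simp: q_def)
  also have "\<dots> = (1 + measure lebesgue \<Omega>) * (LINT x|lebesgue_on \<Omega>. norm (Z x)) + e"
    unfolding D_def using pos by (simp add: field_simps)
  finally show "(LINT x|lebesgue_on \<Omega>. \<bar>z x\<bar>) \<le> (1 + measure lebesgue \<Omega>) * (LINT x|lebesgue_on \<Omega>. norm (Z x)) + e" .
qed

section \<open>Integration by parts\<close>

lemma C1c_lipschitz: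
  assumes "C1c \<Omega> z Z" "\<And>x. norm (Z x) \<le> B"
  shows "\<bar>z x - z y\<bar> \<le> B * norm (x - y)"
proof -
  have "norm (z x - z y) \<le> B * norm (x - y)"
  proof (rule differentiable_bound[of UNIV z "\<lambda>x h. Z x \<bullet> h"])
    show "onorm (\<lambda>h. Z x \<bullet> h) \<le> B" for x
      using order_trans[OF Cauchy_Schwarz_ineq2 mult_right_mono[OF assms(2)]]
      by (intro onorm_le) simp
  qed (use C1c_D(1)[OF assms(1)] in auto)
  then show ?thesis by simp
qed

text \<open>Difference quotients of \<open>z\<close> have integral 0 by translation invariance, and
  they converge to the directional derivative under a common integrable bound.\<close>

lemma C1c_integral_partial:
  assumes \<Omega>: "open \<Omega>" and z: "C1c \<Omega> z Z"
  shows "(LINT x|lebesgue_on \<Omega>. Z x \<bullet> b) = 0"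
proof -
  obtain K where K: "compact K" "K \<subseteq> \<Omega>" "\<And>x. x \<notin> K \<Longrightarrow> z x = 0" "\<And>x. x \<notin> K \<Longrightarrow> Z x = 0"
    using C1c_support[OF z] by metis
  obtain R where R: "\<And>x. x \<in> K \<Longrightarrow> norm x \<le> R" "R > 0"
    using compact_imp_bounded[OF K(1)] by (auto simp: bounded_pos)
  obtain B where B: "B > 0" "\<And>x. norm (Z x) \<le> B" using C1c_bounded[OF z] by metis
  note c = C1c_D(2,3)[OF z]
  have [measurable]: "z \<in> borel_measurable borel" "Z \<in> borel_measurable borel"
    using c by (auto intro: borel_measurable_continuous_onI)
  have "integrable lborel (\<lambda>x. indicator K x *\<^sub>R z x)"
    using K(1) c by (intro borel_integrable_compact) (auto intro: continuous_on_subset)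
  also have "(\<lambda>x. indicator K x *\<^sub>R z x) = z" using K(3) by (force simp: indicator_def)
  finally have iz: "integrable lborel z" .
  define f where "f k x = (z (inverse (real (Suc k)) *\<^sub>R b + x) - z x) / inverse (real (Suc k))" for k x
  have shift: "integrable lborel (\<lambda>x. z (v + x))" "(LINT x|lborel. z (v + x)) = (LINT x|lborel. z x)" for v
  proof -
    have "integrable (distr lborel borel ((+) v)) z" using iz by (simp only: lborel_distr_plus)
    then show "integrable lborel (\<lambda>x. z (v + x))" by (subst (asm) integrable_distr_eq) auto
    have "(LINT x|lborel. z x) = (LINT x|distr lborel borel ((+) v). z x)"
      by (simp only: lborel_distr_plus)
    then show "(LINT x|lborel. z (v + x)) = (LINT x|lborel. z x)" by (subst (asm) integral_distr) auto
  qed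
  have f0: "(LINT x|lborel. f k x) = 0" for k
    unfolding f_def using shift iz by simp
  \<comment> \<open>Inside the ball this is the Lipschitz bound; outside it both terms of the
    quotient vanish, because the shift is no longer than \<open>norm b\<close>.\<close>
  have fB: "\<bar>f k x\<bar> \<le> B * norm b * indicator (cball 0 (R + norm b)) x" for k x
  proof (cases "x \<in> cball 0 (R + norm b)")
    case True
    have "\<bar>z (inverse (real (Suc k)) *\<^sub>R b + x) - z x\<bar> \<le> B * norm (inverse (real (Suc k)) *\<^sub>R b)"
      using C1c_lipschitz[OF z B(2), of "inverse (real (Suc k)) *\<^sub>R b + x" x] by simp
    then have "\<bar>z (inverse (real (Suc k)) *\<^sub>R b + x) - z x\<bar> / inverse (real (Suc k)) \<le> B * norm b"
      by (subst pos_divide_le_eq) (simp_all add: mult_ac)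
    moreover have "\<bar>f k x\<bar> = \<bar>z (inverse (real (Suc k)) *\<^sub>R b + x) - z x\<bar> / inverse (real (Suc k))"
      unfolding f_def abs_divide by simp
    ultimately show ?thesis using True by simp
  next
    case False
    then have x: "norm x > R + norm b" by simp
    have "norm (inverse (real (Suc k)) *\<^sub>R b + x) \<ge> norm x - norm (inverse (real (Suc k)) *\<^sub>R b)"
      by (metis add.commute norm_diff_ineq)
    moreover have "norm (inverse (real (Suc k)) *\<^sub>R b) \<le> norm b"
      by (simp add: field_simps)
    ultimately have "norm (inverse (real (Suc k)) *\<^sub>R b + x) > R" using x by linarith
    then have "z (inverse (real (Suc k)) *\<^sub>R b + x) = 0" using R K by force
    moreover have "z x = 0" using x norm_ge_zero[of b] R K by (metis add_increasing2 linorder_not_less)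
    ultimately show ?thesis using B(1) by (simp add: f_def)
  qed
  have lim: "(\<lambda>k. f k x) \<longlonglongrightarrow> Z x \<bullet> b" for x
  proof -
    have "((\<lambda>s. z (s *\<^sub>R b + x)) has_derivative (\<lambda>s. Z (0 *\<^sub>R b + x) \<bullet> (s *\<^sub>R b))) (at 0)"
      by (rule has_derivative_compose[OF _ C1c_D(1)[OF z], where f = "\<lambda>s. s *\<^sub>R b + x"])
        (auto intro!: derivative_eq_intros)
    then have "((\<lambda>s. z (s *\<^sub>R b + x)) has_field_derivative (Z x \<bullet> b)) (at 0)"
      unfolding has_field_derivative_def by (simp add: mult_commute_abs)
    then have "((\<lambda>h. (z (h *\<^sub>R b + x) - z x) / h) \<longlongrightarrow> Z x \<bullet> b) (at 0)"
      by (simp add: DERIV_def)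
    moreover have "filterlim (\<lambda>k. inverse (real (Suc k))) (at 0) sequentially"
      by (intro filterlim_atI LIMSEQ_inverse_real_of_nat) auto
    ultimately show ?thesis unfolding f_def by (rule filterlim_compose)
  qed
  have "(\<lambda>k. LINT x|lborel. f k x) \<longlonglongrightarrow> (LINT x|lborel. Z x \<bullet> b)"
  proof (rule integral_dominated_convergence)
    show "integrable lborel (\<lambda>x. B * norm b * indicator (cball 0 (R + norm b)) x)"
      using emeasure_bounded_finite[of "cball 0 (R + norm b)"]
      by (intro integrable_mult_right integrable_real_indicator) (auto simp: less_top)
    show "f k \<in> borel_measurable lborel" for k unfolding f_def[abs_def] by measurable
  qed (use fB lim in auto)
  then have "(LINT x|lborel. Z x \<bullet> b) = 0" by (simp add: f0 LIMSEQ_const_iff)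
  moreover have "(LINT x|lebesgue_on \<Omega>. Z x \<bullet> b) = (LINT x|lebesgue. indicator \<Omega> x *\<^sub>R (Z x \<bullet> b))"
    using \<Omega> by (subst integral_restrict_space) auto
  moreover have "(\<lambda>x. indicator \<Omega> x *\<^sub>R (Z x \<bullet> b)) = (\<lambda>x. Z x \<bullet> b)"
    using K(2) subsetD[OF K(2)] K(4) by (intro ext) (metis indicator_eq_1_iff inner_zero_left scaleR_one scaleR_zero_right)
  ultimately show ?thesis by (simp add: integral_completion)
qed

lemma C1c_mult:
  assumes "C1c \<Omega> z Z" "C1c \<Omega> y Y"
  shows "C1c \<Omega> (\<lambda>x. z x * y x) (\<lambda>x. z x *\<^sub>R Y x + y x *\<^sub>R Z x)"
proof -
  have "((\<lambda>x. z x * y x) has_derivative (\<lambda>h. (z x *\<^sub>R Y x + y x *\<^sub>R Z x) \<bullet> h)) (at x)" for x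
    by (auto intro!: derivative_eq_intros C1c_D(1)[OF assms(1)] C1c_D(1)[OF assms(2)]
        simp: inner_add_left mult.commute)
  moreover have "continuous_on UNIV (\<lambda>x. z x *\<^sub>R Y x + y x *\<^sub>R Z x)"
    using C1c_D(2,3)[OF assms(1)] C1c_D(2,3)[OF assms(2)] by (intro continuous_intros)
  moreover obtain K where "compact K" "K \<subseteq> \<Omega>" "\<And>x. x \<notin> K \<Longrightarrow> z x = 0"
    using C1c_support[OF assms(1)] by metis
  ultimately show ?thesis
    unfolding C1c_def by (metis mult_zero_left)
qed

lemma C1c_diff:
  assumes "C1c \<Omega> z Z" "C1c \<Omega> y Y"
  shows "C1c \<Omega> (\<lambda>x. z x - y x) (\<lambda>x. Z x - Y x)"
proof -
  have "((\<lambda>x. z x - y x) has_derivative (\<lambda>h. (Z x - Y x) \<bullet> h)) (at x)" for x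
    by (auto intro!: derivative_eq_intros C1c_D(1)[OF assms(1)] C1c_D(1)[OF assms(2)]
        simp: inner_diff_left)
  moreover have "continuous_on UNIV (\<lambda>x. Z x - Y x)"
    using C1c_D(2)[OF assms(1)] C1c_D(2)[OF assms(2)] by (intro continuous_intros)
  moreover obtain K L where "compact K" "K \<subseteq> \<Omega>" "\<And>x. x \<notin> K \<Longrightarrow> z x = 0"
    "compact L" "L \<subseteq> \<Omega>" "\<And>x. x \<notin> L \<Longrightarrow> y x = 0"
    using C1c_support[OF assms(1)] C1c_support[OF assms(2)] by metis
  then have "compact (K \<union> L)" "K \<union> L \<subseteq> \<Omega>" "\<forall>x. x \<notin> K \<union> L \<longrightarrow> z x - y x = 0" by auto
  ultimately show ?thesis unfolding C1c_def by blast
qed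

lemma C1c_integration_by_parts:
  assumes \<Omega>: "open \<Omega>" "bounded \<Omega>" and C: "C1c \<Omega> z Z" "C1c \<Omega> y Y"
  shows "(LINT x|lebesgue_on \<Omega>. z x * (Y x \<bullet> b)) = - (LINT x|lebesgue_on \<Omega>. (Z x \<bullet> b) * y x)"
proof -
  note c = C1c_D(2,3)[OF C(1)] C1c_D(2,3)[OF C(2)]
  have "0 = (LINT x|lebesgue_on \<Omega>. (z x *\<^sub>R Y x + y x *\<^sub>R Z x) \<bullet> b)"
    using C1c_integral_partial[OF \<Omega>(1) C1c_mult[OF C]] by simp
  also have "\<dots> = (LINT x|lebesgue_on \<Omega>. z x * (Y x \<bullet> b) + (Z x \<bullet> b) * y x)"
    by (simp add: inner_add_left mult.commute)
  also have "\<dots> = (LINT x|lebesgue_on \<Omega>. z x * (Y x \<bullet> b)) + (LINT x|lebesgue_on \<Omega>. (Z x \<bullet> b) * y x)"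
    using c by (intro Bochner_Integration.integral_add integrable_continuous_lebesgue_on \<Omega> continuous_intros)
  finally show ?thesis by simp
qed

section \<open>Approximate solutions of the linear problem\<close>

locale elliptic_problem =
  fixes \<Omega> :: "(real^'n) set" and a :: "real^'n \<Rightarrow> real" and \<alpha> \<beta> p :: real
  assumes dim: "CARD('n) > 2" and p_eq: "p = 1 / (real CARD('n) - 2)"
    and open_\<Omega>: "open \<Omega>" and bounded_\<Omega>: "bounded \<Omega>"
    and a_measurable[measurable]: "a \<in> borel_measurable (lebesgue_on \<Omega>)"
    and \<alpha>_pos: "\<alpha> > 0" and \<beta>_pos: "\<beta> > 0"
    and a_bounds: "AE x in lebesgue_on \<Omega>. \<alpha> \<le> a x \<and> a x \<le> \<beta>"
begin

abbreviation M where "M \<equiv> lebesgue_on \<Omega>"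

definition energy :: "(real^'n \<Rightarrow> real) \<Rightarrow> (real^'n \<Rightarrow> real) \<Rightarrow> real" where
  "energy v w = (LINT x|M. a x * (grad v x \<bullet> grad w x))"

text \<open>
  Near-minimisers of the energy functional satisfy this, so the linear problem can be treated with
  test functions only, without completing them to a Hilbert space.
\<close>

definition approx_sol :: "(real^'n \<Rightarrow> real) \<Rightarrow> real \<Rightarrow> (real^'n \<Rightarrow> real) \<Rightarrow> bool" where
  "approx_sol h \<delta> v \<longleftrightarrow> v \<in> test_functions \<Omega> \<and> (\<forall>\<psi>\<in>test_functions \<Omega>.
     (energy v \<psi> - (LINT x|M. h x * \<psi> x))\<^sup>2 \<le> \<delta> * (LINT x|M. (norm (grad \<psi> x))\<^sup>2))"

sublocale finite_measure M
  by (rule finite_measure_lebesgue_on_bounded[OF open_\<Omega> bounded_\<Omega>])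

lemmas integrable_continuous = integrable_continuous_lebesgue_on[OF open_\<Omega> bounded_\<Omega>]

lemma continuous_imp_measurable: "continuous_on UNIV h \<Longrightarrow> h \<in> borel_measurable M"
  by (intro borel_imp_lebesgue_on borel_measurable_continuous_onI)

lemma integrable_a:
  fixes h :: "real^'n \<Rightarrow> real"
  assumes "integrable M h"
  shows "integrable M (\<lambda>x. a x * h x)"
proof (rule Bochner_Integration.integrable_bound)
  show "integrable M (\<lambda>x. \<beta> * h x)" using assms by simp
  show "(\<lambda>x. a x * h x) \<in> borel_measurable M" using assms by measurable
  show "AE x in M. norm (a x * h x) \<le> norm (\<beta> * h x)"
    using a_bounds
  proof eventually_elim
    case (elim x)
    then have "\<bar>a x\<bar> \<le> \<bar>\<beta>\<bar>" using \<alpha>_pos by linarith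
    then show ?case by (simp add: abs_mult mult_right_mono)
  qed
qed

lemma integrable_mult_bounded_continuous:
  fixes h :: "real^'n \<Rightarrow> real"
  assumes "integrable M h" "continuous_on UNIV g" "\<And>x. \<bar>g x\<bar> \<le> B"
  shows "integrable M (\<lambda>x. h x * g x)"
proof (rule Bochner_Integration.integrable_bound)
  show "integrable M (\<lambda>x. B * h x)" using assms by simp
  show "(\<lambda>x. h x * g x) \<in> borel_measurable M"
    using assms(1) continuous_imp_measurable[OF assms(2)] by measurable
  have "\<bar>h x\<bar> * \<bar>g x\<bar> \<le> \<bar>B\<bar> * \<bar>h x\<bar>" for x
    using mult_left_mono[OF order_trans[OF assms(3) abs_ge_self], of "\<bar>h x\<bar>" x] by (simp add: mult.commute)
  then show "AE x in M. norm (h x * g x) \<le> norm (B * h x)" by (simp add: abs_mult)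
qed

lemma continuous_test:
  assumes "\<phi> \<in> test_functions \<Omega>"
  shows "continuous_on UNIV \<phi>" "continuous_on UNIV (grad \<phi>)"
  using C1c_D(2,3)[OF C1c_grad[OF assms]] by auto

lemma integrable_mult_test:
  assumes "integrable M h" "\<phi> \<in> test_functions \<Omega>"
  shows "integrable M (\<lambda>x. h x * \<phi> x)"
  using C1c_bounded[OF C1c_grad[OF assms(2)]] integrable_mult_bounded_continuous[OF assms(1)]
    continuous_test[OF assms(2)] by metis

lemma integrable_energy:
  assumes "v \<in> test_functions \<Omega>" "w \<in> test_functions \<Omega>"
  shows "integrable M (\<lambda>x. a x * (grad v x \<bullet> grad w x))"
  by (intro integrable_a integrable_continuous continuous_intros continuous_test assms)

lemma energy_add_cmult:
  assumes "v \<in> test_functions \<Omega>" "w \<in> test_functions \<Omega>" "\<psi> \<in> test_functions \<Omega>"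
  shows "energy (\<lambda>x. v x + t * w x) \<psi> = energy v \<psi> + t * energy w \<psi>"
    "energy \<psi> (\<lambda>x. v x + t * w x) = energy \<psi> v + t * energy \<psi> w"
proof -
  have "grad (\<lambda>x. v x + t * w x) x = grad v x + t *\<^sub>R grad w x" for x
    by (simp add: grad_add[OF assms(1) test_functions_cmult[OF assms(2)]] grad_cmult[OF assms(2)])
  then show "energy (\<lambda>x. v x + t * w x) \<psi> = energy v \<psi> + t * energy w \<psi>"
    "energy \<psi> (\<lambda>x. v x + t * w x) = energy \<psi> v + t * energy \<psi> w"
    using integrable_energy assms
    by (simp_all add: energy_def inner_add_left inner_add_right distrib_left mult.left_commute[of _ t])
qed

lemma energy_bounds:
  assumes "v \<in> test_functions \<Omega>"
  shows "\<alpha> * (LINT x|M. (norm (grad v x))\<^sup>2) \<le> energy v v"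
    "energy v v \<le> \<beta> * (LINT x|M. (norm (grad v x))\<^sup>2)"
proof -
  have i: "integrable M (\<lambda>x. (norm (grad v x))\<^sup>2)"
    by (intro integrable_continuous continuous_intros continuous_test assms)
  have "(LINT x|M. \<alpha> * (norm (grad v x))\<^sup>2) \<le> energy v v"
    unfolding energy_def
  proof (rule integral_mono_AE)
    show "AE x in M. \<alpha> * (norm (grad v x))\<^sup>2 \<le> a x * (grad v x \<bullet> grad v x)"
      using a_bounds by eventually_elim (simp add: power2_norm_eq_inner mult_right_mono)
  qed (use i integrable_energy[OF assms assms] in auto)
  then show "\<alpha> * (LINT x|M. (norm (grad v x))\<^sup>2) \<le> energy v v" by simp
  have "energy v v \<le> (LINT x|M. \<beta> * (norm (grad v x))\<^sup>2)"
    unfolding energy_def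
  proof (rule integral_mono_AE)
    show "AE x in M. a x * (grad v x \<bullet> grad v x) \<le> \<beta> * (norm (grad v x))\<^sup>2"
      using a_bounds by eventually_elim (simp add: power2_norm_eq_inner mult_right_mono)
  qed (use i integrable_energy[OF assms assms] in auto)
  then show "energy v v \<le> \<beta> * (LINT x|M. (norm (grad v x))\<^sup>2)" by simp
qed

lemma energy_commute: "energy v w = energy w v"
  by (simp add: energy_def inner_commute)

lemmas poincare = C1c_poincare[OF open_\<Omega> bounded_\<Omega>]

text \<open>Evaluation at the minimum \<open>t = - q / Q\<close>. For \<open>Q = 0\<close> the
  expression is linear in \<open>t\<close>, and boundedness from below forces
  \<open>q = 0\<close>.\<close>

lemma quadratic_lower_bound_imp:
  fixes q Q d :: real
  assumes "Q \<ge> 0" "\<And>t. t * q + t\<^sup>2 / 2 * Q \<ge> - d"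
  shows "q\<^sup>2 \<le> 2 * d * Q"
proof (cases "Q = 0")
  case True
  then have "t * q \<ge> - d" for t using assms(2)[of t] by simp
  from this[of "- (\<bar>d\<bar> + 1) / q"] have "q = 0" by (cases "q = 0") auto
  then show ?thesis using True by simp
next
  case False
  have "- (q\<^sup>2 / (2 * Q)) \<ge> - d"
    using assms(2)[of "- q / Q"] False by (simp add: field_simps power2_eq_square)
  then show ?thesis using False \<open>Q \<ge> 0\<close> by (simp add: field_simps)
qed

text \<open>The direct method without its limit: by ellipticity and the Poincare inequality
  \<open>J\<close> is bounded below, so near-minimisers exist. Along a line
  \<open>v + t * \<psi>\<close> the quadratic \<open>J\<close> cannot fall by more than the
  remaining gap, and this bounds its first variation.\<close>

lemma approx_sol_exists:
  assumes h: "h \<in> borel_measurable M" "\<And>x. \<bar>h x\<bar> \<le> B" and "\<delta> > 0"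
  shows "\<exists>v. approx_sol h \<delta> v"
proof -
  define J where "J v = energy v v / 2 - (LINT x|M. h x * v x)" for v
  define C where "C = 1 + measure lebesgue \<Omega>"
  have C: "C > 0" by (simp add: C_def add_pos_nonneg)
  have B: "B \<ge> 0" using h(2)[of undefined] by linarith
  have ih: "integrable M h"
    using h by (intro integrable_const_bound[of _ B]) auto
  have lower: "J v \<ge> - ((B * C)\<^sup>2 / (2 * \<alpha>) * measure M \<Omega>)" if v: "v \<in> test_functions \<Omega>" for v
  proof -
    have i: "integrable M (\<lambda>x. (norm (grad v x))\<^sup>2)" "integrable M (\<lambda>x. norm (grad v x))" "integrable M (\<lambda>x. \<bar>v x\<bar>)"
      by (intro integrable_continuous continuous_intros continuous_test v)+
    have "(LINT x|M. h x * v x) \<le> (LINT x|M. B * \<bar>v x\<bar>)"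
    proof (rule integral_mono)
      show "h x * v x \<le> B * \<bar>v x\<bar>" for x
        using mult_right_mono[OF h(2)[of x], of "\<bar>v x\<bar>"] by (metis abs_ge_self abs_ge_zero abs_mult order_trans)
    qed (use i integrable_mult_test[OF ih v] in auto)
    also have "\<dots> \<le> B * (C * (LINT x|M. norm (grad v x)))"
      using poincare[OF C1c_grad[OF v]] B dim by (simp add: mult_left_mono C_def)
    also have "\<dots> = (LINT x|M. B * C * norm (grad v x))" by simp
    also have "\<dots> \<le> (LINT x|M. \<alpha> / 2 * (norm (grad v x))\<^sup>2 + (B * C)\<^sup>2 / (2 * \<alpha>))"
    proof (rule integral_mono)
      fix x
      have "0 \<le> (\<alpha> * norm (grad v x) - B * C)\<^sup>2 / (2 * \<alpha>)" using \<alpha>_pos by simp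
      also have "\<dots> = \<alpha> / 2 * (norm (grad v x))\<^sup>2 + (B * C)\<^sup>2 / (2 * \<alpha>) - B * C * norm (grad v x)"
        using \<alpha>_pos by (simp add: field_simps power2_eq_square)
      finally show "B * C * norm (grad v x) \<le> \<alpha> / 2 * (norm (grad v x))\<^sup>2 + (B * C)\<^sup>2 / (2 * \<alpha>)" by simp
    qed (use i in auto)
    also have "\<dots> = \<alpha> / 2 * (LINT x|M. (norm (grad v x))\<^sup>2) + (B * C)\<^sup>2 / (2 * \<alpha>) * measure M \<Omega>"
      using i by simp
    also have "\<alpha> / 2 * (LINT x|M. (norm (grad v x))\<^sup>2) = \<alpha> * (LINT x|M. (norm (grad v x))\<^sup>2) / 2" by simp
    finally show ?thesis using energy_bounds(1)[OF v] unfolding J_def by linarith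
  qed
  define L where "L = (INF v\<in>test_functions \<Omega>. J v)"
  have bdd: "bdd_below (J ` test_functions \<Omega>)" using lower by (auto intro!: bdd_belowI)
  have L: "L \<le> J v" if "v \<in> test_functions \<Omega>" for v
    unfolding L_def using bdd that by (rule cINF_lower)
  \<comment> \<open>The size of the gap anticipates the factor 2 of
    \<open>quadratic_lower_bound_imp\<close> and the factor \<open>\<beta>\<close> in the upper
    bound for \<open>energy \<psi> \<psi>\<close>.\<close>
  have "L < L + \<delta> / (2 * \<beta>)" using \<open>\<delta> > 0\<close> \<beta>_pos by simp
  then obtain v where v: "v \<in> test_functions \<Omega>" "J v < L + \<delta> / (2 * \<beta>)"
    unfolding L_def using cINF_less_iff[OF _ bdd] test_functions_zero by blast
  have "(energy v \<psi> - (LINT x|M. h x * \<psi> x))\<^sup>2 \<le> \<delta> * (LINT x|M. (norm (grad \<psi> x))\<^sup>2)"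
    if \<psi>: "\<psi> \<in> test_functions \<Omega>" for \<psi>
  proof -
    have eq: "J (\<lambda>x. v x + t * \<psi> x) =
      J v + (t * (energy v \<psi> - (LINT x|M. h x * \<psi> x)) + t\<^sup>2 / 2 * energy \<psi> \<psi>)" for t
    proof -
      have "energy (\<lambda>x. v x + t * \<psi> x) (\<lambda>x. v x + t * \<psi> x) = energy v v + 2 * t * energy v \<psi> + t\<^sup>2 * energy \<psi> \<psi>"
        using v \<psi> by (simp add: energy_add_cmult test_functions_add test_functions_cmult
            energy_commute[of \<psi> v] algebra_simps power2_eq_square)
      moreover have "(LINT x|M. h x * (v x + t * \<psi> x)) = (LINT x|M. h x * v x) + t * (LINT x|M. h x * \<psi> x)"
        using integrable_mult_test[OF ih] v \<psi> by (simp add: distrib_left mult.left_commute[of _ t])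
      ultimately show ?thesis by (simp add: J_def field_simps)
    qed
    have LJ: "L \<le> J (\<lambda>x. v x + t * \<psi> x)" for t
      using v \<psi> by (intro L test_functions_add test_functions_cmult)
    have "t * (energy v \<psi> - (LINT x|M. h x * \<psi> x)) + t\<^sup>2 / 2 * energy \<psi> \<psi> \<ge> - (\<delta> / (2 * \<beta>))" for t
    proof -
      have "L \<le> J v + (t * (energy v \<psi> - (LINT x|M. h x * \<psi> x)) + t\<^sup>2 / 2 * energy \<psi> \<psi>)"
        using LJ[of t] by (simp only: eq)
      then show ?thesis using v(2) by linarith
    qed
    moreover have "energy \<psi> \<psi> \<ge> 0"
      by (rule order_trans[OF _ energy_bounds(1)[OF \<psi>]]) (use \<alpha>_pos in simp)
    ultimately
    have "(energy v \<psi> - (LINT x|M. h x * \<psi> x))\<^sup>2 \<le> 2 * (\<delta> / (2 * \<beta>)) * energy \<psi> \<psi>"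
      by (intro quadratic_lower_bound_imp) auto
    also have "\<dots> \<le> 2 * (\<delta> / (2 * \<beta>)) * (\<beta> * (LINT x|M. (norm (grad \<psi> x))\<^sup>2))"
      using energy_bounds(2)[OF \<psi>] \<open>\<delta> > 0\<close> \<beta>_pos by (intro mult_left_mono) auto
    finally show ?thesis using \<beta>_pos by simp
  qed
  with v show ?thesis unfolding approx_sol_def by blast
qed

text \<open>The function \<open>g (v x)\<close> need not be a test function, but it is a limit of
  test functions, uniformly together with the gradients. The inequality defining
  \<open>approx_sol\<close> passes to the limit by dominated convergence.\<close>

lemma approx_sol_compose:
  assumes h: "integrable M h" and v: "approx_sol h \<delta> v"
    and g: "\<And>s. (g has_field_derivative g' s) (at s)" "continuous_on UNIV g'" "g 0 = 0"
  shows "((LINT x|M. a x * (g' (v x) * (norm (grad v x))\<^sup>2)) - (LINT x|M. h x * g (v x)))\<^sup>2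
     \<le> \<delta> * (LINT x|M. (g' (v x))\<^sup>2 * (norm (grad v x))\<^sup>2)"
proof -
  have vt: "v \<in> test_functions \<Omega>" using v by (simp add: approx_sol_def)
  have "\<exists>\<psi>. \<psi> \<in> test_functions \<Omega> \<and> (\<forall>x. \<bar>\<psi> x - g (v x)\<bar> \<le> inverse (real (Suc k))) \<and>
      (\<forall>x. norm (grad \<psi> x - g' (v x) *\<^sub>R grad v x) \<le> inverse (real (Suc k)))" for k
    by (rule test_functions_approx_compose[OF vt g, of "inverse (real (Suc k))"]) auto
  then obtain \<psi> where \<psi>: "\<And>k. \<psi> k \<in> test_functions \<Omega>"
    "\<And>k x. \<bar>\<psi> k x - g (v x)\<bar> \<le> inverse (real (Suc k))"
    "\<And>k x. norm (grad (\<psi> k) x - g' (v x) *\<^sub>R grad v x) \<le> inverse (real (Suc k))"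
    by metis
  define G where "G x = g' (v x) *\<^sub>R grad v x" for x
  have C: "C1c \<Omega> (\<lambda>x. g (v x)) G"
    unfolding G_def by (rule C1c_compose[OF C1c_grad[OF vt] g])
  have cont: "continuous_on UNIV (\<lambda>x. g (v x))" "continuous_on UNIV G"
    using C1c_D(2,3)[OF C] by auto
  obtain B where B: "\<And>x. \<bar>g (v x)\<bar> \<le> B" "\<And>x. norm (G x) \<le> B" using C1c_bounded[OF C] by metis
  obtain V where V: "\<And>x. norm (grad v x) \<le> V" using C1c_bounded[OF C1c_grad[OF vt]] by metis
  have le1: "inverse (real (Suc k)) \<le> 1" for k by (simp add: field_simps)
  have lim1: "(\<lambda>k. \<psi> k x) \<longlonglongrightarrow> g (v x)" for x
    by (rule Lim_transform_bound[OF _ LIMSEQ_inverse_real_of_nat, THEN LIM_zero_cancel])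
      (use \<psi>(2) in auto)
  have lim2: "(\<lambda>k. grad (\<psi> k) x) \<longlonglongrightarrow> G x" for x
    by (rule Lim_transform_bound[OF _ LIMSEQ_inverse_real_of_nat, THEN LIM_zero_cancel])
      (use \<psi>(3) in \<open>auto simp: G_def\<close>)
  have b1: "\<bar>\<psi> k x\<bar> \<le> B + 1" for k x using \<psi>(2)[of k x] B(1)[of x] le1[of k] by linarith
  have b2: "norm (grad (\<psi> k) x) \<le> B + 1" for k x
    using norm_triangle_sub[of "grad (\<psi> k) x" "G x"] \<psi>(3)[of k x] B(2)[of x] le1[of k] unfolding G_def by linarith
  have [measurable]: "\<psi> k \<in> borel_measurable M" "grad (\<psi> k) \<in> borel_measurable M"
    "grad v \<in> borel_measurable M" "(\<lambda>x. g (v x)) \<in> borel_measurable M" "G \<in> borel_measurable M"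
    "h \<in> borel_measurable M" for k
    using continuous_test[OF \<psi>(1)] continuous_test[OF vt] cont h by (auto intro: continuous_imp_measurable)
  have V0: "V \<ge> 0" using V[of undefined] norm_ge_zero order_trans by blast
  have B0: "B \<ge> 0" using B(1)[of undefined] by linarith
  have i1: "(\<lambda>k. LINT x|M. h x * \<psi> k x) \<longlonglongrightarrow> (LINT x|M. h x * g (v x))"
  proof (rule integral_dominated_convergence[where w = "\<lambda>x. (B + 1) * \<bar>h x\<bar>"])
    show "AE x in M. norm (h x * \<psi> k x) \<le> (B + 1) * \<bar>h x\<bar>" for k
      using mult_right_mono[OF b1, of "\<bar>h _\<bar>"] by (intro AE_I2) (simp add: abs_mult mult.commute)
  qed (use h lim1 in \<open>auto intro!: tendsto_intros\<close>)
  have i2: "(\<lambda>k. LINT x|M. a x * (grad v x \<bullet> grad (\<psi> k) x)) \<longlonglongrightarrow> (LINT x|M. a x * (grad v x \<bullet> G x))"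
  proof (rule integral_dominated_convergence[where w = "\<lambda>x. \<beta> * (V * (B + 1))"])
    show "AE x in M. norm (a x * (grad v x \<bullet> grad (\<psi> k) x)) \<le> \<beta> * (V * (B + 1))" for k
      using a_bounds
    proof eventually_elim
      case (elim x)
      have "\<bar>grad v x \<bullet> grad (\<psi> k) x\<bar> \<le> norm (grad v x) * norm (grad (\<psi> k) x)" by (rule Cauchy_Schwarz_ineq2)
      also have "\<dots> \<le> V * (B + 1)" using V b2 V0 by (intro mult_mono) auto
      finally show ?case using elim \<alpha>_pos by (simp add: abs_mult mult_mono)
    qed
  qed (use lim2 in \<open>auto intro!: tendsto_intros\<close>)
  have i3: "(\<lambda>k. LINT x|M. (norm (grad (\<psi> k) x))\<^sup>2) \<longlonglongrightarrow> (LINT x|M. (norm (G x))\<^sup>2)"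
  proof (rule integral_dominated_convergence[where w = "\<lambda>x. (B + 1)\<^sup>2"])
    show "AE x in M. norm ((norm (grad (\<psi> k) x))\<^sup>2) \<le> (B + 1)\<^sup>2" for k
      using b2 by (intro AE_I2) (auto intro: power_mono)
  qed (use lim2 in \<open>auto intro!: tendsto_intros\<close>)
  have "((LINT x|M. a x * (grad v x \<bullet> G x)) - (LINT x|M. h x * g (v x)))\<^sup>2 \<le> \<delta> * (LINT x|M. (norm (G x))\<^sup>2)"
  proof (rule LIMSEQ_le)
    show "(\<lambda>k. (energy v (\<psi> k) - (LINT x|M. h x * \<psi> k x))\<^sup>2) \<longlonglongrightarrow>
      ((LINT x|M. a x * (grad v x \<bullet> G x)) - (LINT x|M. h x * g (v x)))\<^sup>2"
      unfolding energy_def by (intro tendsto_intros i1 i2)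
    show "(\<lambda>k. \<delta> * (LINT x|M. (norm (grad (\<psi> k) x))\<^sup>2)) \<longlonglongrightarrow> \<delta> * (LINT x|M. (norm (G x))\<^sup>2)"
      by (intro tendsto_intros i3)
    show "\<exists>N. \<forall>k\<ge>N. (energy v (\<psi> k) - (LINT x|M. h x * \<psi> k x))\<^sup>2 \<le> \<delta> * (LINT x|M. (norm (grad (\<psi> k) x))\<^sup>2)"
      using v \<psi>(1) unfolding approx_sol_def by blast
  qed
  then show ?thesis by (simp add: G_def power_mult_distrib power2_norm_eq_inner)
qed

text \<open>This is where linearity enters: residuals subtract, and the square of a difference is at
  most twice the sum of the squares. Scaling by \<open>l\<close> costs \<open>l\<^sup>2\<close> in
  the slack, so the slacks have to be small compared with it.\<close>

lemma approx_sol_diff: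
  assumes "integrable M h" "integrable M k" "approx_sol h \<delta> v" "approx_sol k \<epsilon> w"
  shows "approx_sol (\<lambda>x. l * (h x - k x)) (2 * l\<^sup>2 * (\<delta> + \<epsilon>)) (\<lambda>x. l * (v x - w x))"
proof -
  have t: "v \<in> test_functions \<Omega>" "w \<in> test_functions \<Omega>"
    using assms by (auto simp: approx_sol_def)
  have e: "(\<lambda>x. l * (v x - w x)) = (\<lambda>x. l * v x + (- l) * w x)" by (auto simp: algebra_simps)
  have "(energy (\<lambda>x. l * (v x - w x)) \<psi> - (LINT x|M. l * (h x - k x) * \<psi> x))\<^sup>2
     \<le> 2 * l\<^sup>2 * (\<delta> + \<epsilon>) * (LINT x|M. (norm (grad \<psi> x))\<^sup>2)" if \<psi>: "\<psi> \<in> test_functions \<Omega>" for \<psi>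
  proof -
    define X where "X = energy v \<psi> - (LINT x|M. h x * \<psi> x)"
    define Y where "Y = energy w \<psi> - (LINT x|M. k x * \<psi> x)"
    \<comment> \<open>Homogeneity is read off from \<open>0 + l * v\<close>, the energy of 0 being
      computed from \<open>v - v\<close>.\<close>
    have "energy (\<lambda>x. l * v x) \<psi> = l * energy v \<psi>"
      using energy_add_cmult(1)[OF test_functions_zero t(1) \<psi>, of l]
        energy_add_cmult(1)[OF t(1) t(1) \<psi>, of "-1"] by simp
    then have e1: "energy (\<lambda>x. l * (v x - w x)) \<psi> = l * (energy v \<psi> - energy w \<psi>)"
      unfolding e using energy_add_cmult(1)[OF test_functions_cmult[OF t(1)] t(2) \<psi>, of l "-l"]
      by (simp add: algebra_simps)
    have e2: "(LINT x|M. l * (h x - k x) * \<psi> x) = l * ((LINT x|M. h x * \<psi> x) - (LINT x|M. k x * \<psi> x))"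
      using integrable_mult_test[OF assms(1) \<psi>] integrable_mult_test[OF assms(2) \<psi>]
      by (simp add: mult.assoc left_diff_distrib)
    have "(energy (\<lambda>x. l * (v x - w x)) \<psi> - (LINT x|M. l * (h x - k x) * \<psi> x))\<^sup>2 = l\<^sup>2 * (X - Y)\<^sup>2"
      unfolding e1 e2 X_def Y_def power2_eq_square by algebra
    also have "\<dots> \<le> l\<^sup>2 * (2 * X\<^sup>2 + 2 * Y\<^sup>2)"
      using sum_squares_bound[of X "-Y"] by (intro mult_left_mono) (auto simp: power2_eq_square algebra_simps)
    also have "\<dots> \<le> l\<^sup>2 * (2 * (\<delta> * (LINT x|M. (norm (grad \<psi> x))\<^sup>2)) + 2 * (\<epsilon> * (LINT x|M. (norm (grad \<psi> x))\<^sup>2)))"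
      using assms(3,4) \<psi> unfolding X_def Y_def approx_sol_def by (intro mult_left_mono add_mono) auto
    finally show ?thesis by (simp add: algebra_simps)
  qed
  moreover have "(\<lambda>x. l * (v x - w x)) \<in> test_functions \<Omega>"
    unfolding e using t by (intro test_functions_add test_functions_cmult)
  ultimately show ?thesis by (simp add: approx_sol_def)
qed

end

section \<open>The a priori estimate\<close>

text \<open>
  With \<open>p = 1 / (N - 2)\<close> and \<open>\<theta> = p / (1 + p)\<close>, \<open>transform p\<close> is the inverse of the substitution
  \<open>v = sgn u * ((1 + \<bar>u\<bar>) powr (1 - \<theta>) - 1) / (1 - \<theta>)\<close>, for which \<open>\<nabla>v = \<nabla>u / (1 + \<bar>u\<bar>) powr \<theta>\<close>.
\<close>

definition weight :: "real \<Rightarrow> real \<Rightarrow> real" where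
  "weight p s = 1 + \<bar>s\<bar> / (1 + p)"

definition transform :: "real \<Rightarrow> real \<Rightarrow> real" where
  "transform p s = sgn s * (weight p s powr (1 + p) - 1)"

lemma weight_ge_1: "p > 0 \<Longrightarrow> weight p s \<ge> 1"
  by (simp add: weight_def)

lemma weight_pos: "p > 0 \<Longrightarrow> weight p s > 0"
  using weight_ge_1[of p s] by linarith

lemma continuous_on_weight: "p > 0 \<Longrightarrow> continuous_on S f \<Longrightarrow> continuous_on S (\<lambda>x. weight p (f x))"
  unfolding weight_def by (intro continuous_intros) auto

lemma continuous_on_weight_powr:
  assumes "p > 0" "continuous_on S f"
  shows "continuous_on S (\<lambda>x. weight p (f x) powr r)"
  by (intro continuous_on_powr continuous_on_weight assms continuous_intros)
    (metis assms(1) less_numeral_extra(3) weight_pos)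

text \<open>At the origin the difference quotient of the odd extension for \<open>h\<close> is that
  of \<open>H\<close> for \<open>\<bar>h\<bar>\<close>. The derivative is even, so no jump arises
  from the sign function.\<close>

lemma DERIV_odd_extension:
  assumes H: "\<And>y. y \<ge> 0 \<Longrightarrow> (H has_real_derivative H' y) (at y)" "H 0 = 0"
  shows "((\<lambda>s. sgn s * H \<bar>s\<bar>) has_real_derivative H' \<bar>s\<bar>) (at s)"
proof -
  consider "s > 0" | "s < 0" | "s = 0" by linarith
  then show ?thesis
  proof cases
    case 1
    have "((\<lambda>s. sgn s * H \<bar>s\<bar>) has_real_derivative H' s) (at s)"
      by (rule has_field_derivative_transform_within_open[OF H(1), of s "{0<..}"]) (use 1 in auto)
    then show ?thesis using 1 by simp
  next
    case 2
    have "((\<lambda>s. - H (- s)) has_real_derivative H' (- s)) (at s)"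
      using DERIV_minus[OF DERIV_chain2[of H "H' (- s)" uminus s "-1" UNIV]] H(1)[of "- s"] 2
        DERIV_minus[OF DERIV_ident, of s UNIV] by simp
    then have "((\<lambda>s. sgn s * H \<bar>s\<bar>) has_real_derivative H' (- s)) (at s)"
      by (rule has_field_derivative_transform_within_open[of _ _ s "{..<0}"]) (use 2 in auto)
    then show ?thesis using 2 by simp
  next
    case 3
    have "((\<lambda>h. (H (0 + h) - H 0) / h) \<longlongrightarrow> H' 0) (at 0)"
      using H(1)[of 0] by (simp add: DERIV_def)
    moreover have "filterlim abs (at 0) (at (0::real))"
      by (rule filterlim_atI) (auto simp: eventually_at_filter intro: tendsto_rabs_zero)
    ultimately have "((\<lambda>h. (H (0 + \<bar>h\<bar>) - H 0) / \<bar>h\<bar>) \<longlongrightarrow> H' 0) (at 0)"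
      by (rule filterlim_compose)
    moreover have "(H (0 + \<bar>h\<bar>) - H 0) / \<bar>h\<bar> = (sgn (0 + h) * H \<bar>0 + h\<bar> - sgn 0 * H \<bar>0\<bar>) / h" for h
      using H(2) by (cases h "0 :: real" rule: linorder_cases) auto
    ultimately show ?thesis using 3 by (simp add: DERIV_def)
  qed
qed

lemma DERIV_transform:
  assumes "p > 0"
  shows "(transform p has_real_derivative weight p s powr p) (at s)"
proof -
  have "((\<lambda>y. (1 + y / (1 + p)) powr (1 + p) - 1) has_real_derivative (1 + y / (1 + p)) powr p) (at y)"
    if "y \<ge> 0" for y
  proof -
    have "1 + y / (1 + p) > 0" using that assms by (simp add: add_pos_nonneg)
    then show ?thesis
      using assms by (auto intro!: derivative_eq_intros)
  qed
  from DERIV_odd_extension[OF this] show ?thesis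
    unfolding transform_def[abs_def] weight_def by simp
qed

lemma DERIV_log_weight:
  assumes "p > 0"
  shows "((\<lambda>s. sgn s * ((1 + p) * ln (weight p s))) has_real_derivative 1 / weight p s) (at s)"
proof -
  have "((\<lambda>y. (1 + p) * ln (1 + y / (1 + p))) has_real_derivative 1 / (1 + y / (1 + p))) (at y)"
    if "y \<ge> 0" for y
  proof -
    have "1 + y / (1 + p) > 0" using that assms by (simp add: add_pos_nonneg)
    then show ?thesis
      using assms by (auto intro!: derivative_eq_intros)
  qed
  from DERIV_odd_extension[OF this] show ?thesis
    unfolding weight_def by simp
qed

text \<open>Raised to the power \<open>p / (1 + p)\<close>, this identifies the degenerate factor
  \<open>(1 + \<bar>u\<bar>) powr \<theta>\<close> with the derivative of the substitution, against
  which it cancels.\<close>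

lemma one_plus_abs_transform: "p > 0 \<Longrightarrow> 1 + \<bar>transform p s\<bar> = weight p s powr (1 + p)"
  using ge_one_powr_ge_zero[OF weight_ge_1, of p "1 + p" s]
  by (cases "s = 0") (auto simp: transform_def abs_mult weight_def)

section \<open>Elementary inequalities behind the a priori estimate\<close>

lemma one_plus_powr_le:
  fixes t q :: real
  assumes "t \<ge> 0" "0 < q" "q \<le> 2"
  shows "(1 + t) powr q \<le> 4 * (1 + t powr q)"
proof -
  have "(1 + t) powr q \<le> (2 * max 1 t) powr q" using assms by (intro powr_mono2) auto
  also have "\<dots> = 2 powr q * max 1 t powr q" using assms by (simp add: powr_mult)
  also have "\<dots> \<le> 2 powr 2 * (1 + t powr q)"
    using assms by (intro mult_mono powr_mono) (auto simp: max_def)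
  finally show ?thesis by simp
qed

lemma four_mult_le_power2_sum: "4 * x * y \<le> (x + y)\<^sup>2" for x y :: real
  using sum_squares_bound[of x y] by (simp add: power2_sum)

lemma weighted_am_gm:
  fixes t b x y :: real
  assumes "t > 0" "b > 0"
  shows "x * y \<le> t / 2 * (x\<^sup>2 / b) + 1 / (2 * t) * (b * y\<^sup>2)"
proof -
  have "0 \<le> (t * x - b * y)\<^sup>2 / (2 * t * b)" using assms by simp
  also have "\<dots> = t / 2 * (x\<^sup>2 / b) + 1 / (2 * t) * (b * y\<^sup>2) - x * y"
    using assms by (simp add: power2_eq_square field_simps)
  finally show ?thesis by simp
qed

text \<open>The pairing of \<open>L log L\<close> with exponentials. If \<open>s\<close> exceeds
  \<open>ln (1 + y)\<close>, then both \<open>y\<close> and \<open>s\<close> are at most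
  \<open>exp s\<close>.\<close>

lemma llogl_young:
  fixes y s :: real
  assumes "s \<ge> 0" "y \<ge> 0"
  shows "y * s \<le> y * ln (1 + y) + exp (2 * s)"
proof (cases "s \<le> ln (1 + y)")
  case True
  then have "y * s \<le> y * ln (1 + y)" using assms by (intro mult_left_mono) auto
  then show ?thesis using exp_ge_zero[of "2 * s"] by linarith
next
  case False
  then have "exp (ln (1 + y)) < exp s" by simp
  then have "y < exp s" using assms by simp
  moreover have "s \<le> exp s" using exp_ge_add_one_self[of s] by linarith
  ultimately have "y * s \<le> exp s * exp s" using assms by (intro mult_mono) auto
  moreover have "y * ln (1 + y) \<ge> 0" using assms by simp
  moreover have "exp s * exp s = exp (2 * s)" by (simp only: mult_2 exp_add)
  ultimately show ?thesis by linarith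
qed

lemma power_powr_eq: "(L::real) > 0 \<Longrightarrow> (L ^ n) powr r = L powr (real n * r)"
  by (metis powr_powr powr_realpow)

text \<open>Interpolation in place of Hoelder's inequality, split at \<open>b = L ^ 16\<close>;
  above it one writes \<open>b powr (1/4) = b * b powr (-3/4)\<close>. If \<open>L ^ 16\<close> is 1
  plus the integral of \<open>b powr r\<close>, both terms integrate to at most a multiple of
  \<open>L ^ 4\<close>.\<close>

lemma powr_quarter_le:
  fixes b L :: real
  assumes "b \<ge> 1" "L \<ge> 1" "r \<ge> 1"
  shows "b powr (1/4) \<le> L ^ 4 + b powr r / L ^ 12"
proof (cases "b \<le> L ^ 16")
  case True
  then have "b powr (1/4) \<le> (L ^ 16) powr (1/4)" using assms by (intro powr_mono2) auto
  also have "\<dots> = L ^ 4" using assms by (simp add: power_powr_eq)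
  finally have "b powr (1/4) \<le> L ^ 4" .
  moreover have "b powr r / L ^ 12 \<ge> 0" using assms by simp
  ultimately show ?thesis by linarith
next
  case False
  have "b powr (1/4) = b powr 1 * b powr (-3/4)" by (simp only: flip: powr_add) simp
  also have "\<dots> \<le> b powr r * (L ^ 16) powr (-3/4)"
    using False assms by (intro mult_mono powr_mono powr_mono2') auto
  also have "(L ^ 16) powr (-3/4) = 1 / L ^ 12"
    using assms powr_minus_divide[of L 12] by (simp add: power_powr_eq)
  finally have "b powr (1/4) \<le> b powr r / L ^ 12" by simp
  then show ?thesis using assms zero_le_power[of L 4] by linarith
qed

context elliptic_problem
begin

lemma p_pos: "p > 0" and p_le_1: "p \<le> 1"
  using dim by (auto simp: p_eq)

text \<open>Inside the locale the exact value of \<open>p\<close> enters here only; all else rests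
  on \<open>0 < p\<close> and \<open>p \<le> 1\<close>.\<close>

lemma sobolev_exponent: "real CARD('n) / (real CARD('n) - 1) = (1 + 2 * p) / (1 + p)"
proof -
  define n where "n = real CARD('n) - 2"
  have n: "n > 0" "real CARD('n) = n + 2" "p = 1 / n" using dim by (simp_all add: n_def p_eq)
  have "1 + 2 * (1 / n) = (n + 2) / n" "1 + 1 / n = (n + 1) / n"
    using n(1) by (simp_all add: field_simps)
  then show ?thesis unfolding n(2,3) using n(1) by simp
qed

lemmas weight_ge1 = weight_ge_1[OF p_pos] and weight_gt0 = weight_pos[OF p_pos]

lemma C1c_transform:
  assumes "w \<in> test_functions \<Omega>"
  shows "C1c \<Omega> (\<lambda>x. transform p (w x)) (\<lambda>x. weight p (w x) powr p *\<^sub>R grad w x)"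
  by (rule C1c_compose[OF C1c_grad[OF assms] DERIV_transform[OF p_pos]])
    (auto simp: transform_def intro!: continuous_on_weight_powr p_pos continuous_intros)

lemma integrable_weight:
  assumes "w \<in> test_functions \<Omega>"
  shows "integrable M (\<lambda>x. weight p (w x) powr r)"
    "integrable M (\<lambda>x. (norm (grad w x))\<^sup>2 / weight p (w x))"
    "integrable M (\<lambda>x. norm (grad w x) * weight p (w x) powr r)"
    "r > 0 \<Longrightarrow> integrable M (\<lambda>x. \<bar>transform p (w x)\<bar> powr r)"
  using C1c_D(3)[OF C1c_transform[OF assms]] less_imp_neq[OF weight_gt0]
  by (auto intro!: integrable_continuous continuous_intros continuous_on_weight_powr p_pos
      continuous_on_weight continuous_test[OF assms] continuous_on_abs_powr)

text \<open>The derivative of the logarithmic test function produces the integrand of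
  \<open>E\<close>, and its values are paired with \<open>h\<close> by \<open>llogl_young\<close>.
  The residual of the approximate solution is at most the square root of \<open>E\<close>, which is
  absorbed into \<open>\<alpha> * E / 2\<close> at the price of
  \<open>1 / (2 * \<alpha>)\<close>.\<close>

lemma log_estimate:
  assumes h: "integrable M h" "integrable M (\<lambda>x. \<bar>h x\<bar> * ln (1 + \<bar>h x\<bar>))"
    and w: "approx_sol h \<delta> w" "\<delta> \<le> 1"
  defines "E \<equiv> LINT x|M. (norm (grad w x))\<^sup>2 / weight p (w x)"
  shows "\<alpha> * E / 2 \<le> 16 * (LINT x|M. \<bar>h x\<bar> * ln (1 + \<bar>h x\<bar>)) +
    16 * (LINT x|M. weight p (w x) powr (1/4)) + 1 / (2 * \<alpha>)"
proof -
  have wt: "w \<in> test_functions \<Omega>" using w(1) by (simp add: approx_sol_def)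
  note iw = integrable_weight[OF wt]
  have E: "E \<ge> 0"
    unfolding E_def using weight_gt0 by (intro Bochner_Integration.integral_nonneg) (simp add: less_imp_le)
  define g where "g s = sgn s * ((1 + p) * ln (weight p s))" for s
  define X where "X = (LINT x|M. a x * (1 / weight p (w x) * (norm (grad w x))\<^sup>2))"
  define Y where "Y = (LINT x|M. h x * g (w x))"
  have c1: "continuous_on UNIV (\<lambda>s. 1 / weight p s)"
    using less_imp_neq[OF weight_gt0]
    by (auto intro!: continuous_intros continuous_on_weight p_pos)
  have gd: "(g has_real_derivative 1 / weight p s) (at s)" for s
    unfolding g_def using DERIV_log_weight[OF p_pos] .
  have g0: "g 0 = 0" by (simp add: g_def)
  have "(X - Y)\<^sup>2 \<le> \<delta> * (LINT x|M. (1 / weight p (w x))\<^sup>2 * (norm (grad w x))\<^sup>2)"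
    unfolding X_def Y_def by (rule approx_sol_compose[OF h(1) w(1) gd c1 g0])
  \<comment> \<open>One of the two factors \<open>1 / weight p (w x)\<close> is dropped, being at
    most 1.\<close>
  also have "\<dots> \<le> 1 * E"
  proof (rule mult_mono)
    show "(LINT x|M. (1 / weight p (w x))\<^sup>2 * (norm (grad w x))\<^sup>2) \<le> E"
      unfolding E_def
    proof (rule integral_mono)
      show "integrable M (\<lambda>x. (1 / weight p (w x))\<^sup>2 * (norm (grad w x))\<^sup>2)"
        using less_imp_neq[OF weight_gt0]
        by (auto intro!: integrable_continuous continuous_intros continuous_on_weight p_pos continuous_test[OF wt])
      show "(1 / weight p (w x))\<^sup>2 * (norm (grad w x))\<^sup>2 \<le> (norm (grad w x))\<^sup>2 / weight p (w x)" for x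
        using mult_mono[OF _ weight_ge1[of "w x"], of "(norm (grad w x))\<^sup>2" "(norm (grad w x))\<^sup>2"] weight_gt0[of "w x"]
        by (simp add: field_simps power2_eq_square)
    qed (rule iw)
  qed (use w(2) in auto)
  finally have XY: "(X - Y)\<^sup>2 \<le> E" by simp
  have "X - Y \<le> \<alpha> * E / 2 + 1 / (2 * \<alpha>)"
  proof (rule power2_le_imp_le)
    have "E = 4 * (\<alpha> * E / 2) * (1 / (2 * \<alpha>))" using \<alpha>_pos by simp
    also have "\<dots> \<le> (\<alpha> * E / 2 + 1 / (2 * \<alpha>))\<^sup>2"
      by (rule four_mult_le_power2_sum)
    finally show "(X - Y)\<^sup>2 \<le> (\<alpha> * E / 2 + 1 / (2 * \<alpha>))\<^sup>2" using XY by linarith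
  qed (use E \<alpha>_pos in auto)
  moreover have "\<alpha> * E \<le> X"
  proof -
    have "(LINT x|M. \<alpha> * ((norm (grad w x))\<^sup>2 / weight p (w x))) \<le> X"
      unfolding X_def
    proof (rule integral_mono_AE)
      show "integrable M (\<lambda>x. a x * (1 / weight p (w x) * (norm (grad w x))\<^sup>2))"
        using iw(2) by (intro integrable_a) simp
      show "AE x in M. \<alpha> * ((norm (grad w x))\<^sup>2 / weight p (w x)) \<le> a x * (1 / weight p (w x) * (norm (grad w x))\<^sup>2)"
        using a_bounds
      proof eventually_elim
        case (elim x)
        then have "\<alpha> * ((norm (grad w x))\<^sup>2 / weight p (w x)) \<le> a x * ((norm (grad w x))\<^sup>2 / weight p (w x))"
          using weight_gt0[of "w x"] by (intro mult_right_mono) auto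
        then show ?case by simp
      qed
    qed (intro integrable_mult_right iw)
    then show ?thesis unfolding E_def by (simp only: integral_mult_right_zero)
  qed
  moreover have "Y \<le> (LINT x|M. 16 * (\<bar>h x\<bar> * ln (1 + \<bar>h x\<bar>)) + 16 * weight p (w x) powr (1/4))"
    unfolding Y_def
  proof (rule integral_mono)
    have C: "C1c \<Omega> (\<lambda>x. g (w x)) (\<lambda>x. (1 / weight p (w x)) *\<^sub>R grad w x)"
      by (rule C1c_compose[OF C1c_grad[OF wt] gd c1 g0])
    show "integrable M (\<lambda>x. h x * g (w x))"
      using C1c_bounded[OF C] integrable_mult_bounded_continuous[OF h(1) C1c_D(3)[OF C]] by metis
    fix x
    define b where "b = weight p (w x)"
    have b: "b \<ge> 1" unfolding b_def by (rule weight_ge1)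
    have "\<bar>g (w x)\<bar> \<le> (1 + p) * ln b"
      using p_pos b by (simp add: g_def b_def abs_mult abs_sgn_eq weight_def)
    also have "\<dots> \<le> 2 * ln b" using p_le_1 b by (intro mult_right_mono) auto
    \<comment> \<open>Applying \<open>llogl_young\<close> to \<open>ln b / 8\<close> makes the
      exponential equal to \<open>b powr (1/4)\<close>, a power small enough for
      \<open>a_priori\<close> to close; the price is the factor 16.\<close>
    finally have "\<bar>g (w x)\<bar> \<le> 16 * (ln b / 8)" by simp
    then have "\<bar>h x\<bar> * \<bar>g (w x)\<bar> \<le> \<bar>h x\<bar> * (16 * (ln b / 8))" by (intro mult_left_mono) auto
    moreover have "h x * g (w x) \<le> \<bar>h x\<bar> * \<bar>g (w x)\<bar>" by (metis abs_ge_self abs_mult)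
    moreover have "\<bar>h x\<bar> * (ln b / 8) \<le> \<bar>h x\<bar> * ln (1 + \<bar>h x\<bar>) + exp (2 * (ln b / 8))"
      using b by (intro llogl_young) auto
    moreover have "exp (2 * (ln b / 8)) = b powr (1/4)" using b by (simp add: powr_def)
    ultimately show "h x * g (w x) \<le> 16 * (\<bar>h x\<bar> * ln (1 + \<bar>h x\<bar>)) + 16 * weight p (w x) powr (1/4)"
      unfolding b_def[symmetric] by linarith
  qed (use h iw in auto)
  moreover have "\<dots> = 16 * (LINT x|M. \<bar>h x\<bar> * ln (1 + \<bar>h x\<bar>)) + 16 * (LINT x|M. weight p (w x) powr (1/4))"
    using h iw by simp
  ultimately show ?thesis by linarith
qed

text \<open>The constant is chosen before \<open>w\<close>, \<open>h\<close> and
  \<open>\<delta>\<close> and depends on the data only through \<open>H0\<close>; the rescaled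
  differences rely on this. With \<open>L ^ 16 = 1 + m\<close>, the energy \<open>E\<close> is of
  order \<open>L ^ 4\<close>, the gradient of \<open>transform p (w x)\<close> of order
  \<open>L ^ 10\<close> in \<open>L^1\<close>, and therefore \<open>L ^ 16\<close> of order
  \<open>L ^ 15\<close>.\<close>

lemma a_priori:
  assumes "H0 \<ge> 0"
  shows "\<exists>C>0. \<forall>w h \<delta>. integrable M h \<longrightarrow> integrable M (\<lambda>x. \<bar>h x\<bar> * ln (1 + \<bar>h x\<bar>)) \<longrightarrow>
    (LINT x|M. \<bar>h x\<bar> * ln (1 + \<bar>h x\<bar>)) \<le> H0 \<longrightarrow> approx_sol h \<delta> w \<longrightarrow> \<delta> \<le> 1 \<longrightarrow>
    (LINT x|M. (norm (grad w x))\<^sup>2 / weight p (w x)) \<le> C \<and>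
    (LINT x|M. weight p (w x) powr (1 + 2 * p)) \<le> C"
proof -
  define \<mu> where "\<mu> = measure M \<Omega>"
  have \<mu>: "\<mu> \<ge> 0" by (simp add: \<mu>_def)
  \<comment> \<open>\<open>K1\<close> collects the terms of \<open>log_estimate\<close> divided by
    \<open>\<alpha> / 2\<close>, \<open>K2\<close> comes from the gradient bound, and
    \<open>K4\<close> from comparing \<open>L ^ 16\<close> with \<open>L ^ 15\<close>. The summand 1
    keeps \<open>K2\<close> and \<open>K4\<close> at least 1; in \<open>K4\<close> it also covers
    the 1 of \<open>1 + m\<close>.\<close>
  define K1 where "K1 = 2 * (16 * H0 + 16 * (\<mu> + 1) + 1 / (2 * \<alpha>)) / \<alpha>"
  define K2 where "K2 = (K1 + 1) / 2 + 1"
  define K4 where "K4 = 1 + 4 * \<mu> + 4 * K2 powr (3/2)"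
  define C where "C = (1 + K1) * K4 ^ 16"
  have K1: "K1 > 0" using assms \<mu> \<alpha>_pos by (auto simp: K1_def intro!: divide_pos_pos add_nonneg_pos)
  have K2: "K2 \<ge> 1" using K1 by (simp add: K2_def)
  have K4: "K4 \<ge> 1" using \<mu> by (simp add: K4_def)
  have C: "C > 0" using K1 K4 by (simp add: C_def)
  have "(LINT x|M. (norm (grad w x))\<^sup>2 / weight p (w x)) \<le> C \<and>
    (LINT x|M. weight p (w x) powr (1 + 2 * p)) \<le> C"
    if h: "integrable M h" "integrable M (\<lambda>x. \<bar>h x\<bar> * ln (1 + \<bar>h x\<bar>))"
      "(LINT x|M. \<bar>h x\<bar> * ln (1 + \<bar>h x\<bar>)) \<le> H0" and w: "approx_sol h \<delta> w" "\<delta> \<le> 1" for w h \<delta>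
  proof -
    have wt: "w \<in> test_functions \<Omega>" using w(1) by (simp add: approx_sol_def)
    note iw = integrable_weight[OF wt]
    define E where "E = (LINT x|M. (norm (grad w x))\<^sup>2 / weight p (w x))"
    define m where "m = (LINT x|M. weight p (w x) powr (1 + 2 * p))"
    \<comment> \<open>The sixteenth root makes all exponents below integral. The argument closes because \<open>1 + m\<close> is
      bounded by a multiple of its power \<open>15/16 < 1\<close>.\<close>
    define L where "L = root 16 (1 + m)"
    have m: "m \<ge> 0" unfolding m_def by (intro Bochner_Integration.integral_nonneg) simp
    have L16: "L ^ 16 = 1 + m" using m by (simp add: L_def)
    have L: "L \<ge> 1" using m by (simp add: L_def)
    have "(LINT x|M. weight p (w x) powr (1/4)) \<le> (LINT x|M. L ^ 4 + weight p (w x) powr (1 + 2 * p) / L ^ 12)"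
      using weight_ge1 L p_pos iw by (intro integral_mono powr_quarter_le) auto
    also have "\<dots> = \<mu> * L ^ 4 + m / L ^ 12"
      using iw by (simp add: m_def \<mu>_def)
    also have "m / L ^ 12 \<le> L ^ 16 / L ^ 12"
      using L16 L by (intro divide_right_mono) auto
    also have "L ^ 16 / L ^ 12 = L ^ 4" using L power_add[of L 4 12] by (simp add: field_simps)
    finally have quarter: "(LINT x|M. weight p (w x) powr (1/4)) \<le> (\<mu> + 1) * L ^ 4"
      by (simp add: algebra_simps)
    have L4: "L ^ 4 \<ge> 1" using L by simp
    have "\<alpha> * E / 2 \<le> 16 * H0 + 16 * ((\<mu> + 1) * L ^ 4) + 1 / (2 * \<alpha>)"
      using log_estimate[OF h(1,2) w] h(3) quarter unfolding E_def[symmetric] by linarith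
    also have "\<dots> \<le> 16 * H0 * L ^ 4 + 16 * ((\<mu> + 1) * L ^ 4) + 1 / (2 * \<alpha>) * L ^ 4"
      using mult_left_mono[OF L4, of "16 * H0"] mult_left_mono[OF L4, of "1 / (2 * \<alpha>)"] assms \<alpha>_pos by simp
    finally have E: "E \<le> K1 * L ^ 4"
      unfolding K1_def using \<alpha>_pos by (simp add: field_simps)
    have E0: "E \<ge> 0"
      unfolding E_def using weight_gt0 by (intro Bochner_Integration.integral_nonneg) (simp add: less_imp_le)
    \<comment> \<open>Cauchy--Schwarz in additive form: the parameter \<open>L ^ 6\<close> balances
      \<open>E\<close>, of order \<open>L ^ 4\<close>, against \<open>m \<le> L ^ 16\<close>, so
      that both terms are of order \<open>L ^ 10\<close>.\<close>
    have "(LINT x|M. norm (grad w x) * weight p (w x) powr p) \<le>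
       (LINT x|M. L ^ 6 / 2 * ((norm (grad w x))\<^sup>2 / weight p (w x)) + 1 / (2 * L ^ 6) * weight p (w x) powr (1 + 2 * p))"
    proof (rule integral_mono)
      fix x
      define b where "b = weight p (w x)"
      have b: "b > 0" unfolding b_def by (rule weight_gt0)
      have "b powr (2 * p) = b powr p * b powr p" by (simp only: mult_2 powr_add)
      then have e: "b powr (1 + 2 * p) = b * (b powr p)\<^sup>2"
        using b by (simp add: powr_add power2_eq_square)
      show "norm (grad w x) * weight p (w x) powr p \<le>
        L ^ 6 / 2 * ((norm (grad w x))\<^sup>2 / weight p (w x)) + 1 / (2 * L ^ 6) * weight p (w x) powr (1 + 2 * p)"
        unfolding b_def[symmetric] e using b L by (intro weighted_am_gm) auto
    qed (intro Bochner_Integration.integrable_add integrable_mult_right iw)+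
    also have "\<dots> = L ^ 6 / 2 * E + 1 / (2 * L ^ 6) * m"
      unfolding E_def m_def
      by (subst Bochner_Integration.integral_add)
        (intro integrable_mult_right iw | simp only: integral_mult_right_zero)+
    also have "\<dots> = L ^ 6 / 2 * E + m / (2 * L ^ 6)" by simp
    also have "\<dots> \<le> L ^ 6 / 2 * (K1 * L ^ 4) + L ^ 16 / (2 * L ^ 6)"
      using E L L16 by (intro add_mono mult_left_mono divide_right_mono) auto
    also have "\<dots> = (K1 + 1) / 2 * L ^ 10"
      using L power_add[of L 6 4] power_add[of L 10 6] by (simp add: field_simps)
    also have "\<dots> \<le> K2 * L ^ 10" using L by (intro mult_right_mono) (auto simp: K2_def)
    finally have D: "(LINT x|M. norm (weight p (w x) powr p *\<^sub>R grad w x)) \<le> K2 * L ^ 10"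
      by (simp add: mult.commute)
    define q where "q = (1 + 2 * p) / (1 + p)"
    have q: "1 \<le> q" "q \<le> 3/2" "(1 + p) * q = 1 + 2 * p"
      using p_pos p_le_1 by (auto simp: q_def field_simps)
    have KL: "K2 * L ^ 10 \<ge> 1"
      using mult_mono[OF K2 one_le_power[OF L, of 10]] K2 by simp
    have "(LINT x|M. \<bar>transform p (w x)\<bar> powr q) \<le> (K2 * L ^ 10) powr q"
      using C1c_sobolev[OF open_\<Omega> bounded_\<Omega> C1c_transform[OF wt] _ _ D] dim KL
      by (simp add: sobolev_exponent q_def)
    \<comment> \<open>The exponent \<open>q\<close> is largest in dimension 3, where it equals
      \<open>3/2\<close>. Even then the power of \<open>L\<close> is 15, below 16.\<close>
    also have "\<dots> \<le> (K2 * L ^ 10) powr (3/2)" using KL q by (intro powr_mono) auto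
    also have "\<dots> = K2 powr (3/2) * (L ^ 10) powr (3/2)" using K2 L by (simp add: powr_mult)
    also have "(L ^ 10) powr (3/2) = L ^ 15" using L by (simp add: power_powr_eq)
    finally have S: "(LINT x|M. \<bar>transform p (w x)\<bar> powr q) \<le> K2 powr (3/2) * L ^ 15" .
    have iz: "integrable M (\<lambda>x. \<bar>transform p (w x)\<bar> powr q)"
      using integrable_weight(4)[OF wt, of q] q by simp
    have "m \<le> (LINT x|M. 4 * (1 + \<bar>transform p (w x)\<bar> powr q))"
      unfolding m_def
    proof (rule integral_mono)
      fix x
      have "weight p (w x) powr (1 + 2 * p) = (1 + \<bar>transform p (w x)\<bar>) powr q"
        unfolding one_plus_abs_transform[OF p_pos] powr_powr q(3) ..
      also have "\<dots> \<le> 4 * (1 + \<bar>transform p (w x)\<bar> powr q)"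
        using q by (intro one_plus_powr_le) auto
      finally show "weight p (w x) powr (1 + 2 * p) \<le> 4 * (1 + \<bar>transform p (w x)\<bar> powr q)" .
    qed (use iw iz in auto)
    also have "\<dots> = 4 * \<mu> + 4 * (LINT x|M. \<bar>transform p (w x)\<bar> powr q)"
      using iz by (simp add: \<mu>_def)
    also have "\<dots> \<le> 4 * \<mu> + 4 * (K2 powr (3/2) * L ^ 15)" using S by simp
    also have "\<dots> \<le> 4 * \<mu> * L ^ 15 + 4 * (K2 powr (3/2) * L ^ 15)"
      using mult_left_mono[OF one_le_power[OF L, of 15], of "4 * \<mu>"] \<mu> by simp
    finally have "L ^ 16 \<le> K4 * L ^ 15"
      using one_le_power[OF L, of 15] unfolding L16 K4_def by (simp add: algebra_simps)
    then have "L * L ^ 15 \<le> K4 * L ^ 15" using power_Suc[of L 15] by simp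
    then have "L \<le> K4" using L by simp
    then have LK: "L ^ 16 \<le> K4 ^ 16" using L by (intro power_mono) auto
    note E
    also have "K1 * L ^ 4 \<le> K1 * L ^ 16"
      using K1 L by (intro mult_left_mono power_increasing) auto
    also have "\<dots> \<le> K1 * K4 ^ 16" using LK K1 by simp
    also have "\<dots> \<le> C" using K4 by (simp add: C_def algebra_simps)
    finally have "E \<le> C" .
    moreover have "m \<le> C"
    proof -
      have "m \<le> K4 ^ 16" using LK L16 by linarith
      also have "\<dots> \<le> C" using K4 K1 by (simp add: C_def algebra_simps)
      finally show ?thesis .
    qed
    ultimately show ?thesis by (simp add: E_def m_def)
  qed
  with C show ?thesis by blast
qed

end

section \<open>Convergence of the approximations\<close>

text \<open>Riesz--Fischer: for a subsequence with increments at most \<open>(1/2) ^ k\<close> the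
  telescoping series converges absolutely almost everywhere, and the sum of its norms dominates.
  Vector values let several sequences share one subsequence.\<close>

lemma L1_complete:
  fixes g :: "nat \<Rightarrow> 'a \<Rightarrow> 'b::{banach,second_countable_topology}"
  assumes g: "\<And>k. integrable M (g k)"
    and cauchy: "\<And>e. e > 0 \<Longrightarrow> \<exists>n0. \<forall>n\<ge>n0. \<forall>m\<ge>n0. (LINT x|M. norm (g n x - g m x)) \<le> e"
  obtains r G where "strict_mono (r :: nat \<Rightarrow> nat)" "integrable M G"
    "AE x in M. (\<lambda>k. g (r k) x) \<longlonglongrightarrow> G x" "(\<lambda>k. LINT x|M. norm (g (r k) x - G x)) \<longlonglongrightarrow> 0"
proof -
  have "\<exists>n0. \<forall>n\<ge>n0. \<forall>m\<ge>n0. (LINT x|M. norm (g n x - g m x)) \<le> (1/2) ^ k" for k :: nat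
    by (rule cauchy) simp
  then obtain N where N: "\<And>k n m. n \<ge> N k \<Longrightarrow> m \<ge> N k \<Longrightarrow> (LINT x|M. norm (g n x - g m x)) \<le> (1/2) ^ k"
    by metis
  \<comment> \<open>A running sum is strictly increasing, and both \<open>r k\<close> and
    \<open>r (Suc k)\<close> are at least \<open>N k\<close>.\<close>
  define r where "r k = (\<Sum>i\<le>k. Suc (N i))" for k
  have r: "strict_mono r" by (rule strict_monoI_Suc) (simp add: r_def)
  have rN: "r k \<ge> N k" for k 
    using member_le_sum[of k "{..k}" "\<lambda>i. Suc (N i)"] by (simp add: r_def)
  define d where "d k x = g (r (Suc k)) x - g (r k) x" for k x
  have id: "integrable M (d k)" for k using g by (auto simp: d_def[abs_def])
  have rS: "r (Suc k) \<ge> N k" for k using rN[of k] by (simp add: r_def)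
  have d_le: "(LINT x|M. norm (d k x)) \<le> (1/2) ^ k" for k
    unfolding d_def by (rule N[OF rS rN])
  have sd: "summable (\<lambda>k. LINT x|M. norm (d k x))"
    by (rule summable_comparison_test'[of "\<lambda>k. (1/2) ^ k" 0]) (use d_le in auto)
  have ae: "AE x in M. summable (\<lambda>k. norm (d k x))"
  proof -
    have [measurable]: "d k \<in> borel_measurable M" for k by (rule borel_measurable_integrable[OF id])
    have "(\<integral>\<^sup>+x. (\<Sum>k. ennreal (norm (d k x))) \<partial>M) = (\<Sum>k. \<integral>\<^sup>+x. norm (d k x) \<partial>M)"
      by (rule nn_integral_suminf) auto
    also have "\<dots> = (\<Sum>k. ennreal (LINT x|M. norm (d k x)))"
      using id by (intro suminf_cong nn_integral_eq_integral) auto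
    also have "\<dots> = ennreal (\<Sum>k. LINT x|M. norm (d k x))"
      using sd by (intro suminf_ennreal2) auto
    finally have "(\<integral>\<^sup>+x. (\<Sum>k. ennreal (norm (d k x))) \<partial>M) \<noteq> \<infinity>" by simp
    then have "AE x in M. (\<Sum>k. ennreal (norm (d k x))) \<noteq> \<infinity>"
      by (rule nn_integral_noteq_infinite[rotated]) auto
    then show ?thesis
      by eventually_elim (auto intro: summable_suminf_not_top)
  qed
  define G where "G x = g (r 0) x + (\<Sum>k. d k x)" for x
  have iG: "integrable M G"
    unfolding G_def by (intro Bochner_Integration.integrable_add g integrable_suminf id ae sd)
  have isum: "integrable M (\<lambda>x. \<Sum>k. norm (d k x))"
    by (rule integrable_suminf) (use id ae sd in auto)
  have part: "g (r k) x = g (r 0) x + (\<Sum>i<k. d i x)" for k x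
    by (induction k) (auto simp: d_def)
  have lim: "AE x in M. (\<lambda>k. g (r k) x) \<longlonglongrightarrow> G x"
    using ae
  proof eventually_elim
    case (elim x)
    then have "(\<lambda>k. \<Sum>i<k. d i x) \<longlonglongrightarrow> (\<Sum>k. d k x)"
      by (rule summable_LIMSEQ[OF summable_norm_cancel])
    then have "(\<lambda>k. g (r 0) x + (\<Sum>i<k. d i x)) \<longlonglongrightarrow> G x"
      unfolding G_def by (intro tendsto_intros)
    moreover have "(\<lambda>k. g (r k) x) = (\<lambda>k. g (r 0) x + (\<Sum>i<k. d i x))"
      by (rule ext, rule part)
    ultimately show ?case by (simp only:)
  qed
  have "(\<lambda>k. LINT x|M. norm (g (r k) x - G x)) \<longlonglongrightarrow> (LINT x|M. 0)"
  proof (rule integral_dominated_convergence[where w = "\<lambda>x. \<Sum>k. norm (d k x)"])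
    show "AE x in M. (\<lambda>k. norm (g (r k) x - G x)) \<longlonglongrightarrow> 0"
      using lim by eventually_elim (simp add: LIM_zero tendsto_norm_zero)
    show "AE x in M. norm (norm (g (r k) x - G x)) \<le> (\<Sum>k. norm (d k x))" for k
      using ae
    proof eventually_elim
      case (elim x)
      then have s: "summable (\<lambda>i. norm (d (i + k) x))" by (rule summable_ignore_initial_segment)
      have "G x - g (r k) x = (\<Sum>i. d (i + k) x)"
        using suminf_minus_initial_segment[OF summable_norm_cancel[OF elim], of k]
        unfolding G_def by (subst part) simp
      then have "norm (g (r k) x - G x) \<le> (\<Sum>i. norm (d (i + k) x))"
        using summable_norm[OF s] by (simp add: norm_minus_commute)
      also have "\<dots> = (\<Sum>k. norm (d k x)) - (\<Sum>i<k. norm (d i x))"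
        using elim by (rule suminf_minus_initial_segment)
      also have "\<dots> \<le> (\<Sum>k. norm (d k x))" by (simp add: sum_nonneg)
      finally show ?case by simp
    qed
  qed (use isum g iG in auto)
  then show ?thesis using that[OF r iG lim] by simp
qed

lemma L1_limit_inner:
  fixes g :: "nat \<Rightarrow> 'a \<Rightarrow> 'b::euclidean_space"
  assumes g: "\<And>k. integrable M (g k)" and G: "integrable M G"
    and lim: "(\<lambda>k. LINT x|M. norm (g k x - G x)) \<longlonglongrightarrow> 0"
    and w: "w \<in> borel_measurable M" "AE x in M. norm (w x) \<le> B"
  shows "(\<lambda>k. LINT x|M. g k x \<bullet> w x) \<longlonglongrightarrow> (LINT x|M. G x \<bullet> w x)"
proof (rule LIM_zero_cancel)
  have bound: "AE x in M. \<bar>h x \<bullet> w x\<bar> \<le> B * norm (h x)" for h :: "'a \<Rightarrow> 'b"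
    using w(2)
  proof eventually_elim
    case (elim x)
    have "\<bar>h x \<bullet> w x\<bar> \<le> norm (h x) * norm (w x)" by (rule Cauchy_Schwarz_ineq2)
    also have "\<dots> \<le> norm (h x) * B" using elim by (intro mult_left_mono) auto
    finally show ?case by (simp add: mult.commute)
  qed
  have int: "integrable M (\<lambda>x. h x \<bullet> w x)" if h: "integrable M h" for h :: "'a \<Rightarrow> 'b"
  proof (rule Bochner_Integration.integrable_bound)
    show "integrable M (\<lambda>x. B * norm (h x))" using h by simp
    show "(\<lambda>x. h x \<bullet> w x) \<in> borel_measurable M" using h w by measurable
    show "AE x in M. norm (h x \<bullet> w x) \<le> norm (B * norm (h x))"
      using bound[of h] by eventually_elim simp
  qed
  have "norm ((LINT x|M. g k x \<bullet> w x) - (LINT x|M. G x \<bullet> w x)) \<le> B * (LINT x|M. norm (g k x - G x))" for k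
  proof -
    have "(LINT x|M. g k x \<bullet> w x) - (LINT x|M. G x \<bullet> w x) = (LINT x|M. (g k x - G x) \<bullet> w x)"
      using int[OF g] int[OF G] by (simp add: inner_diff_left)
    also have "norm \<dots> \<le> (LINT x|M. norm ((g k x - G x) \<bullet> w x))" by (rule integral_norm_bound)
    also have "\<dots> \<le> (LINT x|M. B * norm (g k x - G x))"
    proof (rule integral_mono_AE)
      show "integrable M (\<lambda>x. norm ((g k x - G x) \<bullet> w x))"
        by (intro integrable_norm int Bochner_Integration.integrable_diff g G)
      show "AE x in M. norm ((g k x - G x) \<bullet> w x) \<le> B * norm (g k x - G x)"
        using bound[of "\<lambda>x. g k x - G x"] by simp
    qed (use g G in auto)
    finally show ?thesis by simp
  qed
  then show "(\<lambda>k. (LINT x|M. g k x \<bullet> w x) - (LINT x|M. G x \<bullet> w x)) \<longlonglongrightarrow> 0"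
    using tendsto_mult_right_zero[OF lim, of B] by (rule Lim_null_comparison[OF always_eventually, rotated, OF _ allI, rotated])
qed

text \<open>Subadditivity of the power \<open>p \<le> 1\<close>: after division by the larger number
  both parts lie between 0 and 1, where \<open>t \<le> t powr p\<close>.\<close>

lemma powr_diff_le:
  fixes x y p :: real
  assumes "x > 0" "y > 0" "0 < p" "p \<le> 1"
  shows "\<bar>x powr p - y powr p\<bar> \<le> \<bar>x - y\<bar> powr p"
  using assms(1,2)
proof (induction x y rule: linorder_wlog)
  case (sym a b)
  then show ?case by (simp add: abs_minus_commute)
next
  case (le a b)
  have sub: "t \<le> t powr p" if "0 \<le> t" "t \<le> 1" for t
    using powr_mono'[of p 1 t] that assms by (cases "t = 0") auto
  have "1 \<le> (a / b) powr p + ((b - a) / b) powr p"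
    using sub[of "a / b"] sub[of "(b - a) / b"] le by (simp add: diff_divide_distrib)
  then have "1 \<le> (a powr p + (b - a) powr p) / b powr p"
    using le by (simp add: powr_divide add_divide_distrib)
  then have "b powr p \<le> a powr p + (b - a) powr p" using le by (simp add: pos_le_divide_eq)
  moreover have "a powr p \<le> b powr p" using le assms by (intro powr_mono2) auto
  ultimately show ?case using le by (simp add: abs_if)
qed

lemma mult_powr_le:
  fixes x y r :: real
  assumes "x > 0" "y > 0" "r \<ge> 0"
  shows "x * y powr r \<le> x powr (1 + r) + y powr (1 + r)"
proof (cases "x \<le> y")
  case True
  then have "x * y powr r \<le> y powr (1 + r)" using assms by (simp add: powr_add mult_right_mono)
  then show ?thesis by (simp add: add_increasing)
next
  case False
  then have "x * y powr r \<le> x * x powr r" using assms by (intro mult_left_mono powr_mono2) auto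
  then show ?thesis using assms by (simp add: powr_add add_increasing2)
qed

text \<open>Hoelder continuity with the increment \<open>s - t\<close> written as
  \<open>l * (s - t)\<close> over \<open>l\<close>. The factor \<open>l powr (- p)\<close> vanishes
  for large \<open>l\<close>, and the rest is a moment of the rescaled difference.\<close>

lemma weight_diff_powr_le:
  assumes p: "0 < p" "p \<le> 1" and l: "l > 0"
  shows "\<bar>weight p s powr p - weight p t powr p\<bar> \<le> 2 * l powr (- p) * weight p (l * (s - t)) powr p"
proof -
  have "\<bar>weight p s powr p - weight p t powr p\<bar> \<le> \<bar>weight p s - weight p t\<bar> powr p"
    using p by (intro powr_diff_le weight_pos)
  also have "\<dots> \<le> (2 / l * weight p (l * (s - t))) powr p"
  proof (rule powr_mono2)
    have "\<bar>weight p s - weight p t\<bar> = \<bar>\<bar>s\<bar> - \<bar>t\<bar>\<bar> / (1 + p)"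
      using p by (simp add: weight_def flip: diff_divide_distrib)
    also have "\<dots> \<le> \<bar>s - t\<bar> / (1 + p)" using p by (intro divide_right_mono) auto
    also have "\<dots> = 1 / l * (\<bar>l * (s - t)\<bar> / (1 + p))" using l by (simp add: abs_mult)
    also have "\<dots> \<le> 1 / l * weight p (l * (s - t))" using l by (intro mult_left_mono) (auto simp: weight_def)
    also have "\<dots> \<le> 2 / l * weight p (l * (s - t))"
      using l weight_pos[OF p(1), of "l * (s - t)"] by (intro mult_right_mono divide_right_mono) auto
    finally show "\<bar>weight p s - weight p t\<bar> \<le> 2 / l * weight p (l * (s - t))" .
  qed (use p in auto)
  also have "\<dots> = 2 powr p * l powr (- p) * weight p (l * (s - t)) powr p"
    using l weight_pos[OF p(1), of "l * (s - t)"] by (simp add: powr_mult powr_divide powr_minus_divide)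
  also have "\<dots> \<le> 2 * l powr (- p) * weight p (l * (s - t)) powr p"
    using powr_mono[of p 1 2] p by (intro mult_right_mono) auto
  finally show ?thesis .
qed

section \<open>Comparison of two approximate solutions\<close>

context elliptic_problem
begin

text \<open>The rescaled difference \<open>d\<close> obeys bounds with the same \<open>C\<close>,
  although its gradient is \<open>l\<close> times that of \<open>v - w\<close>; this gives the
  factor \<open>1 / l\<close>. The change of the weight in front of \<open>grad w\<close> gives
  \<open>l powr (- p)\<close>.\<close>

lemma gradient_difference_estimate:
  assumes v: "v \<in> test_functions \<Omega>" and w: "w \<in> test_functions \<Omega>" and "l > 0"
  defines "d \<equiv> \<lambda>x. l * (v x - w x)"
  assumes Ew: "(LINT x|M. (norm (grad w x))\<^sup>2 / weight p (w x)) \<le> C"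
    and Ed: "(LINT x|M. (norm (grad d x))\<^sup>2 / weight p (d x)) \<le> C"
    and Mv: "(LINT x|M. weight p (v x) powr (1 + 2 * p)) \<le> C"
    and Mw: "(LINT x|M. weight p (w x) powr (1 + 2 * p)) \<le> C"
    and Md: "(LINT x|M. weight p (d x) powr (1 + 2 * p)) \<le> C"
  shows "(LINT x|M. norm (grad v x - grad w x)) \<le> 3 * C / l + 3 * C * l powr (- p)"
    and "(LINT x|M. norm (weight p (v x) powr p *\<^sub>R grad v x - weight p (w x) powr p *\<^sub>R grad w x))
      \<le> 3 * C / l + 3 * C * l powr (- p)"
proof -
  have d_eq: "d = (\<lambda>x. l * v x + (- l) * w x)" unfolding d_def by (auto simp: algebra_simps)
  have d: "d \<in> test_functions \<Omega>"
    unfolding d_eq using v w by (intro test_functions_add test_functions_cmult)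
  have gd: "grad d x = l *\<^sub>R (grad v x - grad w x)" for x
    unfolding d_eq grad_add[OF test_functions_cmult[OF v] test_functions_cmult[OF w]]
      grad_cmult[OF v] grad_cmult[OF w] by (simp add: scaleR_diff_right)
  note iv = integrable_weight[OF v] and iw = integrable_weight[OF w] and id = integrable_weight[OF d]
  \<comment> \<open>A common majorant of both integrands: its first line bounds the gradient
    difference times the weight of \<open>v\<close>, its second the difference of the weights times
    \<open>grad w\<close>. Mixed products of weights are split into pure moments by
    \<open>mult_powr_le\<close>.\<close>
  define R where "R x = 1 / (2 * l) * ((norm (grad d x))\<^sup>2 / weight p (d x) + (weight p (d x) powr (1 + 2 * p) + weight p (v x) powr (1 + 2 * p)))
    + l powr (- p) * ((norm (grad w x))\<^sup>2 / weight p (w x) + (weight p (w x) powr (1 + 2 * p) + weight p (d x) powr (1 + 2 * p)))" for x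
  have sq: "b powr (2 * p) = (b powr p)\<^sup>2" for b :: real
    by (simp only: mult_2 powr_add power2_eq_square)
  have first: "weight p (v x) powr p * norm (grad v x - grad w x) \<le>
      1 / (2 * l) * ((norm (grad d x))\<^sup>2 / weight p (d x) + (weight p (d x) powr (1 + 2 * p) + weight p (v x) powr (1 + 2 * p)))" for x
  proof -
    have "norm (grad d x) * weight p (v x) powr p \<le>
        1 / 2 * ((norm (grad d x))\<^sup>2 / weight p (d x)) + 1 / (2 * 1) * (weight p (d x) * (weight p (v x) powr p)\<^sup>2)"
      using weight_gt0 by (intro weighted_am_gm) auto
    moreover have "weight p (d x) * (weight p (v x) powr p)\<^sup>2 \<le> weight p (d x) powr (1 + 2 * p) + weight p (v x) powr (1 + 2 * p)"
      using mult_powr_le[OF weight_gt0 weight_gt0, of "2 * p" "d x" "v x"] p_pos unfolding sq by simp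
    ultimately have "norm (grad d x) * weight p (v x) powr p \<le>
        1 / 2 * ((norm (grad d x))\<^sup>2 / weight p (d x) + (weight p (d x) powr (1 + 2 * p) + weight p (v x) powr (1 + 2 * p)))"
      by simp
    then have "1 / l * (norm (grad d x) * weight p (v x) powr p) \<le> 1 / l *
        (1 / 2 * ((norm (grad d x))\<^sup>2 / weight p (d x) + (weight p (d x) powr (1 + 2 * p) + weight p (v x) powr (1 + 2 * p))))"
      using \<open>l > 0\<close> by (intro mult_left_mono) auto
    moreover have "1 / l * (norm (grad d x) * weight p (v x) powr p) = weight p (v x) powr p * norm (grad v x - grad w x)"
      using \<open>l > 0\<close> by (simp add: gd)
    ultimately show ?thesis by (simp add: mult.commute[of l 2])
  qed
  have second: "\<bar>weight p (v x) powr p - weight p (w x) powr p\<bar> * norm (grad w x) \<le>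
      l powr (- p) * ((norm (grad w x))\<^sup>2 / weight p (w x) + (weight p (w x) powr (1 + 2 * p) + weight p (d x) powr (1 + 2 * p)))" for x
  proof -
    have "norm (grad w x) * weight p (d x) powr p \<le>
        1 / 2 * ((norm (grad w x))\<^sup>2 / weight p (w x)) + 1 / (2 * 1) * (weight p (w x) * (weight p (d x) powr p)\<^sup>2)"
      using weight_gt0 by (intro weighted_am_gm) auto
    moreover have "weight p (w x) * (weight p (d x) powr p)\<^sup>2 \<le> weight p (w x) powr (1 + 2 * p) + weight p (d x) powr (1 + 2 * p)"
      using mult_powr_le[OF weight_gt0 weight_gt0, of "2 * p" "w x" "d x"] p_pos unfolding sq by simp
    ultimately have le: "2 * (norm (grad w x) * weight p (d x) powr p) \<le>
        (norm (grad w x))\<^sup>2 / weight p (w x) + (weight p (w x) powr (1 + 2 * p) + weight p (d x) powr (1 + 2 * p))"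
      by simp
    have "\<bar>weight p (v x) powr p - weight p (w x) powr p\<bar> * norm (grad w x) \<le>
        (2 * l powr (- p) * weight p (d x) powr p) * norm (grad w x)"
      unfolding d_def using p_pos p_le_1 \<open>l > 0\<close> by (intro mult_right_mono weight_diff_powr_le) auto
    also have "\<dots> = l powr (- p) * (2 * (norm (grad w x) * weight p (d x) powr p))" by simp
    also have "\<dots> \<le> l powr (- p) * ((norm (grad w x))\<^sup>2 / weight p (w x) + (weight p (w x) powr (1 + 2 * p) + weight p (d x) powr (1 + 2 * p)))"
      using le by (intro mult_left_mono) auto
    finally show ?thesis .
  qed
  have nonneg: "l powr (- p) * ((norm (grad w x))\<^sup>2 / weight p (w x) + (weight p (w x) powr (1 + 2 * p) + weight p (d x) powr (1 + 2 * p))) \<ge> 0" for x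
    using weight_gt0[of "w x"] by simp
  have pt1: "norm (grad v x - grad w x) \<le> R x" for x
  proof -
    have "1 * norm (grad v x - grad w x) \<le> weight p (v x) powr p * norm (grad v x - grad w x)"
      using weight_ge1[of "v x"] p_pos by (intro mult_right_mono ge_one_powr_ge_zero) auto
    then show ?thesis using first[of x] nonneg[of x] unfolding R_def by linarith
  qed
  have pt2: "norm (weight p (v x) powr p *\<^sub>R grad v x - weight p (w x) powr p *\<^sub>R grad w x) \<le> R x" for x
  proof -
    have "weight p (v x) powr p *\<^sub>R grad v x - weight p (w x) powr p *\<^sub>R grad w x =
      weight p (v x) powr p *\<^sub>R (grad v x - grad w x) + (weight p (v x) powr p - weight p (w x) powr p) *\<^sub>R grad w x"
      by (simp add: algebra_simps)
    also have "norm \<dots> \<le> weight p (v x) powr p * norm (grad v x - grad w x) + \<bar>weight p (v x) powr p - weight p (w x) powr p\<bar> * norm (grad w x)"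
      by (rule order_trans[OF norm_triangle_ineq]) simp
    finally show ?thesis using first[of x] second[of x] unfolding R_def by linarith
  qed
  have iR: "integrable M R"
    unfolding R_def by (intro Bochner_Integration.integrable_add integrable_mult_right iv iw id)
  have C: "C \<ge> 0"
    by (rule order_trans[OF _ Mv]) (simp add: Bochner_Integration.integral_nonneg)
  have "(LINT x|M. R x) = 1 / (2 * l) * ((LINT x|M. (norm (grad d x))\<^sup>2 / weight p (d x)) +
      ((LINT x|M. weight p (d x) powr (1 + 2 * p)) + (LINT x|M. weight p (v x) powr (1 + 2 * p))))
    + l powr (- p) * ((LINT x|M. (norm (grad w x))\<^sup>2 / weight p (w x)) +
      ((LINT x|M. weight p (w x) powr (1 + 2 * p)) + (LINT x|M. weight p (d x) powr (1 + 2 * p))))"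
    unfolding R_def
    by (simp only: Bochner_Integration.integral_add Bochner_Integration.integrable_add integrable_mult_right
        iv(1) iw(1,2) id(1,2) integral_mult_right_zero)
  also have "\<dots> \<le> 1 / (2 * l) * (C + (C + C)) + l powr (- p) * (C + (C + C))"
    using Ew Ed Mv Mw Md \<open>l > 0\<close> by (intro add_mono mult_left_mono) auto
  also have "\<dots> \<le> 3 * C / l + 3 * C * l powr (- p)"
    using C \<open>l > 0\<close> by (simp add: field_simps)
  finally have R: "(LINT x|M. R x) \<le> 3 * C / l + 3 * C * l powr (- p)" .
  have "(LINT x|M. norm (grad v x - grad w x)) \<le> (LINT x|M. R x)"
    by (rule integral_mono[OF _ iR pt1]) (intro integrable_continuous continuous_intros continuous_test v w)
  with R show "(LINT x|M. norm (grad v x - grad w x)) \<le> 3 * C / l + 3 * C * l powr (- p)" by linarith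
  have "(LINT x|M. norm (weight p (v x) powr p *\<^sub>R grad v x - weight p (w x) powr p *\<^sub>R grad w x)) \<le> (LINT x|M. R x)"
    by (rule integral_mono[OF _ iR pt2])
      (intro integrable_continuous continuous_intros continuous_on_weight_powr p_pos continuous_test v w)
  with R show "(LINT x|M. norm (weight p (v x) powr p *\<^sub>R grad v x - weight p (w x) powr p *\<^sub>R grad w x))
      \<le> 3 * C / l + 3 * C * l powr (- p)" by linarith
qed

end

section \<open>Data with \<open>f log (1 + |f|)\<close> integrable\<close>

lemma llogl_mono: "0 \<le> s \<Longrightarrow> s \<le> t \<Longrightarrow> s * ln (1 + s) \<le> t * ln (1 + t)" for s t :: real
  by (intro mult_mono) auto

locale llogl_problem = elliptic_problem \<Omega> a \<alpha> \<beta> p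
  for \<Omega> :: "(real^'n) set" and a \<alpha> \<beta> p +
  fixes f :: "real^'n \<Rightarrow> real"
  assumes f_integrable: "integrable (lebesgue_on \<Omega>) f"
    and f_llogl: "integrable (lebesgue_on \<Omega>) (\<lambda>x. f x * ln (1 + \<bar>f x\<bar>))"
begin

definition f_trunc :: "nat \<Rightarrow> real^'n \<Rightarrow> real" where
  "f_trunc n x = max (- real n) (min (real n) (f x))"

lemma f_measurable[measurable]: "f \<in> borel_measurable M"
  using f_integrable by (rule borel_measurable_integrable)

lemma f_trunc_measurable[measurable]: "f_trunc n \<in> borel_measurable M"
  unfolding f_trunc_def[abs_def] by measurable

lemma f_trunc_bounds: "\<bar>f_trunc n x\<bar> \<le> real n" "\<bar>f_trunc n x\<bar> \<le> \<bar>f x\<bar>"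
  by (auto simp: f_trunc_def)

lemma f_trunc_eq: "\<bar>f x\<bar> \<le> real n \<Longrightarrow> f_trunc n x = f x"
  by (auto simp: f_trunc_def)

text \<open>Where \<open>\<bar>f x\<bar> \<le> k\<close> both truncations equal \<open>f x\<close>;
  elsewhere both lie between 0 and \<open>f x\<close>.\<close>

lemma f_trunc_diff:
  assumes "k \<le> n" "k \<le> m"
  shows "\<bar>f_trunc n x - f_trunc m x\<bar> \<le> (if \<bar>f x\<bar> \<le> real k then 0 else \<bar>f x\<bar>)"
  using assms by (auto simp: f_trunc_def)

lemma f_trunc_integrable: "integrable M (f_trunc n)"
  by (rule Bochner_Integration.integrable_bound[OF f_integrable]) (auto simp: f_trunc_bounds)

text \<open>Scaling preserves \<open>L log L\<close> because
  \<open>1 + l * t \<le> (1 + l) * (1 + t)\<close>, so the logarithm gains only a constant.\<close>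

lemma llogl_scaled_integrable:
  assumes "l \<ge> 0"
  shows "integrable M (\<lambda>x. (l * \<bar>f x\<bar>) * ln (1 + l * \<bar>f x\<bar>))"
proof (rule Bochner_Integration.integrable_bound)
  have "integrable M (\<lambda>x. \<bar>f x * ln (1 + \<bar>f x\<bar>)\<bar>)" using f_llogl by simp
  then show "integrable M (\<lambda>x. l * (ln (1 + l) * \<bar>f x\<bar> + \<bar>f x * ln (1 + \<bar>f x\<bar>)\<bar>))"
    using f_integrable by simp
  show "AE x in M. norm (l * \<bar>f x\<bar> * ln (1 + l * \<bar>f x\<bar>)) \<le> norm (l * (ln (1 + l) * \<bar>f x\<bar> + \<bar>f x * ln (1 + \<bar>f x\<bar>)\<bar>))"
  proof (rule AE_I2)
    fix x
    define t where "t = \<bar>f x\<bar>"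
    have t: "t \<ge> 0" by (simp add: t_def)
    have lt: "l * t \<ge> 0" using assms t by simp
    have "1 + l * t \<le> (1 + l) * (1 + t)" using assms t by (simp add: algebra_simps)
    then have "ln (1 + l * t) \<le> ln ((1 + l) * (1 + t))"
      using lt by (intro ln_mono) auto
    also have "\<dots> = ln (1 + l) + ln (1 + t)" using assms t by (simp add: ln_mult)
    finally have "l * t * ln (1 + l * t) \<le> l * t * (ln (1 + l) + ln (1 + t))"
      using lt by (intro mult_left_mono)
    also have "\<dots> = l * (ln (1 + l) * t + t * ln (1 + t))" by (simp add: algebra_simps)
    finally have "l * t * ln (1 + l * t) \<le> l * (ln (1 + l) * t + t * ln (1 + t))" .
    moreover have "0 \<le> l * t * ln (1 + l * t)" using lt by simp
    moreover have eq: "\<bar>f x * ln (1 + t)\<bar> = t * ln (1 + t)" by (simp add: t_def abs_mult)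
    ultimately show "norm (l * \<bar>f x\<bar> * ln (1 + l * \<bar>f x\<bar>)) \<le> norm (l * (ln (1 + l) * \<bar>f x\<bar> + \<bar>f x * ln (1 + \<bar>f x\<bar>)\<bar>))"
      unfolding t_def[symmetric] real_norm_def eq by linarith
  qed
qed measurable

lemma llogl_integrable_bounded_by:
  assumes h: "h \<in> borel_measurable M" "\<And>x. \<bar>h x\<bar> \<le> l * \<bar>f x\<bar>" and "l \<ge> 0"
  shows "integrable M (\<lambda>x. \<bar>h x\<bar> * ln (1 + \<bar>h x\<bar>))"
proof (rule Bochner_Integration.integrable_bound[OF llogl_scaled_integrable[OF \<open>l \<ge> 0\<close>]])
  show "AE x in M. norm (\<bar>h x\<bar> * ln (1 + \<bar>h x\<bar>)) \<le> norm (l * \<bar>f x\<bar> * ln (1 + l * \<bar>f x\<bar>))"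
  proof (rule AE_I2)
    fix x
    have "\<bar>h x\<bar> * ln (1 + \<bar>h x\<bar>) \<le> l * \<bar>f x\<bar> * ln (1 + l * \<bar>f x\<bar>)"
      by (rule llogl_mono[OF _ h(2)]) simp
    moreover have "0 \<le> \<bar>h x\<bar> * ln (1 + \<bar>h x\<bar>)" by simp
    ultimately show "norm (\<bar>h x\<bar> * ln (1 + \<bar>h x\<bar>)) \<le> norm (l * \<bar>f x\<bar> * ln (1 + l * \<bar>f x\<bar>))"
      unfolding real_norm_def by linarith
  qed
qed (use h(1) in measurable)

text \<open>Dominated convergence on the tails of \<open>f\<close>. The bound is 1 whatever
  \<open>l\<close> is and only the threshold \<open>k\<close> depends on \<open>l\<close>, so one
  constant from \<open>a_priori\<close> serves all rescaled differences.\<close>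

lemma llogl_tail_small:
  assumes "l \<ge> 0"
  shows "\<exists>k. \<forall>n\<ge>k. \<forall>m\<ge>k.
    (LINT x|M. \<bar>l * (f_trunc n x - f_trunc m x)\<bar> * ln (1 + \<bar>l * (f_trunc n x - f_trunc m x)\<bar>)) \<le> 1"
proof -
  define g where "g k x = (if \<bar>f x\<bar> \<le> real k then 0 else l * \<bar>f x\<bar> * ln (1 + l * \<bar>f x\<bar>))" for k :: nat and x
  have nonneg: "l * \<bar>f x\<bar> * ln (1 + l * \<bar>f x\<bar>) \<ge> 0" for x
    using assms by simp
  have gm: "g k \<in> borel_measurable M" for k unfolding g_def by measurable
  have gb: "AE x in M. norm (g k x) \<le> l * \<bar>f x\<bar> * ln (1 + l * \<bar>f x\<bar>)" for k
    using nonneg by (intro AE_I2) (auto simp: g_def)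
  have "(\<lambda>k. LINT x|M. g k x) \<longlonglongrightarrow> (LINT x|M. 0)"
  proof (rule integral_dominated_convergence[OF _ gm llogl_scaled_integrable[OF assms] _ gb])
    have "(\<lambda>k. g k x) \<longlonglongrightarrow> 0" for x
    proof (rule tendsto_eventually)
      obtain k0 where "\<bar>f x\<bar> \<le> real k0" using real_arch_simple by blast
      then show "eventually (\<lambda>k. g k x = 0) sequentially"
        by (intro eventually_sequentiallyI[of k0]) (auto simp: g_def)
    qed
    then show "AE x in M. (\<lambda>k. g k x) \<longlonglongrightarrow> 0" by simp
  qed simp
  then have "eventually (\<lambda>k. (LINT x|M. g k x) < 1) sequentially"
    by (intro order_tendstoD(2)[of _ "LINT x|M. 0"]) auto
  then obtain k where k: "(LINT x|M. g k x) < 1" by (auto simp: eventually_sequentially)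
  have "(LINT x|M. \<bar>l * (f_trunc n x - f_trunc m x)\<bar> * ln (1 + \<bar>l * (f_trunc n x - f_trunc m x)\<bar>)) \<le> 1"
    if nm: "n \<ge> k" "m \<ge> k" for n m
  proof -
    have le: "\<bar>l * (f_trunc n x - f_trunc m x)\<bar> \<le> (if \<bar>f x\<bar> \<le> real k then 0 else l * \<bar>f x\<bar>)" for x
      using mult_left_mono[OF f_trunc_diff[OF nm] assms, of x] assms by (auto simp: abs_mult split: if_splits)
    have le': "\<bar>l * (f_trunc n x - f_trunc m x)\<bar> \<le> l * \<bar>f x\<bar>" for x
      using le[of x] assms by (auto split: if_splits)
    have "(LINT x|M. \<bar>l * (f_trunc n x - f_trunc m x)\<bar> * ln (1 + \<bar>l * (f_trunc n x - f_trunc m x)\<bar>)) \<le> (LINT x|M. g k x)"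
    proof (rule integral_mono)
      show "integrable M (\<lambda>x. \<bar>l * (f_trunc n x - f_trunc m x)\<bar> * ln (1 + \<bar>l * (f_trunc n x - f_trunc m x)\<bar>))"
        by (rule llogl_integrable_bounded_by[OF _ le' assms]) measurable
      show "integrable M (g k)"
        by (rule Bochner_Integration.integrable_bound[OF llogl_scaled_integrable[OF assms] gm])
          (use nonneg in \<open>auto simp: g_def\<close>)
      show "\<bar>l * (f_trunc n x - f_trunc m x)\<bar> * ln (1 + \<bar>l * (f_trunc n x - f_trunc m x)\<bar>) \<le> g k x" for x
        using llogl_mono[OF abs_ge_zero le[of x]] by (simp add: g_def split: if_splits)
    qed
    then show ?thesis using k by linarith
  qed
  then show ?thesis by blast
qed

lemma approximations_exist: "\<exists>v. \<forall>n. approx_sol (f_trunc n) (inverse (real (Suc n))) (v n)"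
  by (intro choice allI approx_sol_exists[OF f_trunc_measurable f_trunc_bounds(1)]) simp

text \<open>The order of choices matters: first the constants, then \<open>l\<close> so large that
  the difference estimate falls below \<open>e\<close>, and only then the indices, which make the
  data and the slack of the rescaled difference small enough for that \<open>l\<close>.\<close>

lemma approximations_cauchy:
  assumes v: "\<And>n. approx_sol (f_trunc n) (inverse (real (Suc n))) (v n)" and "e > 0"
  shows "\<exists>n0. \<forall>n\<ge>n0. \<forall>m\<ge>n0.
    (LINT x|M. norm (grad (v n) x - grad (v m) x)) \<le> e \<and>
    (LINT x|M. norm (weight p (v n x) powr p *\<^sub>R grad (v n) x - weight p (v m x) powr p *\<^sub>R grad (v m) x)) \<le> e"
proof -
  \<comment> \<open>The factors 1 give the integrand the shape of
    \<open>llogl_scaled_integrable\<close> for \<open>l = 1\<close>.\<close>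
  define H where "H = (LINT x|M. 1 * \<bar>f x\<bar> * ln (1 + 1 * \<bar>f x\<bar>))"
  have H: "H \<ge> 0" unfolding H_def by (intro Bochner_Integration.integral_nonneg) simp
  obtain C1 where C1: "C1 > 0" "\<And>w h \<delta>. integrable M h \<Longrightarrow> integrable M (\<lambda>x. \<bar>h x\<bar> * ln (1 + \<bar>h x\<bar>)) \<Longrightarrow>
      (LINT x|M. \<bar>h x\<bar> * ln (1 + \<bar>h x\<bar>)) \<le> H \<Longrightarrow> approx_sol h \<delta> w \<Longrightarrow> \<delta> \<le> 1 \<Longrightarrow>
      (LINT x|M. (norm (grad w x))\<^sup>2 / weight p (w x)) \<le> C1 \<and> (LINT x|M. weight p (w x) powr (1 + 2 * p)) \<le> C1"
    using a_priori[OF H] by blast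
  obtain C2 where C2: "C2 > 0" "\<And>w h \<delta>. integrable M h \<Longrightarrow> integrable M (\<lambda>x. \<bar>h x\<bar> * ln (1 + \<bar>h x\<bar>)) \<Longrightarrow>
      (LINT x|M. \<bar>h x\<bar> * ln (1 + \<bar>h x\<bar>)) \<le> 1 \<Longrightarrow> approx_sol h \<delta> w \<Longrightarrow> \<delta> \<le> 1 \<Longrightarrow>
      (LINT x|M. (norm (grad w x))\<^sup>2 / weight p (w x)) \<le> C2 \<and> (LINT x|M. weight p (w x) powr (1 + 2 * p)) \<le> C2"
    using a_priori[of 1] by auto
  define C where "C = max C1 C2"
  have vC: "(LINT x|M. (norm (grad (v n) x))\<^sup>2 / weight p (v n x)) \<le> C \<and>
      (LINT x|M. weight p (v n x) powr (1 + 2 * p)) \<le> C" for n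
  proof -
    have int: "integrable M (\<lambda>x. \<bar>f_trunc n x\<bar> * ln (1 + \<bar>f_trunc n x\<bar>))"
      by (rule llogl_integrable_bounded_by[of _ 1]) (auto simp: f_trunc_bounds)
    have "(LINT x|M. \<bar>f_trunc n x\<bar> * ln (1 + \<bar>f_trunc n x\<bar>)) \<le> H"
      unfolding H_def
      using llogl_mono[OF abs_ge_zero f_trunc_bounds(2)[of n]] llogl_scaled_integrable[of 1] int
      by (intro integral_mono) auto
    moreover have "inverse (real (Suc n)) \<le> 1" by (simp add: field_simps)
    ultimately show ?thesis
      using C1(2)[OF f_trunc_integrable int _ v] by (auto simp: C_def)
  qed
  have "((\<lambda>l. 3 * C / l + 3 * C * l powr (- p)) \<longlongrightarrow> 0 + 3 * C * 0) at_top"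
    using p_pos by (intro tendsto_add tendsto_mult tendsto_const tendsto_neg_powr filterlim_ident
        real_tendsto_divide_at_top[OF tendsto_const filterlim_ident]) auto
  then have "eventually (\<lambda>l. 3 * C / l + 3 * C * l powr (- p) < e) at_top"
    using \<open>e > 0\<close> by (intro order_tendstoD(2)) auto
  then have "eventually (\<lambda>l. 3 * C / l + 3 * C * l powr (- p) < e \<and> l > 0) at_top"
    using eventually_gt_at_top[of 0] by eventually_elim simp
  then obtain l where l: "3 * C / l + 3 * C * l powr (- p) < e" "l > 0"
    by (auto dest!: eventually_happens)
  obtain k where k: "\<And>n m. n \<ge> k \<Longrightarrow> m \<ge> k \<Longrightarrow>
    (LINT x|M. \<bar>l * (f_trunc n x - f_trunc m x)\<bar> * ln (1 + \<bar>l * (f_trunc n x - f_trunc m x)\<bar>)) \<le> 1"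
    using llogl_tail_small[of l] l(2) by auto
  \<comment> \<open>From index \<open>j\<close> on the slack of the rescaled difference is at most
    \<open>4 * l\<^sup>2 / real (Suc j)\<close>, hence at most 1 as \<open>a_priori\<close>
    requires.\<close>
  obtain j where j: "real j \<ge> 4 * l\<^sup>2" using real_arch_simple by blast
  show ?thesis
  proof (intro exI[of _ "max k j"] allI impI)
    fix n m assume nm: "n \<ge> max k j" "m \<ge> max k j"
    have inv: "inverse (real (Suc i)) \<le> inverse (real (Suc j))" if "i \<ge> j" for i
      using that by (intro le_imp_inverse_le) auto
    have "2 * l\<^sup>2 * (inverse (real (Suc n)) + inverse (real (Suc m))) \<le>
        2 * l\<^sup>2 * (inverse (real (Suc j)) + inverse (real (Suc j)))"
      using nm by (intro mult_left_mono add_mono inv) auto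
    also have "\<dots> = 4 * l\<^sup>2 / real (Suc j)" by (simp add: field_simps)
    also have "\<dots> \<le> 1" using j by (simp add: field_simps)
    finally have \<delta>: "2 * l\<^sup>2 * (inverse (real (Suc n)) + inverse (real (Suc m))) \<le> 1" .
    have as: "approx_sol (\<lambda>x. l * (f_trunc n x - f_trunc m x))
        (2 * l\<^sup>2 * (inverse (real (Suc n)) + inverse (real (Suc m)))) (\<lambda>x. l * (v n x - v m x))"
      by (rule approx_sol_diff[OF f_trunc_integrable f_trunc_integrable v v])
    have "\<bar>l * (f_trunc n x - f_trunc m x)\<bar> \<le> 2 * l * \<bar>f x\<bar>" for x
    proof -
      have "\<bar>f_trunc n x - f_trunc m x\<bar> \<le> 2 * \<bar>f x\<bar>"
        using f_trunc_bounds(2)[of n x] f_trunc_bounds(2)[of m x] by linarith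
      then show ?thesis using mult_left_mono[of _ _ l] l(2) by (fastforce simp: abs_mult)
    qed
    then have int: "integrable M (\<lambda>x. \<bar>l * (f_trunc n x - f_trunc m x)\<bar> * ln (1 + \<bar>l * (f_trunc n x - f_trunc m x)\<bar>))"
      by (intro llogl_integrable_bounded_by[of _ "2 * l"]) (use l in auto)
    have dC: "(LINT x|M. (norm (grad (\<lambda>x. l * (v n x - v m x)) x))\<^sup>2 / weight p (l * (v n x - v m x))) \<le> C"
      "(LINT x|M. weight p (l * (v n x - v m x)) powr (1 + 2 * p)) \<le> C"
      using C2(2)[OF _ int k as \<delta>] nm f_trunc_integrable by (auto simp: C_def)
    have t: "v i \<in> test_functions \<Omega>" for i using v by (simp add: approx_sol_def)
    show "(LINT x|M. norm (grad (v n) x - grad (v m) x)) \<le> e \<and>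
      (LINT x|M. norm (weight p (v n x) powr p *\<^sub>R grad (v n) x - weight p (v m x) powr p *\<^sub>R grad (v m) x)) \<le> e"
      using gradient_difference_estimate[OF t t l(2) _ dC(1) _ _ dC(2), of] vC l(1) by fastforce
  qed
qed

end

section \<open>Passage to the limit\<close>

context llogl_problem
begin

text \<open>Functions and both kinds of gradient form one vector-valued sequence, so a single
  subsequence converges almost everywhere for all three. The pointwise identity \<open>Z_eq\<close>
  thereby survives as the relation between \<open>G\<close> and \<open>V\<close>.\<close>

lemma approximations_limit:
  assumes v: "\<And>n. approx_sol (f_trunc n) (inverse (real (Suc n))) (v n)"
  obtains r u G V where "strict_mono (r :: nat \<Rightarrow> nat)"
    "integrable M u" "integrable M G" "integrable M V"
    "AE x in M. G x = (1 + \<bar>u x\<bar>) powr (p / (1 + p)) *\<^sub>R V x"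
    "(\<lambda>k. LINT x|M. \<bar>transform p (v (r k) x) - u x\<bar>) \<longlonglongrightarrow> 0"
    "(\<lambda>k. LINT x|M. norm (weight p (v (r k) x) powr p *\<^sub>R grad (v (r k)) x - G x)) \<longlonglongrightarrow> 0"
    "(\<lambda>k. LINT x|M. norm (grad (v (r k)) x - V x)) \<longlonglongrightarrow> 0"
proof -
  define z where "z n x = transform p (v n x)" for n x
  define Z where "Z n x = weight p (v n x) powr p *\<^sub>R grad (v n) x" for n x
  define g where "g n x = (z n x, Z n x, grad (v n) x)" for n x
  have t: "v n \<in> test_functions \<Omega>" for n using v by (simp add: approx_sol_def)
  have C: "C1c \<Omega> (z n) (Z n)" for n
    using C1c_transform[OF t] unfolding z_def[abs_def] Z_def[abs_def] .
  note c = C1c_D(2,3)[OF C] continuous_test(2)[OF t]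
  have ig: "integrable M (g n)" for n
    unfolding g_def by (intro integrable_continuous continuous_intros c)
  define K where "K = 1 + measure lebesgue \<Omega>"
  have K: "K > 0" by (simp add: K_def add_pos_nonneg)
  have "\<exists>n0. \<forall>n\<ge>n0. \<forall>m\<ge>n0. (LINT x|M. norm (g n x - g m x)) \<le> e" if "e > 0" for e
  proof -
    have "e / (K + 2) > 0" using that K by simp
    from approximations_cauchy[OF v this] obtain n0 where n0: "\<And>n m. n \<ge> n0 \<Longrightarrow> m \<ge> n0 \<Longrightarrow>
      (LINT x|M. norm (grad (v n) x - grad (v m) x)) \<le> e / (K + 2) \<and>
      (LINT x|M. norm (Z n x - Z m x)) \<le> e / (K + 2)"
      unfolding Z_def by blast
    have "(LINT x|M. norm (g n x - g m x)) \<le> e" if nm: "n \<ge> n0" "m \<ge> n0" for n m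
    proof -
      have i: "integrable M (\<lambda>x. \<bar>z n x - z m x\<bar>)" "integrable M (\<lambda>x. norm (Z n x - Z m x))"
        "integrable M (\<lambda>x. norm (grad (v n) x - grad (v m) x))"
        by (intro integrable_continuous continuous_intros c)+
      have "(LINT x|M. norm (g n x - g m x)) \<le>
          (LINT x|M. \<bar>z n x - z m x\<bar> + (norm (Z n x - Z m x) + norm (grad (v n) x - grad (v m) x)))"
      proof (rule integral_mono)
        show "integrable M (\<lambda>x. norm (g n x - g m x))"
          by (intro integrable_norm Bochner_Integration.integrable_diff ig)
        show "norm (g n x - g m x) \<le> \<bar>z n x - z m x\<bar> + (norm (Z n x - Z m x) + norm (grad (v n) x - grad (v m) x))" for x
          unfolding g_def
          using norm_Pair_le[of "z n x - z m x" "(Z n x - Z m x, grad (v n) x - grad (v m) x)"]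
            norm_Pair_le[of "Z n x - Z m x" "grad (v n) x - grad (v m) x"] by simp
      qed (intro Bochner_Integration.integrable_add i)
      also have "\<dots> = (LINT x|M. \<bar>z n x - z m x\<bar>) + ((LINT x|M. norm (Z n x - Z m x)) + (LINT x|M. norm (grad (v n) x - grad (v m) x)))"
        using i by simp
      also have "\<dots> \<le> K * (e / (K + 2)) + (e / (K + 2) + e / (K + 2))"
      proof (intro add_mono)
        \<comment> \<open>The Cauchy property is available for gradients only; the Poincare
          inequality passes it on to the functions.\<close>
        have "(LINT x|M. \<bar>z n x - z m x\<bar>) \<le> K * (LINT x|M. norm (Z n x - Z m x))"
          unfolding K_def using dim by (intro poincare[OF C1c_diff[OF C C]]) simp
        also have "\<dots> \<le> K * (e / (K + 2))" using n0[OF nm] K by (intro mult_left_mono) auto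
        finally show "(LINT x|M. \<bar>z n x - z m x\<bar>) \<le> K * (e / (K + 2))" .
      qed (use n0[OF nm] in auto)
      also have "\<dots> = (K + 2) * (e / (K + 2))" by (simp only: distrib_right mult_2)
      also have "\<dots> = e" using K by simp
      finally show ?thesis .
    qed
    then show ?thesis by blast
  qed
  then obtain r F where r: "strict_mono r" and F: "integrable M F"
    "AE x in M. (\<lambda>k. g (r k) x) \<longlonglongrightarrow> F x" "(\<lambda>k. LINT x|M. norm (g (r k) x - F x)) \<longlonglongrightarrow> 0"
    by (rule L1_complete[OF ig])
  define u where "u x = fst (F x)" for x
  define G where "G x = fst (snd (F x))" for x
  define V where "V x = snd (snd (F x))" for x
  have iF: "integrable M u" "integrable M G" "integrable M V"
    unfolding u_def G_def V_def
    by (intro integrable_bounded_linear[OF bounded_linear_fst] integrable_bounded_linear[OF bounded_linear_snd] F(1))+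
  have lim: "(\<lambda>k. LINT x|M. norm (h (r k) x - H x)) \<longlonglongrightarrow> 0"
    if h: "\<And>n. integrable M (h n)" "integrable M H" and le: "\<And>n x. norm (h n x - H x) \<le> norm (g n x - F x)"
    for h :: "nat \<Rightarrow> real^'n \<Rightarrow> 'c::{banach,second_countable_topology}" and H
  proof (rule tendsto_sandwich[OF _ _ tendsto_const F(3)])
    show "eventually (\<lambda>k. 0 \<le> (LINT x|M. norm (h (r k) x - H x))) sequentially"
      by (intro always_eventually allI Bochner_Integration.integral_nonneg) simp
    show "eventually (\<lambda>k. (LINT x|M. norm (h (r k) x - H x)) \<le> (LINT x|M. norm (g (r k) x - F x))) sequentially"
      by (intro always_eventually allI integral_mono le integrable_norm Bochner_Integration.integrable_diff h ig F(1))
  qed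
  have iz: "integrable M (z n)" "integrable M (Z n)" "integrable M (grad (v n))" for n
    by (intro integrable_continuous c)+
  have comp: "g n x - F x = (z n x - u x, Z n x - G x, grad (v n) x - V x)" for n x
    by (simp add: g_def u_def G_def V_def prod_eq_iff)
  have n1: "norm (z n x - u x) \<le> norm (g n x - F x)" for n x
    unfolding comp using norm_fst_le[of "z n x - u x" "(Z n x - G x, grad (v n) x - V x)"] by simp
  have n0: "norm (Z n x - G x, grad (v n) x - V x) \<le> norm (g n x - F x)" for n x
    unfolding comp using norm_snd_le[of "(Z n x - G x, grad (v n) x - V x)" "z n x - u x"] by simp
  have n2: "norm (Z n x - G x) \<le> norm (g n x - F x)" for n x
    using order_trans[OF norm_fst_le[of "Z n x - G x" "grad (v n) x - V x"] n0] by simp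
  have n3: "norm (grad (v n) x - V x) \<le> norm (g n x - F x)" for n x
    using order_trans[OF norm_snd_le[of "grad (v n) x - V x" "Z n x - G x"] n0] by simp
  have Z_eq: "Z n x = (1 + \<bar>z n x\<bar>) powr (p / (1 + p)) *\<^sub>R grad (v n) x" for n x
    using p_pos by (simp add: Z_def z_def one_plus_abs_transform powr_powr)
  have ae: "AE x in M. G x = (1 + \<bar>u x\<bar>) powr (p / (1 + p)) *\<^sub>R V x"
    using F(2)
  proof eventually_elim
    case (elim x)
    have l1: "(\<lambda>k. z (r k) x) \<longlonglongrightarrow> u x" using tendsto_fst[OF elim] by (simp add: g_def u_def)
    have l2: "(\<lambda>k. Z (r k) x) \<longlonglongrightarrow> G x" using tendsto_fst[OF tendsto_snd[OF elim]] by (simp add: g_def G_def)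
    have l3: "(\<lambda>k. grad (v (r k)) x) \<longlonglongrightarrow> V x" using tendsto_snd[OF tendsto_snd[OF elim]] by (simp add: g_def V_def)
    have "1 + \<bar>u x\<bar> \<noteq> 0" by simp
    then have "(\<lambda>k. (1 + \<bar>z (r k) x\<bar>) powr (p / (1 + p)) *\<^sub>R grad (v (r k)) x) \<longlonglongrightarrow> (1 + \<bar>u x\<bar>) powr (p / (1 + p)) *\<^sub>R V x"
      by (intro tendsto_scaleR tendsto_powr tendsto_add tendsto_rabs tendsto_const l1 l3)
    then show ?case using l2 LIMSEQ_unique unfolding Z_eq by blast
  qed
  show ?thesis
    by (rule that[OF r iF ae]) (use lim[OF iz(1) iF(1) n1] lim[OF iz(2) iF(2) n2] lim[OF iz(3) iF(3) n3]
        in \<open>simp_all add: z_def Z_def\<close>)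
qed

text \<open>Integration by parts holds for each \<open>z k\<close>, and both of its sides are
  pairings with bounded functions, which are continuous in \<open>L^1\<close>.\<close>

lemma L1_limit_weak_gradient:
  assumes C: "\<And>k. C1c \<Omega> (z k) (Z k)" and i: "integrable M u" "integrable M G"
    and lim: "(\<lambda>k. LINT x|M. \<bar>z k x - u x\<bar>) \<longlonglongrightarrow> 0" "(\<lambda>k. LINT x|M. norm (Z k x - G x)) \<longlonglongrightarrow> 0"
  shows "has_weak_gradient u G \<Omega>"
  unfolding has_weak_gradient_def
proof (intro conjI i ballI allI)
  fix \<phi> j assume \<phi>: "\<phi> \<in> test_functions \<Omega>"
  note C\<phi> = C1c_grad[OF \<phi>]
  obtain B where "B > 0" and B: "\<And>x. \<bar>\<phi> x\<bar> \<le> B" "\<And>x. norm (grad \<phi> x) \<le> B"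
      using C1c_bounded[OF C\<phi>] by blast
  have iz: "integrable M (z k)" "integrable M (Z k)" for k
    by (rule integrable_continuous[OF C1c_D(3)[OF C]], rule integrable_continuous[OF C1c_D(2)[OF C]])
  have m: "\<phi> \<in> borel_measurable M" "grad \<phi> \<in> borel_measurable M"
    using continuous_test[OF \<phi>] by (auto intro: continuous_imp_measurable)
  have "(\<lambda>k. LINT x|M. z k x \<bullet> (grad \<phi> x \<bullet> axis j 1)) \<longlonglongrightarrow> (LINT x|M. u x \<bullet> (grad \<phi> x \<bullet> axis j 1))"
  proof (rule L1_limit_inner[where B = B])
    show "AE x in M. norm (grad \<phi> x \<bullet> axis j 1) \<le> B"
      using order_trans[OF component_le_norm_cart B(2)] by (intro AE_I2) (simp add: inner_axis)
  qed (use iz i lim m in auto)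
  moreover have l2: "(\<lambda>k. LINT x|M. Z k x \<bullet> (\<phi> x *\<^sub>R axis j 1)) \<longlonglongrightarrow> (LINT x|M. G x \<bullet> (\<phi> x *\<^sub>R axis j 1))"
    by (rule L1_limit_inner[where B = B]) (use iz i lim m B in auto)
  moreover have eq: "(LINT x|M. z k x \<bullet> (grad \<phi> x \<bullet> axis j 1)) = - (LINT x|M. Z k x \<bullet> (\<phi> x *\<^sub>R axis j 1))" for k
    using C1c_integration_by_parts[OF open_\<Omega> bounded_\<Omega> C C\<phi>, of k "axis j 1"] by (simp add: mult.commute)
  ultimately have "(LINT x|M. u x \<bullet> (grad \<phi> x \<bullet> axis j 1)) = - (LINT x|M. G x \<bullet> (\<phi> x *\<^sub>R axis j 1))"
    unfolding eq using tendsto_minus[OF l2] LIMSEQ_unique by blast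
  then show "(LINT x|M. u x * grad \<phi> x $ j) = - (LINT x|M. G x $ j * \<phi> x)"
    by (simp add: inner_axis mult.commute)
qed

lemma has_weak_gradient_diff_test:
  assumes u: "has_weak_gradient u G \<Omega>" and \<phi>: "\<phi> \<in> test_functions \<Omega>"
  shows "has_weak_gradient (\<lambda>x. u x - \<phi> x) (\<lambda>x. G x - grad \<phi> x) \<Omega>"
proof -
  have iu: "integrable M u" "integrable M G" using u by (auto simp: has_weak_gradient_def)
  have i\<phi>: "integrable M \<phi>" "integrable M (grad \<phi>)"
    by (rule integrable_continuous, rule continuous_test[OF \<phi>])+
  have "(LINT x|M. (u x - \<phi> x) * grad \<psi> x $ j) = - (LINT x|M. (G x - grad \<phi> x) $ j * \<psi> x)"
    if \<psi>: "\<psi> \<in> test_functions \<Omega>" for \<psi> j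
  proof -
    obtain B where "B > 0" and B: "\<And>x. \<bar>\<psi> x\<bar> \<le> B" "\<And>x. norm (grad \<psi> x) \<le> B"
      using C1c_bounded[OF C1c_grad[OF \<psi>]] by blast
    have Bj: "\<bar>grad \<psi> x $ j\<bar> \<le> B" for x using order_trans[OF component_le_norm_cart B(2)] .
    have cj: "continuous_on UNIV (\<lambda>x. grad \<psi> x $ j)" by (intro continuous_intros continuous_test \<psi>)
    have iGj: "integrable M (\<lambda>x. G x $ j)" "integrable M (\<lambda>x. grad \<phi> x $ j)"
      by (intro integrable_bounded_linear[OF bounded_linear_vec_nth] iu i\<phi>)+
    have "(LINT x|M. (u x - \<phi> x) * grad \<psi> x $ j) = (LINT x|M. u x * grad \<psi> x $ j) - (LINT x|M. \<phi> x * grad \<psi> x $ j)"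
      using integrable_mult_bounded_continuous[OF iu(1) cj Bj] integrable_mult_bounded_continuous[OF i\<phi>(1) cj Bj]
      by (simp add: left_diff_distrib)
    moreover have "(LINT x|M. (G x - grad \<phi> x) $ j * \<psi> x) = (LINT x|M. G x $ j * \<psi> x) - (LINT x|M. grad \<phi> x $ j * \<psi> x)"
      using integrable_mult_test[OF iGj(1) \<psi>] integrable_mult_test[OF iGj(2) \<psi>]
      by (simp add: left_diff_distrib)
    moreover have "(LINT x|M. \<phi> x * grad \<psi> x $ j) = - (LINT x|M. grad \<phi> x $ j * \<psi> x)"
      using C1c_integration_by_parts[OF open_\<Omega> bounded_\<Omega> C1c_grad[OF \<phi>] C1c_grad[OF \<psi>], of "axis j 1"]
      by (simp add: inner_axis)
    moreover have "(LINT x|M. u x * grad \<psi> x $ j) = - (LINT x|M. G x $ j * \<psi> x)"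
      using u \<psi> by (simp add: has_weak_gradient_def)
    ultimately show ?thesis by simp
  qed
  then show ?thesis using iu i\<phi> by (simp add: has_weak_gradient_def)
qed

text \<open>The functions \<open>g (v k x)\<close> need not be test functions, so the distance to
  \<open>u\<close> is bridged in two steps: first by the \<open>L^1\<close> convergence, then by a
  test function close to \<open>g (v k x)\<close> uniformly together with its gradient.\<close>

lemma L1_limit_W11_0:
  assumes t: "\<And>k. v k \<in> test_functions \<Omega>"
    and g: "\<And>s. (g has_field_derivative g' s) (at s)" "continuous_on UNIV g'" "g 0 = 0"
    and i: "integrable M u" "integrable M G"
    and lim: "(\<lambda>k. LINT x|M. \<bar>g (v k x) - u x\<bar>) \<longlonglongrightarrow> 0"
      "(\<lambda>k. LINT x|M. norm (g' (v k x) *\<^sub>R grad (v k) x - G x)) \<longlonglongrightarrow> 0"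
  shows "u \<in> W11_0 \<Omega>" "has_weak_gradient u G \<Omega>"
proof -
  have C: "C1c \<Omega> (\<lambda>x. g (v k x)) (\<lambda>x. g' (v k x) *\<^sub>R grad (v k) x)" for k
    by (rule C1c_compose[OF C1c_grad[OF t] g])
  show wg: "has_weak_gradient u G \<Omega>"
    by (rule L1_limit_weak_gradient[OF C i lim])
  have "\<exists>\<phi>\<in>test_functions \<Omega>. \<exists>H. has_weak_gradient (\<lambda>x. u x - \<phi> x) H \<Omega> \<and>
      (LINT x|M. \<bar>u x - \<phi> x\<bar>) + (LINT x|M. norm (H x)) < \<epsilon>" if "\<epsilon> > 0" for \<epsilon>
  proof -
    define \<mu> where "\<mu> = measure M \<Omega>"
    have \<mu>: "\<mu> \<ge> 0" by (simp add: \<mu>_def)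
    have "(\<lambda>k. (LINT x|M. \<bar>g (v k x) - u x\<bar>) + (LINT x|M. norm (g' (v k x) *\<^sub>R grad (v k) x - G x))) \<longlonglongrightarrow> 0 + 0"
      by (intro tendsto_add lim)
    then have "eventually (\<lambda>k. (LINT x|M. \<bar>g (v k x) - u x\<bar>) + (LINT x|M. norm (g' (v k x) *\<^sub>R grad (v k) x - G x)) < \<epsilon> / 2) sequentially"
      using that by (intro order_tendstoD(2)) auto
    then obtain k where k: "(LINT x|M. \<bar>g (v k x) - u x\<bar>) + (LINT x|M. norm (g' (v k x) *\<^sub>R grad (v k) x - G x)) < \<epsilon> / 2"
      by (auto simp: eventually_sequentially)
    \<comment> \<open>Two uniform errors of size \<open>e\<close> on a set of measure
      \<open>\<mu>\<close> must stay below the remaining \<open>\<epsilon> / 2\<close>; the 1 covers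
      \<open>\<mu> = 0\<close>.\<close>
    define e where "e = \<epsilon> / (4 * (1 + \<mu>))"
    have e: "e > 0" "2 * (e * \<mu>) < \<epsilon> / 2" using that \<mu> by (auto simp: e_def field_simps)
    obtain \<phi> where \<phi>: "\<phi> \<in> test_functions \<Omega>" "\<And>x. \<bar>\<phi> x - g (v k x)\<bar> \<le> e"
      "\<And>x. norm (grad \<phi> x - g' (v k x) *\<^sub>R grad (v k) x) \<le> e"
      using test_functions_approx_compose[OF t g e(1)] by blast
    have ik: "integrable M (\<lambda>x. g (v k x))" "integrable M (\<lambda>x. g' (v k x) *\<^sub>R grad (v k) x)"
      "integrable M \<phi>" "integrable M (grad \<phi>)"
      by (rule integrable_continuous[OF C1c_D(3)[OF C]], rule integrable_continuous[OF C1c_D(2)[OF C]],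
          (rule integrable_continuous, rule continuous_test[OF \<phi>(1)])+)
    have "(LINT x|M. \<bar>u x - \<phi> x\<bar>) \<le> (LINT x|M. \<bar>g (v k x) - u x\<bar> + e)"
    proof (rule integral_mono)
      show "\<bar>u x - \<phi> x\<bar> \<le> \<bar>g (v k x) - u x\<bar> + e" for x using \<phi>(2)[of x] by linarith
    qed (use i ik in auto)
    moreover have "(LINT x|M. norm (G x - grad \<phi> x)) \<le> (LINT x|M. norm (g' (v k x) *\<^sub>R grad (v k) x - G x) + e)"
    proof (rule integral_mono)
      show "norm (G x - grad \<phi> x) \<le> norm (g' (v k x) *\<^sub>R grad (v k) x - G x) + e" for x
        using \<phi>(3)[of x] norm_triangle_ineq[of "G x - g' (v k x) *\<^sub>R grad (v k) x" "g' (v k x) *\<^sub>R grad (v k) x - grad \<phi> x"]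
        by (simp add: norm_minus_commute)
    qed (use i ik in auto)
    moreover have "(LINT x|M. \<bar>g (v k x) - u x\<bar> + e) = (LINT x|M. \<bar>g (v k x) - u x\<bar>) + e * \<mu>"
      "(LINT x|M. norm (g' (v k x) *\<^sub>R grad (v k) x - G x) + e) = (LINT x|M. norm (g' (v k x) *\<^sub>R grad (v k) x - G x)) + e * \<mu>"
      using i ik by (simp_all add: \<mu>_def)
    ultimately have "(LINT x|M. \<bar>u x - \<phi> x\<bar>) + (LINT x|M. norm (G x - grad \<phi> x)) < \<epsilon>"
      using k e(2) by linarith
    with has_weak_gradient_diff_test[OF wg \<phi>(1)] \<phi>(1) show ?thesis by blast
  qed
  with wg show "u \<in> W11_0 \<Omega>" unfolding W11_0_def W11_def by blast
qed

text \<open>The equation is linear in the gradient, so its \<open>L^1\<close> convergence suffices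
  against the bounded field \<open>a x *\<^sub>R grad \<phi> x\<close>. The residual for the fixed
  \<open>\<phi>\<close> disappears with the slack.\<close>

lemma limit_equation:
  assumes v: "\<And>n. approx_sol (f_trunc n) (inverse (real (Suc n))) (v n)" and r: "strict_mono (r :: nat \<Rightarrow> nat)"
    and V: "integrable M V" "(\<lambda>k. LINT x|M. norm (grad (v (r k)) x - V x)) \<longlonglongrightarrow> 0"
    and \<phi>: "\<phi> \<in> test_functions \<Omega>"
  shows "(LINT x|M. (a x *\<^sub>R V x) \<bullet> grad \<phi> x) = (LINT x|M. f x * \<phi> x)"
proof -
  have t: "v n \<in> test_functions \<Omega>" for n using v by (simp add: approx_sol_def)
  obtain B where "B > 0" and B: "\<And>x. \<bar>\<phi> x\<bar> \<le> B" "\<And>x. norm (grad \<phi> x) \<le> B"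
      using C1c_bounded[OF C1c_grad[OF \<phi>]] by blast
  have m: "\<phi> \<in> borel_measurable M" "grad \<phi> \<in> borel_measurable M"
    using continuous_test[OF \<phi>] by (auto intro: continuous_imp_measurable)
  have "(\<lambda>k. LINT x|M. grad (v (r k)) x \<bullet> (a x *\<^sub>R grad \<phi> x)) \<longlonglongrightarrow> (LINT x|M. V x \<bullet> (a x *\<^sub>R grad \<phi> x))"
  proof (rule L1_limit_inner[where B = "\<beta> * B"])
    show "integrable M (grad (v (r k)))" for k by (intro integrable_continuous continuous_test t)
    show "(\<lambda>x. a x *\<^sub>R grad \<phi> x) \<in> borel_measurable M" using m by measurable
    show "AE x in M. norm (a x *\<^sub>R grad \<phi> x) \<le> \<beta> * B"
      using a_bounds
    proof eventually_elim
      case (elim x)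
      then show ?case using \<alpha>_pos B(2)[of x] by (simp add: mult_mono)
    qed
  qed (use V in auto)
  then have l1: "(\<lambda>k. energy (v (r k)) \<phi>) \<longlonglongrightarrow> (LINT x|M. (a x *\<^sub>R V x) \<bullet> grad \<phi> x)"
    by (simp add: energy_def)
  have "(\<lambda>n. LINT x|M. f_trunc n x * \<phi> x) \<longlonglongrightarrow> (LINT x|M. f x * \<phi> x)"
  proof (rule integral_dominated_convergence[where w = "\<lambda>x. \<bar>f x * \<phi> x\<bar>"])
    show "integrable M (\<lambda>x. \<bar>f x * \<phi> x\<bar>)"
      using integrable_mult_test[OF f_integrable \<phi>] by simp
    show "AE x in M. norm (f_trunc n x * \<phi> x) \<le> \<bar>f x * \<phi> x\<bar>" for n
      using f_trunc_bounds(2)[of n] by (intro AE_I2) (simp add: abs_mult mult_right_mono)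
    have "(\<lambda>n. f_trunc n x * \<phi> x) \<longlonglongrightarrow> f x * \<phi> x" for x
    proof (rule tendsto_eventually)
      obtain k0 where "\<bar>f x\<bar> \<le> real k0" using real_arch_simple by blast
      then show "eventually (\<lambda>n. f_trunc n x * \<phi> x = f x * \<phi> x) sequentially"
        by (intro eventually_sequentiallyI[of k0]) (auto intro!: f_trunc_eq)
    qed
    then show "AE x in M. (\<lambda>n. f_trunc n x * \<phi> x) \<longlonglongrightarrow> f x * \<phi> x" by simp
  qed (use m in auto)
  then have l2: "(\<lambda>k. LINT x|M. f_trunc (r k) x * \<phi> x) \<longlonglongrightarrow> (LINT x|M. f x * \<phi> x)"
    using LIMSEQ_subseq_LIMSEQ[OF _ r] by (simp add: o_def)
  define Q where "Q = (LINT x|M. (norm (grad \<phi> x))\<^sup>2)"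
  have lim0: "(\<lambda>k. inverse (real (Suc (r k))) * Q) \<longlonglongrightarrow> 0"
    using LIMSEQ_subseq_LIMSEQ[OF LIMSEQ_inverse_real_of_nat r]
    by (intro tendsto_mult_left_zero) (simp add: o_def)
  have le: "(energy (v n) \<phi> - (LINT x|M. f_trunc n x * \<phi> x))\<^sup>2 \<le> inverse (real (Suc n)) * Q" for n
    using v[of n] \<phi> unfolding approx_sol_def Q_def by blast
  have "(\<lambda>k. (energy (v (r k)) \<phi> - (LINT x|M. f_trunc (r k) x * \<phi> x))\<^sup>2) \<longlonglongrightarrow> 0"
  proof (rule tendsto_sandwich[OF _ _ tendsto_const lim0])
    show "eventually (\<lambda>k. (energy (v (r k)) \<phi> - (LINT x|M. f_trunc (r k) x * \<phi> x))\<^sup>2 \<le> inverse (real (Suc (r k))) * Q) sequentially"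
      by (intro always_eventually allI le)
  qed simp
  moreover have "(\<lambda>k. (energy (v (r k)) \<phi> - (LINT x|M. f_trunc (r k) x * \<phi> x))\<^sup>2) \<longlonglongrightarrow>
      ((LINT x|M. (a x *\<^sub>R V x) \<bullet> grad \<phi> x) - (LINT x|M. f x * \<phi> x))\<^sup>2"
    by (intro tendsto_intros l1 l2)
  ultimately have "((LINT x|M. (a x *\<^sub>R V x) \<bullet> grad \<phi> x) - (LINT x|M. f x * \<phi> x))\<^sup>2 = 0"
    using LIMSEQ_unique by blast
  then show ?thesis by simp
qed

text \<open>Dividing \<open>G\<close> by the degenerate factor gives back \<open>V\<close> almost
  everywhere, so the nonlinear flux of \<open>u\<close> is the linear flux
  \<open>a x *\<^sub>R V x\<close>, to which \<open>limit_equation\<close> applies.\<close>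

lemma solution_exists: "\<exists>u \<in> W11_0 \<Omega>. distributional_solution \<Omega> a (p / (1 + p)) f u"
proof -
  obtain v where v: "\<And>n. approx_sol (f_trunc n) (inverse (real (Suc n))) (v n)"
    using approximations_exist by blast
  have t: "v n \<in> test_functions \<Omega>" for n using v by (simp add: approx_sol_def)
  obtain r u G V where r: "strict_mono (r :: nat \<Rightarrow> nat)"
    and i: "integrable M u" "integrable M G" "integrable M V"
    and ae: "AE x in M. G x = (1 + \<bar>u x\<bar>) powr (p / (1 + p)) *\<^sub>R V x"
    and lim: "(\<lambda>k. LINT x|M. \<bar>transform p (v (r k) x) - u x\<bar>) \<longlonglongrightarrow> 0"
      "(\<lambda>k. LINT x|M. norm (weight p (v (r k) x) powr p *\<^sub>R grad (v (r k)) x - G x)) \<longlonglongrightarrow> 0"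
      "(\<lambda>k. LINT x|M. norm (grad (v (r k)) x - V x)) \<longlonglongrightarrow> 0"
    by (rule approximations_limit[OF v])
  have c: "continuous_on UNIV (\<lambda>s. weight p s powr p)"
    by (intro continuous_on_weight_powr p_pos continuous_on_id)
  have u: "u \<in> W11_0 \<Omega>" "has_weak_gradient u G \<Omega>"
    using L1_limit_W11_0[of "\<lambda>k. v (r k)", OF t DERIV_transform[OF p_pos] c _ i(1,2) lim(1,2)]
    by (auto simp: transform_def)
  have "(LINT x|M. ((a x / (1 + \<bar>u x\<bar>) powr (p / (1 + p))) *\<^sub>R G x) \<bullet> grad \<phi> x) = (LINT x|M. f x * \<phi> x)"
    if \<phi>: "\<phi> \<in> test_functions \<Omega>" for \<phi>
  proof -
    have [measurable]: "u \<in> borel_measurable M" "G \<in> borel_measurable M" "V \<in> borel_measurable M" "grad \<phi> \<in> borel_measurable M"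
      using i continuous_imp_measurable[OF continuous_test(2)[OF \<phi>]] by auto
    have "(LINT x|M. ((a x / (1 + \<bar>u x\<bar>) powr (p / (1 + p))) *\<^sub>R G x) \<bullet> grad \<phi> x) = (LINT x|M. (a x *\<^sub>R V x) \<bullet> grad \<phi> x)"
    proof (rule integral_cong_AE)
      show "AE x in M. ((a x / (1 + \<bar>u x\<bar>) powr (p / (1 + p))) *\<^sub>R G x) \<bullet> grad \<phi> x = (a x *\<^sub>R V x) \<bullet> grad \<phi> x"
        using ae
      proof eventually_elim
        case (elim x)
        have "(1 + \<bar>u x\<bar>) powr (p / (1 + p)) \<noteq> 0" by simp
        then show ?case unfolding elim by simp
      qed
    qed measurable
    also have "\<dots> = (LINT x|M. f x * \<phi> x)" by (rule limit_equation[OF v r i(3) lim(3) \<phi>])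
    finally show ?thesis .
  qed
  with u show ?thesis unfolding distributional_solution_def by blast
qed

end

theorem theorem1p2:
  fixes \<Omega> :: "(real ^ 'n) set"
    and a f :: "real ^ 'n \<Rightarrow> real"
    and \<alpha> \<beta> \<theta> :: real
  assumes "CARD('n) > 2"
    and "open \<Omega>" and "bounded \<Omega>"
    and "a \<in> borel_measurable (lebesgue_on \<Omega>)"
    and "\<alpha> > 0" and "\<beta> > 0"
    and "AE x in lebesgue_on \<Omega>. \<alpha> \<le> a x \<and> a x \<le> \<beta>"
    and "\<theta> = 1 / (real CARD('n) - 1)"
    and "integrable (lebesgue_on \<Omega>) f"
    and "integrable (lebesgue_on \<Omega>) (\<lambda>x. f x * ln (1 + \<bar>f x\<bar>))"
  shows "\<exists>u \<in> W11_0 \<Omega>. distributional_solution \<Omega> a \<theta> f u"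
proof -
  define p where "p = 1 / (real CARD('n) - 2)"
  interpret llogl_problem \<Omega> a \<alpha> \<beta> p f
    by unfold_locales (use assms in \<open>simp_all add: p_def\<close>)
  have "\<theta> = p / (1 + p)" using assms(1,8) by (simp add: p_def field_simps)
  then show ?thesis using solution_exists by simp
qed

end
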